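(* Let $m\ge1$. The sums over sylvester classes $$\mathbf{P}_T=\sum_{\mathrm{sylv}(\alpha)=T}\mathbf{F}_\alpha$$ in ${}^m\mathbf{FQSym}$ span a Hopf algebra ${}^m\mathbf{PBT}$, of graded dimension given by the Fuss-Catalan sequence $\frac{1}{mn+1}\binom{(m+1)n}{n}$. The dual basis $\mathbf{Q}_T$ of $\mathbf{P}_T$ in ${}^m\mathbf{PBT}^*$ is formed of the sylvester classes $\overline{\mathbf{G}}_\alpha$ for $\mathrm{sylv}(\alpha)=T$. Moreover, the product of two basis elements $\mathbf{P}_{T'}\mathbf{P}_{T''}$ in ${}^m\mathbf{PBT}$ spans an interval of the $m$-Tamari order. The bounds of this interval are obtained through the bijection between $(m+1)$-ary trees and $m$-binary trees: order recursively the nodes of the $(m+1)$-ary trees from left to right in the following way: the first $m$ subtrees in that order, then the root, then the right (last) subtree. The lower (resp. upper) bound of the product $\mathbf{P}_{T'}\mathbf{P}_{T''}$ consists in glueing $T'$ to the left-most node of $T''$ (resp. $T''$ to the right-most node of $T'$), hence copying the equivalent property in the Loday-Ronco algebra $\mathbf{PBT}$ of planar binary trees (the case $m=1$).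
   Context: $\mathbb{K}$ is a field of characteristic $0$; duals are graded duals. $\mathfrak{S}_n^{(m)}$ is the set of $m$-permutations of $n$: words over $\{1,\dots,n\}$ in which each letter occurs exactly $m$ times. An $m$-word is a word in which the number of occurrences of each letter is a multiple of $m$. The $m$-standardization $\mathrm{std}_m(w)$ of an $m$-word $w$ is obtained by iteratively scanning $w$ from left to right, labelling $1$ the first $m$ occurrences of the smallest letter, then $2$ the next $m$ occurrences of this letter or, if there are none left, the first $m$ occurrences of the next letter, and so on. ${}^m\mathbf{FQSym}$ is the graded Hopf algebra with basis $\mathbf{F}_\alpha$, $\alpha\in\mathfrak{S}_n^{(m)}$ (degree $n$), $n\ge0$, with product $\mathbf{F}_\alpha\mathbf{F}_\beta=\sum_{\gamma\in\alpha\Cup\beta}\mathbf{F}_\gamma$, where for $\alpha\in\mathfrak{S}_n^{(m)}$, $\alpha\Cup\beta$ is the shuffle of $\alpha$ with the word obtained from $\beta$ by adding $n$ to each letter, and coproduct $\Delta\mathbf{F}_\alpha=\sum\mathbf{F}_{\mathrm{std}_m(u)}\otimes\mathbf{F}_{\mathrm{std}_m(v)}$, sum over all factorizations $\alpha=u\cdot v$ with $u,v$ both $m$-words. $\mathbf{G}_\alpha$ denotes the dual basis of $\mathbf{F}_\alpha$ in ${}^m\mathbf{FQSym}^*$. The sylvester congruence on words is generated by $ac\,v\,b\equiv ca\,v\,b$ for letters $a\le b<c$ and any word $v$. ${}^m\mathbf{PBT}^*$ is identified with the quotient of ${}^m\mathbf{FQSym}^*$ by the relations $\mathbf{G}_\alpha=\mathbf{G}_\beta$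 for $\alpha,\beta$ sylvester congruent, and $\overline{\mathbf{G}}_\alpha$ is the class of $\mathbf{G}_\alpha$. The standardization $\mathrm{std}(w)$ is the permutation obtained by numbering $1,2,\ldots$ from left to right the occurrences of the smallest letter of $w$, then those of the next letter, and so on. Two $m$-permutations of $n$ are sylvester congruent iff the binary search trees obtained by inserting the letters of their standardizations from right to left have the same shape; these shapes (binary trees with $mn$ nodes) are the $m$-binary trees. Recursively, an $m$-binary tree is either empty or built from $m$-binary trees $T_R,T_{L_1},\dots,T_{L_m}$ and $m$ nodes $x_0,\dots,x_{m-1}$ as follows: $x_0$ is the root, with right subtree $T_R$; the left subtree of $x_i$ is $T_{L_{m-i}}$, and for $i<m-1$ the node $x_{i+1}$ is attached as right child of the right-most node of $T_{L_{m-i}}$ (as left child of $x_i$ if $T_{L_{m-i}}$ is empty). The bijection with $(m+1)$-ary trees with $n$ internal nodes is recursive: $T_{L_i}$ becomes the $i$-th subtree of the root and $T_R$ the right-most (last) subtree. Sylvester classes of $m$-permutations are thus labelled by $(m+1)$-ary trees, and $\mathrm{sylv}(\alpha)$ is the tree labelling the class of $\alpha$. The $m$-Tamari order is the restriction to $m$-binary trees with $mn$ nodes of the Tamari order on binary trees (oriented so that its covering relations are right rotations and its minimum is the left comb); this is Bergeron's $m$-Tamari lattice up to reversal.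
   Formalization: In finding the left-most node, the first m subtrees are visited in the order T_{L_m},…,T_{L_1}, not left to right; with the stated order the lower bound is false (m=2, T' one node, T'' a root with one-node T_{L_1} and T_{L_2}). T' is glued as first subtree of that node. *)

theory Defs
  imports
    Complex_Main
    "HOL-Library.Poly_Mapping"
    "HOL-Library.Tree"
    "HOL-Library.Function_Algebras"
begin

section \<open>Free vector spaces, tensor products and graded Hopf algebras\<close>

text \<open>
  The vector space with basis \<open>'a\<close> over \<open>'k\<close> is the type \<open>'a \<Rightarrow>\<^sub>0 'k\<close> of finitely supported
  functions; the tensor product of the spaces with bases \<open>'a\<close> and \<open>'b\<close> is the space with basis
  \<open>'a \<times> 'b\<close>.
\<close>

definition scl :: "'k::field \<Rightarrow> ('a \<Rightarrow>\<^sub>0 'k) \<Rightarrow> ('a \<Rightarrow>\<^sub>0 'k)"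
  where "scl c x = Poly_Mapping.map ((*) c) x"

lemma lookup_scl [simp]: "Poly_Mapping.lookup (scl c x) a = c * Poly_Mapping.lookup x a"
  by (simp add: scl_def Poly_Mapping.map.rep_eq when_def)

global_interpretation pm: vector_space "scl :: 'k::field \<Rightarrow> ('a \<Rightarrow>\<^sub>0 'k) \<Rightarrow> ('a \<Rightarrow>\<^sub>0 'k)"
  by unfold_locales (auto intro!: poly_mapping_eqI simp: lookup_add algebra_simps)

definition fscl :: "'k::field \<Rightarrow> ('v \<Rightarrow> 'k) \<Rightarrow> ('v \<Rightarrow> 'k)"
  where "fscl c f = (\<lambda>x. c * f x)"

global_interpretation fn: vector_space "fscl :: 'k::field \<Rightarrow> ('v \<Rightarrow> 'k) \<Rightarrow> ('v \<Rightarrow> 'k)"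
  by unfold_locales (auto simp: fscl_def fun_eq_iff algebra_simps)

abbreviation bas :: "'a \<Rightarrow> ('a \<Rightarrow>\<^sub>0 'k::field)"
  where "bas a \<equiv> Poly_Mapping.single a 1"

definition lin_ext :: "('a \<Rightarrow> ('b \<Rightarrow>\<^sub>0 'k)) \<Rightarrow> ('a \<Rightarrow>\<^sub>0 'k::field) \<Rightarrow> ('b \<Rightarrow>\<^sub>0 'k)"
  where "lin_ext f x = (\<Sum>a\<in>Poly_Mapping.keys x. scl (Poly_Mapping.lookup x a) (f a))"

definition tens :: "('a \<Rightarrow>\<^sub>0 'k::field) \<Rightarrow> ('b \<Rightarrow>\<^sub>0 'k) \<Rightarrow> ('a \<times> 'b \<Rightarrow>\<^sub>0 'k)"
  where "tens x y = lin_ext (\<lambda>a. lin_ext (\<lambda>b. bas (a, b)) y) x"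

text \<open>The linear map \<open>f \<otimes> g\<close>, for linear \<open>f\<close> and \<open>g\<close>.\<close>

definition tens_map ::
  "(('a \<Rightarrow>\<^sub>0 'k) \<Rightarrow> ('c \<Rightarrow>\<^sub>0 'k)) \<Rightarrow> (('b \<Rightarrow>\<^sub>0 'k) \<Rightarrow> ('d \<Rightarrow>\<^sub>0 'k)) \<Rightarrow>
    ('a \<times> 'b \<Rightarrow>\<^sub>0 'k::field) \<Rightarrow> ('c \<times> 'd \<Rightarrow>\<^sub>0 'k)"
  where "tens_map f g = lin_ext (\<lambda>(a, b). tens (f (bas a)) (g (bas b)))"

definition tens_assoc :: "(('a \<times> 'b) \<times> 'c \<Rightarrow>\<^sub>0 'k::field) \<Rightarrow> ('a \<times> 'b \<times> 'c \<Rightarrow>\<^sub>0 'k)"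
  where "tens_assoc = lin_ext (\<lambda>((a, b), c). bas (a, b, c))"

text \<open>The product \<open>(a \<otimes> b) (c \<otimes> d) = a c \<otimes> b d\<close>.\<close>

definition tens_mult ::
  "(('a \<Rightarrow>\<^sub>0 'k) \<Rightarrow> ('a \<Rightarrow>\<^sub>0 'k) \<Rightarrow> ('a \<Rightarrow>\<^sub>0 'k)) \<Rightarrow>
    ('a \<times> 'a \<Rightarrow>\<^sub>0 'k::field) \<Rightarrow> ('a \<times> 'a \<Rightarrow>\<^sub>0 'k) \<Rightarrow> ('a \<times> 'a \<Rightarrow>\<^sub>0 'k)"
  where "tens_mult mult z w =
    lin_ext (\<lambda>(a, b). lin_ext (\<lambda>(c, d).
      tens (mult (bas a) (bas c)) (mult (bas b) (bas d))) w) z"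

text \<open>
  A graded Hopf algebra with underlying space a subspace \<open>A\<close> of the free space on \<open>'a\<close> and
  homogeneous components \<open>H n\<close>.  The structure maps are restrictions to \<open>A\<close> of linear maps on the
  ambient space, which allows \<open>tens_map\<close> and \<open>tens_mult\<close> to be used; since \<open>comult\<close> maps \<open>A\<close> into
  \<open>A \<otimes> A\<close>, only their values on \<open>A\<close> matter.
\<close>

locale graded_hopf_algebra =
  fixes A :: "('a \<Rightarrow>\<^sub>0 'k::field) set"
    and H :: "nat \<Rightarrow> ('a \<Rightarrow>\<^sub>0 'k) set"
    and mult :: "('a \<Rightarrow>\<^sub>0 'k) \<Rightarrow> ('a \<Rightarrow>\<^sub>0 'k) \<Rightarrow> ('a \<Rightarrow>\<^sub>0 'k)"
    and one :: "'a \<Rightarrow>\<^sub>0 'k"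
    and comult :: "('a \<Rightarrow>\<^sub>0 'k) \<Rightarrow> ('a \<times> 'a \<Rightarrow>\<^sub>0 'k)"
    and counit :: "('a \<Rightarrow>\<^sub>0 'k) \<Rightarrow> 'k"
  assumes lin_mult_left: "Vector_Spaces.linear scl scl (\<lambda>x. mult x y)"
    and lin_mult_right: "Vector_Spaces.linear scl scl (mult x)"
    and lin_comult: "Vector_Spaces.linear scl scl comult"
    and lin_counit: "Vector_Spaces.linear scl (*) counit"
    and comp_subspace: "pm.subspace (H n)"
    and comp_span: "A = pm.span (\<Union>n. H n)"
    and comp_direct:
      "finite N \<Longrightarrow> (\<And>n. n \<in> N \<Longrightarrow> h n \<in> H n) \<Longrightarrow> (\<Sum>n\<in>N. h n) = 0 \<Longrightarrow> n \<in> N \<Longrightarrow> h n = 0"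
    and mult_deg: "x \<in> H p \<Longrightarrow> y \<in> H q \<Longrightarrow> mult x y \<in> H (p + q)"
    and one_deg: "one \<in> H 0"
    and comult_deg:
      "x \<in> H n \<Longrightarrow> comult x \<in> pm.span (\<Union>i\<le>n. {tens y z | y z. y \<in> H i \<and> z \<in> H (n - i)})"
    and counit_deg: "x \<in> H n \<Longrightarrow> n \<noteq> 0 \<Longrightarrow> counit x = 0"
    and mult_assoc:
      "x \<in> A \<Longrightarrow> y \<in> A \<Longrightarrow> z \<in> A \<Longrightarrow> mult (mult x y) z = mult x (mult y z)"
    and mult_one_left: "x \<in> A \<Longrightarrow> mult one x = x"
    and mult_one_right: "x \<in> A \<Longrightarrow> mult x one = x"
    and comult_coassoc:
      "x \<in> A \<Longrightarrow> tens_assoc (tens_map comult id (comult x)) = tens_map id comult (comult x)"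
    and counit_left: "x \<in> A \<Longrightarrow> lin_ext (\<lambda>(a, b). scl (counit (bas a)) (bas b)) (comult x) = x"
    and counit_right: "x \<in> A \<Longrightarrow> lin_ext (\<lambda>(a, b). scl (counit (bas b)) (bas a)) (comult x) = x"
    and comult_mult:
      "x \<in> A \<Longrightarrow> y \<in> A \<Longrightarrow> comult (mult x y) = tens_mult mult (comult x) (comult y)"
    and comult_one: "comult one = tens one one"
    and counit_mult: "x \<in> A \<Longrightarrow> y \<in> A \<Longrightarrow> counit (mult x y) = counit x * counit y"
    and counit_one: "counit one = 1"
    and antipode:
      "\<exists>S. Vector_Spaces.linear scl scl S \<and> (\<forall>n. S ` H n \<subseteq> H n) \<and>
        (\<forall>x\<in>A.
          lin_ext (\<lambda>(a, b). mult (S (bas a)) (bas b)) (comult x) = scl (counit x) one \<and>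
          lin_ext (\<lambda>(a, b). mult (bas a) (S (bas b))) (comult x) = scl (counit x) one)"

text \<open>
  The graded dual of \<open>A = \<Oplus>\<^sub>n H n\<close>; a functional on \<open>A\<close> is represented by its extension
  by \<open>0\<close> outside \<open>A\<close>.
\<close>

definition graded_dual ::
  "('a \<Rightarrow>\<^sub>0 'k::field) set \<Rightarrow> (nat \<Rightarrow> ('a \<Rightarrow>\<^sub>0 'k) set) \<Rightarrow> (('a \<Rightarrow>\<^sub>0 'k) \<Rightarrow> 'k) set"
  where "graded_dual A H =
    {f. (\<forall>x. x \<notin> A \<longrightarrow> f x = 0) \<and>
        (\<forall>x\<in>A. \<forall>y\<in>A. f (x + y) = f x + f y) \<and>
        (\<forall>c. \<forall>x\<in>A. f (scl c x) = c * f x) \<and>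
        (\<exists>N. \<forall>n\<ge>N. \<forall>x\<in>H n. f x = 0)}"

definition restrict_functional ::
  "('a \<Rightarrow>\<^sub>0 'k::field) set \<Rightarrow> (('a \<Rightarrow>\<^sub>0 'k) \<Rightarrow> 'k) \<Rightarrow> (('a \<Rightarrow>\<^sub>0 'k) \<Rightarrow> 'k)"
  where "restrict_functional A f = (\<lambda>x. if x \<in> A then f x else 0)"

text \<open>
  The coordinate functional of \<open>b \<in> B\<close>, where \<open>B\<close> is a basis of its span
  (\<open>pm.representation B x\<close> vanishes for \<open>x\<close> outside the span).
\<close>

definition coord :: "('a \<Rightarrow>\<^sub>0 'k::field) set \<Rightarrow> ('a \<Rightarrow>\<^sub>0 'k) \<Rightarrow> (('a \<Rightarrow>\<^sub>0 'k) \<Rightarrow> 'k)"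
  where "coord B b = (\<lambda>x. pm.representation B x b)"


section \<open>The Hopf algebra of \<open>m\<close>-permutations\<close>

definition mperms_of :: "nat \<Rightarrow> nat \<Rightarrow> nat list set"
  where "mperms_of m n = {w. set w \<subseteq> {1..n} \<and> (\<forall>i\<in>{1..n}. count_list w i = m)}"

definition mperms :: "nat \<Rightarrow> nat list set"
  where "mperms m = (\<Union>n. mperms_of m n)"

definition mword :: "nat \<Rightarrow> nat list \<Rightarrow> bool"
  where "mword m w \<longleftrightarrow> (\<forall>a. m dvd count_list w a)"

text \<open>
  Scanning the occurrences of the smallest letter from left to right, then those of the next letter,
  and so on, the occurrence at position \<open>i\<close> is preceded by all the smaller letters and by the equal
  letters to its left; a new label is used after every \<open>m\<close> occurrences.
\<close>

definition mstd :: "nat \<Rightarrow> nat list \<Rightarrow> nat list"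
  where "mstd m w =
    map (\<lambda>i. Suc ((card {j. j < length w \<and> w ! j < w ! i} + card {j. j < i \<and> w ! j = w ! i}) div m))
      [0..<length w]"

abbreviation std :: "nat list \<Rightarrow> nat list"
  where "std \<equiv> mstd 1"

text \<open>
  If \<open>\<alpha>\<close> is an \<open>m\<close>-permutation of \<open>n\<close>, then \<open>n = length \<alpha> div m\<close>.  The two words being shuffled have
  disjoint alphabets, so no word occurs twice in the shuffle.
\<close>

definition shifted_shuffle :: "nat \<Rightarrow> nat list \<Rightarrow> nat list \<Rightarrow> nat list set"
  where "shifted_shuffle m \<alpha> \<beta> = shuffles \<alpha> (map ((+) (length \<alpha> div m)) \<beta>)"

abbreviation F :: "nat list \<Rightarrow> (nat list \<Rightarrow>\<^sub>0 'k::field)"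
  where "F \<equiv> bas"

definition fqsym :: "nat \<Rightarrow> (nat list \<Rightarrow>\<^sub>0 'k::field) set"
  where "fqsym m = pm.span (F ` mperms m)"

definition fqsym_deg :: "nat \<Rightarrow> nat \<Rightarrow> (nat list \<Rightarrow>\<^sub>0 'k::field) set"
  where "fqsym_deg m n = pm.span (F ` mperms_of m n)"

definition fq_mult ::
  "nat \<Rightarrow> (nat list \<Rightarrow>\<^sub>0 'k::field) \<Rightarrow> (nat list \<Rightarrow>\<^sub>0 'k) \<Rightarrow> (nat list \<Rightarrow>\<^sub>0 'k)"
  where "fq_mult m x y =
    lin_ext (\<lambda>\<alpha>. lin_ext (\<lambda>\<beta>. \<Sum>\<gamma>\<in>shifted_shuffle m \<alpha> \<beta>. F \<gamma>) y) x"

definition fq_comult :: "nat \<Rightarrow> (nat list \<Rightarrow>\<^sub>0 'k::field) \<Rightarrow> (nat list \<times> nat list \<Rightarrow>\<^sub>0 'k)"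
  where "fq_comult m =
    lin_ext (\<lambda>\<alpha>. \<Sum>k\<in>{k. k \<le> length \<alpha> \<and> mword m (take k \<alpha>) \<and> mword m (drop k \<alpha>)}.
      tens (F (mstd m (take k \<alpha>))) (F (mstd m (drop k \<alpha>))))"

definition fq_counit :: "(nat list \<Rightarrow>\<^sub>0 'k::field) \<Rightarrow> 'k"
  where "fq_counit x = Poly_Mapping.lookup x []"

definition fqsym_dual :: "nat \<Rightarrow> ((nat list \<Rightarrow>\<^sub>0 'k::field) \<Rightarrow> 'k) set"
  where "fqsym_dual m = graded_dual (fqsym m) (fqsym_deg m)"

definition G :: "nat \<Rightarrow> nat list \<Rightarrow> ((nat list \<Rightarrow>\<^sub>0 'k::field) \<Rightarrow> 'k)"
  where "G m \<alpha> = coord (F ` mperms m) (F \<alpha>)"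

text \<open>The product of the dual, \<open>(f g)(x) = (f \<otimes> g)(\<Delta> x)\<close>.\<close>

definition fq_dual_mult ::
  "nat \<Rightarrow> ((nat list \<Rightarrow>\<^sub>0 'k::field) \<Rightarrow> 'k) \<Rightarrow> ((nat list \<Rightarrow>\<^sub>0 'k) \<Rightarrow> 'k) \<Rightarrow>
    ((nat list \<Rightarrow>\<^sub>0 'k) \<Rightarrow> 'k)"
  where "fq_dual_mult m f g = restrict_functional (fqsym m)
    (\<lambda>x. \<Sum>(u, v)\<in>Poly_Mapping.keys (fq_comult m x).
      Poly_Mapping.lookup (fq_comult m x) (u, v) * f (F u) * g (F v))"


section \<open>The sylvester congruence\<close>

inductive sylvester_step :: "nat list \<Rightarrow> nat list \<Rightarrow> bool"
  where "a \<le> b \<Longrightarrow> b < c \<Longrightarrow>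
    sylvester_step (u @ [a, c] @ v @ [b] @ w) (u @ [c, a] @ v @ [b] @ w)"

definition sylvester :: "nat list \<Rightarrow> nat list \<Rightarrow> bool"
  where "sylvester = equivclp sylvester_step"

text \<open>
  The ideal of the dual generated by the differences \<open>G\<^sub>\<alpha> - G\<^sub>\<beta>\<close> for sylvester congruent
  \<open>\<alpha>\<close> and \<open>\<beta>\<close>, and the quotient by it.
\<close>

inductive_set sylvester_ideal :: "nat \<Rightarrow> ((nat list \<Rightarrow>\<^sub>0 'k::field) \<Rightarrow> 'k) set" for m :: nat
  where
    gen: "\<alpha> \<in> mperms m \<Longrightarrow> \<beta> \<in> mperms m \<Longrightarrow> sylvester \<alpha> \<beta> \<Longrightarrow> G m \<alpha> - G m \<beta> \<in> sylvester_ideal m"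
  | zero: "0 \<in> sylvester_ideal m"
  | add: "f \<in> sylvester_ideal m \<Longrightarrow> g \<in> sylvester_ideal m \<Longrightarrow> f + g \<in> sylvester_ideal m"
  | scale: "f \<in> sylvester_ideal m \<Longrightarrow> fscl c f \<in> sylvester_ideal m"
  | mult_left:
      "f \<in> sylvester_ideal m \<Longrightarrow> g \<in> fqsym_dual m \<Longrightarrow> fq_dual_mult m g f \<in> sylvester_ideal m"
  | mult_right:
      "f \<in> sylvester_ideal m \<Longrightarrow> g \<in> fqsym_dual m \<Longrightarrow> fq_dual_mult m f g \<in> sylvester_ideal m"

definition sylvester_rel ::
  "nat \<Rightarrow> (((nat list \<Rightarrow>\<^sub>0 'k::field) \<Rightarrow> 'k) \<times> ((nat list \<Rightarrow>\<^sub>0 'k) \<Rightarrow> 'k)) set"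
  where "sylvester_rel m =
    {(f, g). f \<in> fqsym_dual m \<and> g \<in> fqsym_dual m \<and> f - g \<in> sylvester_ideal m}"

definition Gbar :: "nat \<Rightarrow> nat list \<Rightarrow> ((nat list \<Rightarrow>\<^sub>0 'k::field) \<Rightarrow> 'k) set"
  where "Gbar m \<alpha> = sylvester_rel m `` {G m \<alpha>}"


section \<open>Binary trees and the Tamari order\<close>

text \<open>Planar binary trees (without labels) have type \<open>unit tree\<close>.\<close>

fun bst_insert :: "nat \<Rightarrow> nat tree \<Rightarrow> nat tree"
  where
    "bst_insert x Leaf = Node Leaf x Leaf"
  | "bst_insert x (Node l a r) =
      (if x \<le> a then Node (bst_insert x l) a r else Node l a (bst_insert x r))"

text \<open>\<open>foldr\<close> inserts the last letter first.\<close>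

definition bst_shape :: "nat list \<Rightarrow> unit tree"
  where "bst_shape w = map_tree (\<lambda>_. ()) (foldr bst_insert w Leaf)"

inductive right_rotation :: "unit tree \<Rightarrow> unit tree \<Rightarrow> bool"
  where
    root: "right_rotation (Node (Node a () b) () c) (Node a () (Node b () c))"
  | left: "right_rotation l l' \<Longrightarrow> right_rotation (Node l () r) (Node l' () r)"
  | right: "right_rotation r r' \<Longrightarrow> right_rotation (Node l () r) (Node l () r')"

definition tamari :: "unit tree \<Rightarrow> unit tree \<Rightarrow> bool"
  where "tamari = right_rotation\<^sup>*\<^sup>*"

text \<open>Gluing \<open>s\<close> as right (left) child of the right-most (left-most) node of \<open>t\<close>.\<close>

fun glue_right :: "unit tree \<Rightarrow> unit tree \<Rightarrow> unit tree"
  where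
    "glue_right Leaf s = s"
  | "glue_right (Node l _ r) s = Node l () (glue_right r s)"

fun glue_left :: "unit tree \<Rightarrow> unit tree \<Rightarrow> unit tree"
  where
    "glue_left s Leaf = s"
  | "glue_left s (Node l _ r) = Node (glue_left s l) () r"


section \<open>\<open>(m+1)\<close>-ary trees and \<open>m\<close>-binary trees\<close>

datatype ptree = Tip | Br "ptree list"

fun ary :: "nat \<Rightarrow> ptree \<Rightarrow> bool"
  where
    "ary k Tip \<longleftrightarrow> True"
  | "ary k (Br ts) \<longleftrightarrow> length ts = k \<and> (\<forall>t\<in>set ts. ary k t)"

abbreviation ary_trees :: "nat \<Rightarrow> ptree set"
  where "ary_trees m \<equiv> {T. ary (Suc m) T}"

text \<open>
  The left subtree of the node \<open>x\<^sub>i\<close> of an \<open>m\<close>-binary tree, given the list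
  \<open>[T\<^bsub>L\<^sub>m\<^sub>-\<^sub>i\<^esub>, \<dots>, T\<^bsub>L\<^sub>1\<^esub>]\<close>:
  the node \<open>x\<^bsub>i+1\<^esub>\<close>, which has no right child of its own, is glued to
  \<open>T\<^bsub>L\<^sub>m\<^sub>-\<^sub>i\<^esub>\<close> on the right; if the latter is empty, \<open>x\<^bsub>i+1\<^esub>\<close> becomes the left child of \<open>x\<^sub>i\<close>.
\<close>

fun left_part :: "unit tree list \<Rightarrow> unit tree"
  where
    "left_part [] = Leaf"
  | "left_part [t] = t"
  | "left_part (t # ts) = glue_right t (Node (left_part ts) () Leaf)"

text \<open>
  The \<open>m\<close>-binary tree of an \<open>(m+1)\<close>-ary tree; the subtrees of a node are, in this order,
  \<open>T\<^bsub>L\<^sub>1\<^esub>, \<dots>, T\<^bsub>L\<^sub>m\<^esub>, T\<^sub>R\<close>.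
\<close>

fun to_bin :: "ptree \<Rightarrow> unit tree"
  where
    "to_bin Tip = Leaf"
  | "to_bin (Br ts) =
      (let bs = map to_bin ts in Node (left_part (rev (butlast bs))) () (last bs))"

definition mtamari :: "nat \<Rightarrow> ptree \<Rightarrow> ptree \<Rightarrow> bool"
  where "mtamari m S T \<longleftrightarrow> S \<in> ary_trees m \<and> T \<in> ary_trees m \<and> tamari (to_bin S) (to_bin T)"

definition sylv :: "nat \<Rightarrow> nat list \<Rightarrow> ptree"
  where "sylv m \<alpha> = (THE T. T \<in> ary_trees m \<and> to_bin T = bst_shape (std \<alpha>))"

text \<open>
  The internal nodes of a tree, as addresses (lists of child indices, counted from \<open>0\<close>), in the
  order used for the bounds: left to right in the corresponding \<open>m\<close>-binary tree.  In the latter the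
  subtrees of a node appear from left to right as \<open>T\<^bsub>L\<^sub>m\<^esub>, \<dots>, T\<^bsub>L\<^sub>1\<^esub>\<close>, followed by the nodes
  \<open>x\<^bsub>m-1\<^esub>, \<dots>, x\<^sub>0\<close> and \<open>T\<^sub>R\<close>, so that the first \<open>m\<close> subtrees are to be visited in the order
  \<open>T\<^bsub>L\<^sub>m\<^esub>, \<dots>, T\<^bsub>L\<^sub>1\<^esub>\<close>.  With the opposite order the description of the lower bound would fail: take
  \<open>m = 2\<close>, \<open>T'\<close> the tree with one node and \<open>T''\<close> the tree whose root has two one-node subtrees
  \<open>T\<^bsub>L\<^sub>1\<^esub>\<close> and \<open>T\<^bsub>L\<^sub>2\<^esub>\<close>, and empty \<open>T\<^sub>R\<close>; the lower bound glues \<open>T'\<close> to \<open>T\<^bsub>L\<^sub>2\<^esub>\<close>.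
\<close>

fun node_order :: "ptree \<Rightarrow> nat list list"
  where
    "node_order Tip = []"
  | "node_order (Br ts) =
      (let m = length ts - 1; os = map node_order ts; sub = (\<lambda>i. map ((#) i) (os ! i))
       in concat (map sub (rev [0..<m])) @ [[]] @ sub m)"

text \<open>\<open>glue_at S p i T\<close> makes \<open>S\<close> the \<open>i\<close>-th subtree of the node of \<open>T\<close> at address \<open>p\<close>.\<close>

fun glue_at :: "ptree \<Rightarrow> nat list \<Rightarrow> nat \<Rightarrow> ptree \<Rightarrow> ptree"
  where
    "glue_at S p i Tip = Tip"
  | "glue_at S [] i (Br ts) = Br (ts[i := S])"
  | "glue_at S (j # p) i (Br ts) = Br (ts[j := glue_at S p i (ts ! j)])"

text \<open>
  The first \<open>m\<close> subtrees of the left-most node and the last subtree of the right-most node are empty.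
  \<open>T'\<close> becomes the first subtree \<open>T\<^bsub>L\<^sub>1\<^esub>\<close> of the left-most node of \<open>T''\<close>, that is, the left
  subtree of its node \<open>x\<^bsub>m-1\<^esub>\<close>, and \<open>T''\<close> the last subtree of the right-most node of \<open>T'\<close>.
\<close>

definition lower_bound :: "ptree \<Rightarrow> ptree \<Rightarrow> ptree"
  where "lower_bound T' T'' =
    (if T'' = Tip then T' else glue_at T' (hd (node_order T'')) 0 T'')"

definition upper_bound :: "nat \<Rightarrow> ptree \<Rightarrow> ptree \<Rightarrow> ptree"
  where "upper_bound m T' T'' =
    (if T' = Tip then T'' else glue_at T'' (last (node_order T')) m T')"


section \<open>The algebra of \<open>(m+1)\<close>-ary trees and its dual\<close>

definition P :: "nat \<Rightarrow> ptree \<Rightarrow> (nat list \<Rightarrow>\<^sub>0 'k::field)"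
  where "P m T = (\<Sum>\<alpha>\<in>{\<alpha> \<in> mperms m. sylv m \<alpha> = T}. F \<alpha>)"

definition pbt :: "nat \<Rightarrow> (nat list \<Rightarrow>\<^sub>0 'k::field) set"
  where "pbt m = pm.span (P m ` ary_trees m)"

definition pbt_deg :: "nat \<Rightarrow> nat \<Rightarrow> (nat list \<Rightarrow>\<^sub>0 'k::field) set"
  where "pbt_deg m n = pbt m \<inter> fqsym_deg m n"

definition pbt_dual :: "nat \<Rightarrow> ((nat list \<Rightarrow>\<^sub>0 'k::field) \<Rightarrow> 'k) set"
  where "pbt_dual m = graded_dual (pbt m) (pbt_deg m)"

definition Q :: "nat \<Rightarrow> ptree \<Rightarrow> ((nat list \<Rightarrow>\<^sub>0 'k::field) \<Rightarrow> 'k)"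
  where "Q m T = coord (P m ` ary_trees m) (P m T)"

end

theory Submission
  imports Defs "HOL-Library.Multiset"
begin

text \<open>
  Two words are sylvester congruent iff they have the same binary search tree, and the binary search
  tree of an \<open>m\<close>-permutation is the labelling by \<open>1\<^sup>m 2\<^sup>m \<dots> n\<^sup>m\<close>, in infix order, of a tree in which
  only the nodes at positions divisible by \<open>m\<close> may have a right child; these are the \<open>m\<close>-binary trees.
  The span of the \<open>P\<^sub>T\<close> consists of the vectors whose coefficients are constant on sylvester classes.
  The coefficient of \<open>\<gamma>\<close> in a product of homogeneous elements is the product of the coefficients of
  the restrictions of \<open>\<gamma>\<close> to its small and to its large letters, and a coefficient of a coproduct is a
  sum over the possible alphabets of the left factor; both descriptions are compatible with the
  congruence.  On trees, the restriction of a word to its small or large letters becomes the tree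
  \<open>low\<close> or \<open>high\<close> induced on the first or on the last nodes.  Both are monotone for the Tamari order,
  and every tree \<open>u\<close> lies between \<open>glue_left (low u) (high u)\<close> and \<open>glue_right (low u) (high u)\<close>, so
  that the trees with given restrictions form an interval.
\<close>

section \<open>Linear maps between free vector spaces\<close>

text \<open>The Hopf identities are inherited from the ambient algebra of
  \<open>m\<close>-permutations, so for the span of the \<open>P m T\<close> only closure of the
  homogeneous components is at stake. The antipode is the delicate case: the single terms of its
  recursion over factorizations of a word need not lie in the span. On the span, however, the
  coproduct of an element of positive degree is x tensor 1 plus terms whose left factor has smaller
  degree, and the antipode can be solved for by induction on the degree. The divisibility condition
  on \<open>m\<close>-binary trees comes from equal letters: insertion sends them to the left, so a
  right child requires a new letter. On the dual side the ideal is given by generators and closure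
  rules, with no evident normal form. It is identified with the annihilator of the span. The
  annihilator is an ideal because the span is closed under the coproduct; conversely, modulo the
  generators a functional becomes a combination of \<open>G\<close> at one word per class, and the
  values on the \<open>P m T\<close> detect its coefficients. The quotient is then the image of
  restriction to the span.\<close>

abbreviation lookup :: "('a \<Rightarrow>\<^sub>0 'b::zero) \<Rightarrow> 'a \<Rightarrow> 'b"
  where "lookup \<equiv> Poly_Mapping.lookup"

abbreviation keys :: "('a \<Rightarrow>\<^sub>0 'b::zero) \<Rightarrow> 'a set"
  where "keys \<equiv> Poly_Mapping.keys"

lemma linear_sclI:
  fixes f :: "('a \<Rightarrow>\<^sub>0 'k::field) \<Rightarrow> ('b \<Rightarrow>\<^sub>0 'k)"
  assumes "\<And>x y. f (x + y) = f x + f y" "\<And>c x. f (scl c x) = scl c (f x)"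
  shows "Vector_Spaces.linear scl scl f"
  unfolding module_hom_iff_linear[symmetric] module_hom_iff
  by (intro conjI allI assms pm.module_axioms)

lemma linear_addD: "Vector_Spaces.linear scl s f \<Longrightarrow> f (x + y) = f x + f y"
  unfolding module_hom_iff_linear[symmetric] module_hom_iff by auto

lemma linear_sclD: "Vector_Spaces.linear scl s f \<Longrightarrow> f (scl c x) = s c (f x)"
  unfolding module_hom_iff_linear[symmetric] module_hom_iff by auto

lemma linear_sumD:
  assumes "Vector_Spaces.linear scl s f"
  shows "f (\<Sum>i\<in>I. g i) = (\<Sum>i\<in>I. f (g i))"
proof -
  have "f 0 = 0"
    using linear_addD[OF assms, of 0 0] by simp
  then show ?thesis
    by (induction I rule: infinite_finite_induct) (auto simp: linear_addD[OF assms])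
qed

lemma lin_ext_eq_sum:
  assumes "finite K" "keys x \<subseteq> K"
  shows "lin_ext f x = (\<Sum>a\<in>K. scl (lookup x a) (f a))"
  unfolding lin_ext_def using assms
  by (intro sum.mono_neutral_left) (auto simp: in_keys_iff)

lemma lin_ext_add: "lin_ext f (x + y) = lin_ext f x + lin_ext f y"
proof -
  let ?K = "keys x \<union> keys y"
  have "lin_ext f z = (\<Sum>a\<in>?K. scl (lookup z a) (f a))" if "z \<in> {x, y, x + y}" for z
    using that by (intro lin_ext_eq_sum) (auto dest: subsetD[OF Poly_Mapping.keys_add])
  then show ?thesis
    by (simp add: lookup_add pm.scale_left_distrib sum.distrib)
qed

lemma lin_ext_scl: "lin_ext f (scl c x) = scl c (lin_ext f x)"
proof -
  have "lin_ext f (scl c x) = (\<Sum>a\<in>keys x. scl (lookup (scl c x) a) (f a))"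
    by (intro lin_ext_eq_sum) (auto simp: in_keys_iff)
  then show ?thesis
    by (simp add: lin_ext_def pm.scale_sum_right)
qed

lemma linear_lin_ext [simp]: "Vector_Spaces.linear scl scl (lin_ext f)"
  by (intro linear_sclI lin_ext_add lin_ext_scl)

lemma lin_ext_zero [simp]: "lin_ext f 0 = 0"
  by (simp add: lin_ext_def)

lemma lin_ext_bas [simp]: "lin_ext f (bas a) = f a"
  by (simp add: lin_ext_def)

lemma lin_ext_sum: "lin_ext f (\<Sum>i\<in>I. g i) = (\<Sum>i\<in>I. lin_ext f (g i))"
  by (rule linear_sumD[OF linear_lin_ext])

lemma lin_ext_cong:
  assumes "\<And>a. a \<in> keys x \<Longrightarrow> f a = g a"
  shows "lin_ext f x = lin_ext g x"
  unfolding lin_ext_def using assms by simp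

lemma linear_via_lin_ext:
  assumes "Vector_Spaces.linear scl scl L"
  shows "L (lin_ext f x) = lin_ext (\<lambda>a. L (f a)) x"
  unfolding lin_ext_def by (simp add: linear_sumD[OF assms] linear_sclD[OF assms])

lemma lin_ext_lin_ext: "lin_ext g (lin_ext f x) = lin_ext (\<lambda>a. lin_ext g (f a)) x"
  by (rule linear_via_lin_ext) simp

text \<open>Outside the support \<open>lookup x b\<close> is 0, which agrees with the empty delta
  sum, so the formula is uniform in \<open>b\<close>.\<close>

lemma sum_keys_delta:
  "(\<Sum>a\<in>keys x. lookup x a * (if a = b then c else 0)) =
    lookup x b * (c :: 'k::field)"
  using sum.delta[of "keys x" b "\<lambda>a. lookup x a * c"]
  by (simp add: if_distrib[of "(*) _"] in_keys_iff cong: if_cong)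

lemma lin_ext_bas_id [simp]: "lin_ext bas x = x"
  by (rule poly_mapping_eqI)
    (simp add: lin_ext_def lookup_sum lookup_single when_def sum_keys_delta)

lemma linear_expand:
  assumes "Vector_Spaces.linear scl scl L"
  shows "L x = lin_ext (\<lambda>a. L (bas a)) x"
  using linear_via_lin_ext[OF assms, of bas x] by simp

lemma lin_ext_fun_add: "lin_ext (\<lambda>a. f a + g a) x = lin_ext f x + lin_ext g x"
  by (simp add: lin_ext_def pm.scale_right_distrib sum.distrib)

lemma lin_ext_fun_scl: "lin_ext (\<lambda>a. scl c (f a)) x = scl c (lin_ext f x)"
  unfolding lin_ext_def pm.scale_sum_right pm.scale_scale by (simp only: mult.commute)

lemma lookup_lin_ext:
  "lookup (lin_ext f x) b =
    (\<Sum>a\<in>keys x. lookup x a * lookup (f a) b)"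
  by (simp add: lin_ext_def lookup_sum)

lemma keys_lin_ext:
  "keys (lin_ext f x) \<subseteq> (\<Union>a\<in>keys x. keys (f a))"
proof
  fix b assume "b \<in> keys (lin_ext f x)"
  then have "(\<Sum>a\<in>keys x. lookup x a * lookup (f a) b) \<noteq> 0"
    by (simp add: in_keys_iff lookup_lin_ext)
  then obtain a where "a \<in> keys x" "lookup x a * lookup (f a) b \<noteq> 0"
    by (rule sum.not_neutral_contains_not_neutral)
  then show "b \<in> (\<Union>a\<in>keys x. keys (f a))"
    by (auto simp: in_keys_iff)
qed

lemma lookup_sum_bas:
  "finite A \<Longrightarrow> lookup (\<Sum>a\<in>A. bas a :: 'a \<Rightarrow>\<^sub>0 'k::field) b = (if b \<in> A then 1 else 0)"
  by (simp add: lookup_sum lookup_single when_def)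

lemma keys_sum_bas:
  "finite A \<Longrightarrow> keys (\<Sum>a\<in>A. bas a :: 'a \<Rightarrow>\<^sub>0 'k::field) = A"
  by (auto simp: in_keys_iff lookup_sum_bas split: if_splits)

section \<open>Tensor products of free spaces\<close>

lemma tens_bas [simp]: "tens (bas a) (bas b) = bas (a, b)"
  by (simp add: tens_def)

lemma lookup_tens [simp]:
  "lookup (tens x y) (a, b) = lookup x a * lookup y b"
proof -
  have "lookup (tens x y) (a, b) =
    (\<Sum>a'\<in>keys x. lookup x a' *
      (\<Sum>b'\<in>keys y. lookup y b' *
        (if b' = b then if a' = a then 1 else 0 else 0)))"
    by (auto simp: tens_def lookup_lin_ext lookup_single when_def intro!: sum.cong)
  also have "\<dots> = (\<Sum>a'\<in>keys x. lookup x a' *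
      (if a' = a then lookup y b else 0))"
    by (rule sum.cong[OF refl], unfold sum_keys_delta) simp
  also have "\<dots> = lookup x a * lookup y b"
    by (rule sum_keys_delta)
  finally show ?thesis .
qed

lemma tens_add_left: "tens (x + y) z = tens x z + tens y z"
  and tens_scl_left: "tens (scl c x) z = scl c (tens x z)"
  and tens_add_right: "tens z (x + y) = tens z x + tens z y"
  and tens_scl_right: "tens z (scl c x) = scl c (tens z x)"
  by (auto intro!: poly_mapping_eqI simp: lookup_add algebra_simps)

lemma linear_tens_left: "Vector_Spaces.linear scl scl (\<lambda>x. tens x z)"
  and linear_tens_right: "Vector_Spaces.linear scl scl (tens z)"
  by (auto intro!: linear_sclI simp: tens_add_left tens_scl_left tens_add_right tens_scl_right)

lemma lin_ext_tens: "lin_ext f (tens x y) = lin_ext (\<lambda>a. lin_ext (\<lambda>b. f (a, b)) y) x"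
  by (simp add: tens_def lin_ext_lin_ext)

lemma keys_tens: "keys (tens x y) \<subseteq> keys x \<times> keys y"
  by (auto simp: in_keys_iff)

lemma span_bas: "pm.span (bas ` B :: ('a \<Rightarrow>\<^sub>0 'k::field) set) = {x. keys x \<subseteq> B}"
proof
  have "pm.subspace {x :: 'a \<Rightarrow>\<^sub>0 'k. keys x \<subseteq> B}"
    by (auto simp: pm.subspace_def in_keys_iff lookup_add subset_iff) (metis add.right_neutral)
  then show "pm.span (bas ` B) \<subseteq> {x :: 'a \<Rightarrow>\<^sub>0 'k. keys x \<subseteq> B}"
    by (intro pm.span_minimal) auto
  show "{x :: 'a \<Rightarrow>\<^sub>0 'k. keys x \<subseteq> B} \<subseteq> pm.span (bas ` B)"
  proof
    fix x :: "'a \<Rightarrow>\<^sub>0 'k" assume "x \<in> {x. keys x \<subseteq> B}"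
    then have "lin_ext bas x \<in> pm.span (bas ` B)"
      unfolding lin_ext_def by (intro pm.span_sum pm.span_scale pm.span_base) auto
    then show "x \<in> pm.span (bas ` B)" by simp
  qed
qed

text \<open>The laws for \<open>m\<close>-permutations need not hold on arbitrary words, so linear
  identities are checked on the basis vectors that occur in \<open>x\<close> and not on the whole
  ambient basis.\<close>

lemma linear_eq_on_keys:
  assumes "Vector_Spaces.linear scl scl L" "Vector_Spaces.linear scl scl L'"
    and "\<And>a. a \<in> keys x \<Longrightarrow> L (bas a) = L' (bas a)"
  shows "L x = L' x"
proof -
  have "L x = lin_ext (\<lambda>a. L (bas a)) x" by (rule linear_expand[OF assms(1)])
  also have "\<dots> = lin_ext (\<lambda>a. L' (bas a)) x" using assms(3) by (rule lin_ext_cong)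
  also have "\<dots> = L' x" by (rule linear_expand[OF assms(2), symmetric])
  finally show ?thesis .
qed

lemma linear_comp:
  assumes "Vector_Spaces.linear scl scl f" "Vector_Spaces.linear scl scl g"
  shows "Vector_Spaces.linear scl scl (\<lambda>x. g (f x))"
  by (rule linear_sclI)
    (simp_all add: linear_addD[OF assms(1)] linear_sclD[OF assms(1)] linear_addD[OF assms(2)] linear_sclD[OF assms(2)])

lemma linear_lin_ext_fun:
  assumes "\<And>a. Vector_Spaces.linear scl scl (\<lambda>y. f a y)"
  shows "Vector_Spaces.linear scl scl (\<lambda>y. lin_ext (\<lambda>a. f a y) x)"
  by (rule linear_sclI)
    (simp_all add: linear_addD[OF assms] linear_sclD[OF assms] lin_ext_fun_add lin_ext_fun_scl)

lemma tens_sum_left: "tens (\<Sum>i\<in>I. f i) y = (\<Sum>i\<in>I. tens (f i) y)"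
  by (rule linear_sumD[OF linear_tens_left])

lemma tens_sum_right: "tens x (\<Sum>i\<in>I. f i) = (\<Sum>i\<in>I. tens x (f i))"
  by (rule linear_sumD[OF linear_tens_right])

section \<open>Words and \<open>m\<close>-standardization\<close>

text \<open>A letter of \<open>A\<close> counts itself, so ranks in \<open>A\<close> run from 1 to
  \<open>card A\<close> like the letters of an \<open>m\<close>-permutation.\<close>

definition rk :: "nat set \<Rightarrow> nat \<Rightarrow> nat"
  where "rk A a = card {b \<in> A. b \<le> a}"

text \<open>
  Factors of \<open>m\<close>-permutations that are \<open>m\<close>-words have this property; on such words \<open>m\<close>-standardization
  is an increasing relabelling.
\<close>

definition uniform :: "nat \<Rightarrow> nat list \<Rightarrow> bool"
  where "uniform m w \<longleftrightarrow> (\<forall>a\<in>set w. count_list w a = m)"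

lemma count_list_conv_card: "count_list w a = card {j. j < length w \<and> w ! j = a}"
  by (simp add: count_list_eq_length_filter length_filter_conv_card eq_commute)

lemma length_eq_sum_count:
  assumes "finite A" "set w \<subseteq> A"
  shows "length w = (\<Sum>a\<in>A. count_list w a)"
  using sum_count_set[OF assms(2,1)] by simp

lemma mperms_ofD:
  assumes "w \<in> mperms_of m n"
  shows "length w = m * n" "a \<in> {1..n} \<Longrightarrow> count_list w a = m" "set w \<subseteq> {1..n}"
proof -
  show "length w = m * n"
    using assms by (subst length_eq_sum_count[of "{1..n}"]) (auto simp: mperms_of_def)
qed (use assms in \<open>auto simp: mperms_of_def\<close>)

lemma set_mperm:
  assumes "w \<in> mperms_of m n" "m \<ge> 1"
  shows "set w = {1..n}"
proof
  show "{1..n} \<subseteq> set w"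
  proof
    fix a assume "a \<in> {1..n}"
    then have "count_list w a = m" using assms by (auto simp: mperms_of_def)
    then show "a \<in> set w" using assms(2) by (metis count_list_0_iff not_one_le_zero)
  qed
qed (use assms in \<open>auto simp: mperms_of_def\<close>)

lemma finite_mperms_of: "finite (mperms_of m n)"
proof (rule finite_subset)
  show "mperms_of m n \<subseteq> {w. set w \<subseteq> {1..n} \<and> length w = m * n}"
    using mperms_ofD by blast
  show "finite {w. set w \<subseteq> {1..n} \<and> length w = m * n}"
    by (rule finite_lists_length_eq) simp
qed

lemma mperms_of_inj:
  assumes "w \<in> mperms_of m n" "w \<in> mperms_of m n'" "m \<ge> 1"
  shows "n = n'"
  using mperms_ofD(1)[OF assms(1)] mperms_ofD(1)[OF assms(2)] assms(3) by auto

lemma mperms_iff: "m \<ge> 1 \<Longrightarrow> w \<in> mperms m \<longleftrightarrow> w \<in> mperms_of m (length w div m)"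
  using mperms_ofD(1) by (fastforce simp: mperms_def)

lemma mperms_of_0 [simp]: "mperms_of m 0 = {[]}"
  by (auto simp: mperms_of_def)

lemma Nil_mperms [simp]: "[] \<in> mperms m"
  unfolding mperms_def using mperms_of_0 by blast

lemma uniform_mperm: "w \<in> mperms_of m n \<Longrightarrow> uniform m w"
  by (auto simp: uniform_def mperms_of_def)

text \<open>A letter occurs \<open>m\<close> times in \<open>u @ v\<close>, and its count in
  \<open>u\<close> is a multiple of \<open>m\<close>, hence 0 or \<open>m\<close>: every letter lies
  entirely in one factor.\<close>

lemma uniform_appendD:
  assumes "uniform m (u @ v)" "mword m u"
  shows "uniform m u" "uniform m v" "mword m v" "set u \<inter> set v = {}"
proof -
  have *: "count_list u a + count_list v a = m" if "a \<in> set u \<union> set v" for a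
    using assms(1) that by (auto simp: uniform_def)
  have **: "count_list u a = m \<and> count_list v a = 0 \<or> count_list u a = 0 \<and> count_list v a = m"
    if "a \<in> set u \<union> set v" for a
  proof -
    have "m dvd count_list u a" using assms(2) by (auto simp: mword_def)
    then show ?thesis using *[OF that] by (cases "count_list u a = 0") (auto dest: dvd_imp_le)
  qed
  have u0: "count_list u a \<noteq> 0" if "a \<in> set u" for a
    using that by (simp add: count_list_0_iff)
  have v0: "count_list v a \<noteq> 0" if "a \<in> set v" for a
    using that by (simp add: count_list_0_iff)
  show "uniform m u" "uniform m v"
    using ** u0 v0 unfolding uniform_def by (metis UnCI)+
  show "mword m v"
    unfolding mword_def using ** by (metis UnCI count_notin dvd_0_right dvd_refl)
  show "set u \<inter> set v = {}"
    using ** u0 v0 by (metis UnCI disjoint_iff)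
qed

lemma uniform_mword: "uniform m w \<Longrightarrow> mword m w"
  unfolding uniform_def mword_def by (metis count_notin dvd_0_right dvd_refl)

lemma uniform_length: "uniform m w \<Longrightarrow> length w = m * card (set w)"
  by (subst length_eq_sum_count[of "set w"]) (auto simp: uniform_def)

lemma rk_mono: "finite A \<Longrightarrow> a \<le> b \<Longrightarrow> rk A a \<le> rk A b"
  unfolding rk_def by (intro card_mono) auto

lemma rk_strict:
  assumes "finite A" "b \<in> A" "a < b"
  shows "rk A a < rk A b"
proof -
  have "b \<in> {x \<in> A. x \<le> b} - {x \<in> A. x \<le> a}" "{x \<in> A. x \<le> a} \<subseteq> {x \<in> A. x \<le> b}"
    using assms by auto
  then show ?thesis
    unfolding rk_def using assms(1) by (intro psubset_card_mono) auto
qed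

lemma strict_mono_on_rk: "finite A \<Longrightarrow> strict_mono_on A (rk A)"
  by (auto simp: strict_mono_on_def rk_strict)

lemma rk_atLeastAtMost: "a \<in> {1..n} \<Longrightarrow> rk {1..n} a = a"
proof -
  assume "a \<in> {1..n}"
  then have "{b \<in> {1..n}. b \<le> a} = {1..a}" by auto
  then show ?thesis by (simp add: rk_def)
qed

lemma rk_image_eq:
  assumes "finite A"
  shows "rk A ` A = {1..card A}"
proof (rule card_subset_eq)
  show "rk A ` A \<subseteq> {1..card A}"
  proof
    fix x assume "x \<in> rk A ` A"
    then obtain a where a: "a \<in> A" "x = rk A a" by auto
    have "card {b \<in> A. b \<le> a} \<le> card A" using assms by (intro card_mono) auto
    moreover have "card {b \<in> A. b \<le> a} > 0" using a assms by (subst card_gt_0_iff) auto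
    ultimately show "x \<in> {1..card A}" using a by (auto simp: rk_def)
  qed
  show "card (rk A ` A) = card {1..card A}"
    using card_image[OF strict_mono_on_imp_inj_on[OF strict_mono_on_rk[OF assms]]] by simp
qed simp

lemma rk_strict_mono_image:
  assumes "strict_mono_on A f" "a \<in> A"
  shows "rk (f ` A) (f a) = rk A a"
proof -
  have inj: "inj_on f A" using assms(1) by (rule strict_mono_on_imp_inj_on)
  have "{b \<in> f ` A. b \<le> f a} = f ` {b \<in> A. b \<le> a}"
    using assms strict_mono_on_less_eq[OF assms(1)] by auto
  moreover have "card (f ` {b \<in> A. b \<le> a}) = card {b \<in> A. b \<le> a}"
    by (intro card_image inj_on_subset[OF inj]) auto
  ultimately show ?thesis by (simp add: rk_def)
qed

text \<open>Each letter smaller than \<open>w ! i\<close> occurs \<open>m\<close> times, and fewer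
  than \<open>m\<close> letters equal to \<open>w ! i\<close> precede position \<open>i\<close>;
  \<open>div m\<close> discards the latter.\<close>

lemma mstd_eq_map_rk:
  assumes "uniform m w" "m \<ge> 1"
  shows "mstd m w = map (rk (set w)) w"
proof (rule nth_equalityI)
  show "length (mstd m w) = length (map (rk (set w)) w)" by (simp add: mstd_def)
  fix i assume "i < length (mstd m w)"
  then have i: "i < length w" by (simp add: mstd_def)
  let ?B = "{b \<in> set w. b < w ! i}"
  have "card {j. j < length w \<and> w ! j < w ! i} = card (\<Union>b\<in>?B. {j. j < length w \<and> w ! j = b})"
    by (rule arg_cong[of _ _ card]) auto
  also have "\<dots> = (\<Sum>b\<in>?B. count_list w b)"
    by (subst card_UN_disjoint) (auto simp: count_list_conv_card)
  also have "\<dots> = card ?B * m"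
    using assms(1) by (simp add: uniform_def)
  finally have 1: "card {j. j < length w \<and> w ! j < w ! i} = card ?B * m" .
  have "card {j. j < i \<and> w ! j = w ! i} < card {j. j < length w \<and> w ! j = w ! i}"
    using i by (intro psubset_card_mono) auto
  also have "\<dots> = m"
    using assms(1) i by (simp add: uniform_def count_list_conv_card[symmetric])
  finally have 2: "card {j. j < i \<and> w ! j = w ! i} < m" .
  have "{b \<in> set w. b \<le> w ! i} = insert (w ! i) ?B"
    using i by auto
  then have "rk (set w) (w ! i) = Suc (card ?B)"
    by (simp add: rk_def)
  then show "mstd m w ! i = map (rk (set w)) w ! i"
    using 1 2 i assms(2) by (simp add: mstd_def)
qed

lemma count_list_map_inj_on:
  assumes "inj_on f A" "set w \<subseteq> A" "a \<in> A"
  shows "count_list (map f w) (f a) = count_list w a"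
  using assms(2) by (induction w) (auto simp: inj_on_eq_iff[OF assms(1)] assms(3))

lemma uniform_map:
  assumes "uniform m w" "inj_on f (set w)"
  shows "uniform m (map f w)"
  using assms by (auto simp: uniform_def count_list_map_inj_on[OF assms(2)])

lemma mperms_of_iff:
  assumes "m \<ge> 1"
  shows "w \<in> mperms_of m n \<longleftrightarrow> uniform m w \<and> set w = {1..n}"
  (is "_ \<longleftrightarrow> ?R")
proof
  show "w \<in> mperms_of m n" if ?R
    using that by (simp add: mperms_of_def uniform_def)
qed (use set_mperm[OF _ assms] uniform_mperm in blast)

lemma mstd_mperms_of:
  assumes "uniform m w" "m \<ge> 1"
  shows "mstd m w \<in> mperms_of m (length w div m)"
proof -
  have "uniform m (map (rk (set w)) w)"
    using assms strict_mono_on_imp_inj_on[OF strict_mono_on_rk[of "set w"]]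
    by (intro uniform_map) auto
  then show ?thesis
    using uniform_length[OF assms(1)] assms(2)
    by (simp add: mstd_eq_map_rk[OF assms] mperms_of_iff rk_image_eq)
qed

lemma mstd_mperm:
  assumes "w \<in> mperms_of m n" "m \<ge> 1"
  shows "mstd m w = w"
proof -
  have "map (rk {1..n}) w = map id w"
    using rk_atLeastAtMost mperms_ofD(3)[OF assms(1)] by (intro map_cong) auto
  then show ?thesis
    by (simp add: mstd_eq_map_rk[OF uniform_mperm[OF assms(1)] assms(2)] set_mperm[OF assms])
qed

lemma mstd_map_strict_mono:
  assumes "uniform m w" "m \<ge> 1" "strict_mono_on (set w) f"
  shows "mstd m (map f w) = mstd m w"
proof -
  have "uniform m (map f w)"
    using assms by (intro uniform_map strict_mono_on_imp_inj_on)
  then show ?thesis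
    using assms by (auto simp: mstd_eq_map_rk rk_strict_mono_image)
qed

lemma length_mstd [simp]: "length (mstd m w) = length w"
  by (simp add: mstd_def)

lemma mword_map_inj_on:
  assumes "inj_on f (set w)"
  shows "mword m (map f w) \<longleftrightarrow> mword m w"
proof
  assume *: "mword m (map f w)"
  show "mword m w"
    unfolding mword_def
  proof
    fix a show "m dvd count_list w a"
    proof (cases "a \<in> set w")
      case True
      then show ?thesis using * count_list_map_inj_on[OF assms order_refl] by (metis mword_def)
    qed simp
  qed
next
  assume *: "mword m w"
  show "mword m (map f w)"
    unfolding mword_def
  proof
    fix a show "m dvd count_list (map f w) a"
    proof (cases "a \<in> f ` set w")
      case True
      then show ?thesis using * count_list_map_inj_on[OF assms order_refl] by (auto simp: mword_def)
    qed (simp add: count_notin)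
  qed
qed

section \<open>The sylvester congruence and binary search trees\<close>

lemma sylvester_refl [simp]: "sylvester u u"
  by (simp add: sylvester_def)

lemma sylvester_sym: "sylvester u v \<Longrightarrow> sylvester v u"
  by (simp add: sylvester_def equivclp_sym)

lemma sylvester_trans: "sylvester u v \<Longrightarrow> sylvester v w \<Longrightarrow> sylvester u w"
  unfolding sylvester_def by (rule equivclp_trans)

lemma sylvester_step_imp: "sylvester_step u v \<Longrightarrow> sylvester u v"
  unfolding sylvester_def by blast

text \<open>An equivalence relation that contains the elementary steps contains the congruence. It
  is used with \<open>R\<close> an invariant of words or a compatibility of the congruence with an
  operation.\<close>

lemma sylvester_map_rel:
  assumes "sylvester u v" "\<And>u v. sylvester_step u v \<Longrightarrow> R u v"
    and "\<And>u. R u u" "\<And>u v. R u v \<Longrightarrow> R v u" "\<And>u v w. R u v \<Longrightarrow> R v w \<Longrightarrow> R u w"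
  shows "R u v"
  using assms(1) unfolding sylvester_def
  by (induction rule: equivclp_induct) (use assms(2-) in blast)+

lemma sylvester_mset: "sylvester u v \<Longrightarrow> mset u = mset v"
  by (erule sylvester_map_rel[where R = "\<lambda>u v. mset u = mset v"]) (auto elim!: sylvester_step.cases)

lemma sylvester_context:
  assumes "sylvester u v"
  shows "sylvester (x @ u @ y) (x @ v @ y)"
  using assms
proof (rule sylvester_map_rel[where R = "\<lambda>u v. sylvester (x @ u @ y) (x @ v @ y)"])
  fix u v assume "sylvester_step u v"
  then show "sylvester (x @ u @ y) (x @ v @ y)"
  proof cases
    case (1 a b c p q r)
    have "sylvester_step ((x @ p) @ [a, c] @ q @ [b] @ (r @ y)) ((x @ p) @ [c, a] @ q @ [b] @ (r @ y))"
      using 1 by (intro sylvester_step.intros)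
    then show ?thesis using 1 by (intro sylvester_step_imp) simp
  qed
qed (auto intro: sylvester_sym sylvester_trans)

lemma sylvester_append:
  assumes "sylvester u u'" "sylvester v v'"
  shows "sylvester (u @ v) (u' @ v')"
  using sylvester_context[OF assms(1), of "[]" v] sylvester_context[OF assms(2), of u' "[]"]
  by (auto intro: sylvester_trans)

text \<open>\<open>C\<close> selects an order-convex set of letters. If both exchanged letters
  \<open>a\<close> and \<open>c\<close> survive, so does the \<open>b\<close> between them that
  permits the exchange; otherwise the two filtered words coincide.\<close>

lemma sylvester_filter:
  assumes "sylvester u v" "\<And>a b c. C a \<Longrightarrow> C c \<Longrightarrow> a \<le> b \<Longrightarrow> b \<le> c \<Longrightarrow> C b"
  shows "sylvester (filter C u) (filter C v)"
  using assms(1)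
proof (rule sylvester_map_rel[where R = "\<lambda>u v. sylvester (filter C u) (filter C v)"])
  fix u v assume "sylvester_step u v"
  then show "sylvester (filter C u) (filter C v)"
  proof cases
    case (1 a b c p q r)
    show ?thesis
    proof (cases "C a \<and> C c")
      case True
      then have "C b" using assms(2)[of a c b] 1 by simp
      then have "sylvester_step (filter C u) (filter C v)"
        using True 1 sylvester_step.intros[of a b c "filter C p" "filter C q" "filter C r"] by simp
      then show ?thesis by (rule sylvester_step_imp)
    qed (use 1 in auto)
  qed
qed (auto intro: sylvester_sym sylvester_trans)

text \<open>\<open>f\<close> is increasing only on the letters of \<open>u\<close>. The relation
  carried through the congruence therefore also records, in a symmetric form, that the alphabet
  stays the same.\<close>

lemma sylvester_map:
  assumes "sylvester u v" "strict_mono_on (set u) f"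
  shows "sylvester (map f u) (map f v)"
proof -
  let ?A = "set u"
  have "(set u = ?A \<longleftrightarrow> set v = ?A) \<and> (set u = ?A \<longrightarrow> sylvester (map f u) (map f v))"
    using assms(1)
  proof (rule sylvester_map_rel[where
        R = "\<lambda>x y. (set x = ?A \<longleftrightarrow> set y = ?A) \<and> (set x = ?A \<longrightarrow> sylvester (map f x) (map f y))"])
    fix x y assume "sylvester_step x y"
    then show "(set x = ?A \<longleftrightarrow> set y = ?A) \<and> (set x = ?A \<longrightarrow> sylvester (map f x) (map f y))"
    proof cases
      case (1 a b c p q r)
      have "sylvester (map f x) (map f y)" if "set x = ?A"
      proof -
        have abc: "a \<in> ?A" "b \<in> ?A" "c \<in> ?A" using 1 that by auto
        have "f a \<le> f b" "f b < f c"
          using 1 abc assms(2) by (auto simp: strict_mono_on_leD strict_mono_onD)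
        then have "sylvester_step (map f x) (map f y)"
          using sylvester_step.intros[of "f a" "f b" "f c" "map f p" "map f q" "map f r"] 1 by simp
        then show ?thesis by (rule sylvester_step_imp)
      qed
      moreover have "set x = set y" using 1 by auto
      ultimately show ?thesis by simp
    qed
  qed (auto intro: sylvester_sym sylvester_trans)
  then show ?thesis by simp
qed

section \<open>Binary search trees as a complete invariant\<close>

abbreviation bstree :: "nat list \<Rightarrow> nat tree"
  where "bstree w \<equiv> foldr bst_insert w Leaf"

abbreviation shape :: "'a tree \<Rightarrow> unit tree"
  where "shape \<equiv> map_tree (\<lambda>_. ())"

fun search :: "nat tree \<Rightarrow> bool"
  where
    "search Leaf \<longleftrightarrow> True"
  | "search (Node l a r) \<longleftrightarrow>
      search l \<and> search r \<and> (\<forall>x\<in>set_tree l. x \<le> a) \<and> (\<forall>x\<in>set_tree r. a < x)"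

lemma set_bst_insert [simp]: "set_tree (bst_insert x t) = insert x (set_tree t)"
  by (induction t) auto

lemma mset_bst_insert [simp]: "mset (inorder (bst_insert x t)) = add_mset x (mset (inorder t))"
  by (induction t) auto

lemma search_bst_insert: "search t \<Longrightarrow> search (bst_insert x t)"
  by (induction t) auto

lemma search_bst: "search (bstree w)"
  by (induction w) (auto simp: search_bst_insert)

lemma set_bst [simp]: "set_tree (bstree w) = set w"
  by (induction w) auto

lemma mset_inorder_bst: "mset (inorder (bstree w)) = mset w"
  by (induction w) auto

lemma sorted_inorder: "search t \<Longrightarrow> sorted (inorder t)"
  by (induction t) (auto simp: sorted_append, metis less_imp_le order_trans)

lemma inorder_bst: "inorder (bstree w) = sort w"
  using sorted_inorder[OF search_bst, of w] mset_inorder_bst[of w] 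
  by (metis properties_for_sort)

text \<open>At a node that separates \<open>a\<close> from \<open>c\<close> the two insertions enter
  different subtrees. Otherwise both letters, and with them the \<open>b\<close> lying between,
  belong to the same subtree; the presence of \<open>b\<close> ensures that a separating node is met
  before a leaf.\<close>

lemma bst_insert_commute:
  assumes "search t" "b \<in> set_tree t" "a \<le> b" "b < c"
  shows "bst_insert a (bst_insert c t) = bst_insert c (bst_insert a t)"
  using assms by (induction t) (auto split: if_splits)

lemma sylvester_imp_bst: "sylvester u v \<Longrightarrow> bstree u = bstree v"
proof (erule sylvester_map_rel[where R = "\<lambda>u v. bstree u = bstree v"])
  fix u v assume "sylvester_step u v"
  then show "bstree u = bstree v"
  proof cases
    case (1 a b c p q r)
    have "bst_insert a (bst_insert c (bstree (q @ [b] @ r))) = bst_insert c (bst_insert a (bstree (q @ [b] @ r)))"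
      using 1 by (intro bst_insert_commute[OF search_bst, of b]) (unfold set_bst, auto)
    then show ?thesis using 1 by simp
  qed
qed auto

text \<open>The final letter \<open>a\<close> plays the role of \<open>b\<close> in every elementary
  step: it bounds the letters of \<open>u\<close> from above and is smaller than
  \<open>x\<close>.\<close>

lemma sylvester_move_right:
  assumes "\<forall>y\<in>set u. y \<le> a" "a < x"
  shows "sylvester (x # u @ v @ [a]) (u @ x # v @ [a])"
  using assms(1)
proof (induction u)
  case (Cons y u)
  have "sylvester_step ([] @ [y, x] @ (u @ v) @ [a] @ []) ([] @ [x, y] @ (u @ v) @ [a] @ [])"
    using Cons.prems assms(2) by (intro sylvester_step.intros) auto
  then have "sylvester (x # y # u @ v @ [a]) (y # x # u @ v @ [a])"
    by (auto intro: sylvester_sym sylvester_step_imp)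
  moreover have "sylvester (y # x # u @ v @ [a]) (y # u @ x # v @ [a])"
    using sylvester_context[OF Cons.IH, of "[y]" "[]"] Cons.prems by simp
  ultimately show ?case by (auto intro: sylvester_trans)
qed simp

text \<open>Postorder puts the root last, where it can permit exchanges: when \<open>x\<close> goes
  to the right subtree it has to pass all letters of the left one, which are at most the
  root.\<close>

lemma sylvester_postorder_insert:
  assumes "search t"
  shows "sylvester (x # postorder t) (postorder (bst_insert x t))"
  using assms
proof (induction t)
  case (Node l a r)
  show ?case
  proof (cases "x \<le> a")
    case True
    then show ?thesis
      using sylvester_context[OF Node.IH(1), of "[]" "postorder r @ [a]"] Node.prems by simp
  next
    case False
    have "sylvester (x # postorder l @ postorder r @ [a]) (postorder l @ x # postorder r @ [a])"
      using False Node.prems by (intro sylvester_move_right) (auto simp flip: set_postorder)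
    moreover have "sylvester (postorder l @ x # postorder r @ [a]) (postorder l @ postorder (bst_insert x r) @ [a])"
      using sylvester_context[OF Node.IH(2), of "postorder l" "[a]"] Node.prems by simp
    ultimately show ?thesis
      using False by (auto intro: sylvester_trans)
  qed
qed simp

lemma sylvester_postorder_bst: "sylvester w (postorder (bstree w))"
proof (induction w)
  case (Cons x w)
  then show ?case
    using sylvester_context[OF Cons, of "[x]" "[]"] sylvester_postorder_insert[OF search_bst, of x w]
    by (auto intro: sylvester_trans)
qed simp

text \<open>The postorder reading of a tree is a canonical word of its class: each word is congruent
  to the reading of its own tree, so equal trees give congruent words.\<close>

lemma sylvester_iff_bst: "sylvester u v \<longleftrightarrow> bstree u = bstree v"
proof
  assume "bstree u = bstree v"
  then show "sylvester u v"
    using sylvester_postorder_bst[of u] sylvester_postorder_bst[of v]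
    by (metis sylvester_sym sylvester_trans)
qed (rule sylvester_imp_bst)

text \<open>Insertion runs from right to left: the root comes first, then the letters of
  \<open>r\<close>, all going right, then those of \<open>l\<close>, all going left.\<close>

lemma bst_postorder: "search t \<Longrightarrow> bstree (postorder t) = t"
proof (induction t)
  case (Node l a r)
  have 1: "foldr bst_insert w (Node l' a r') = Node l' a (foldr bst_insert w r')"
    if "\<forall>x\<in>set w. a < x" for w l' r' using that by (induction w) auto
  have 2: "foldr bst_insert w (Node l' a r') = Node (foldr bst_insert w l') a r'"
    if "\<forall>x\<in>set w. x \<le> a" for w l' r' using that by (induction w) auto
  show ?case
    using Node by (simp add: 1 2)
qed simp

lemma shape_inorder_eq:
  assumes "shape s = shape t" "inorder s = inorder t"
  shows "s = t"
  using assms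
proof (induction s arbitrary: t)
  case (Node l a r)
  then obtain l' a' r' where t: "t = Node l' a' r'" "shape l = shape l'" "shape r = shape r'"
    by (cases t) auto
  then have "length (inorder l) = length (inorder l')"
    by (metis length_inorder size_map_tree)
  then show ?case using Node t by auto
qed simp

text \<open>The infix reading is the sorted word, which the content determines, so the shape alone
  gives the labels back.\<close>

lemma sylvester_iff_shape:
  assumes "mset u = mset v"
  shows "sylvester u v \<longleftrightarrow> shape (bstree u) = shape (bstree v)"
proof -
  have "inorder (bstree u) = inorder (bstree v)"
    unfolding inorder_bst using assms by (metis sorted_list_of_multiset_mset)
  then show ?thesis
    unfolding sylvester_iff_bst using shape_inorder_eq by auto
qed

text \<open>Inserts the letters of two words in parallel, comparing first components only. If the
  second components compare alike, both projections are the search trees of the two words, which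
  then have the same shape.\<close>

fun pair_insert :: "nat \<times> nat \<Rightarrow> (nat \<times> nat) tree \<Rightarrow> (nat \<times> nat) tree"
  where
    "pair_insert x Leaf = Node Leaf x Leaf"
  | "pair_insert x (Node l a r) =
      (if fst x \<le> fst a then Node (pair_insert x l) a r else Node l a (pair_insert x r))"

text \<open>A letter is compared only with letters to its right, which are already in the tree, and
  only by asking whether it is at most the other one.\<close>

lemma shape_bst_cong:
  assumes "length u = length v" "\<And>i j. i < j \<Longrightarrow> j < length u \<Longrightarrow> u ! i \<le> u ! j \<longleftrightarrow> v ! i \<le> v ! j"
  shows "shape (bstree u) = shape (bstree v)"
proof -
  let ?t = "\<lambda>ps. foldr pair_insert ps Leaf"
  have set_ins: "set_tree (pair_insert x t) = insert x (set_tree t)" for x t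
    by (induction t) auto
  have fst_ins: "map_tree fst (pair_insert x t) = bst_insert (fst x) (map_tree fst t)" for x t
    by (induction t) auto
  have snd_ins: "map_tree snd (pair_insert x t) = bst_insert (snd x) (map_tree snd t)"
    if "\<forall>a\<in>set_tree t. fst x \<le> fst a \<longleftrightarrow> snd x \<le> snd a" for x t
    using that by (induction t) auto
  have set_t: "set_tree (?t ps) = set ps" for ps
    by (induction ps) (auto simp: set_ins)
  have 1: "map_tree fst (?t ps) = bstree (map fst ps)" for ps
    by (induction ps) (auto simp: fst_ins)
  have 2: "map_tree snd (?t ps) = bstree (map snd ps)"
    if "\<And>i j. i < j \<Longrightarrow> j < length ps \<Longrightarrow> fst (ps ! i) \<le> fst (ps ! j) \<longleftrightarrow> snd (ps ! i) \<le> snd (ps ! j)" for ps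
    using that
  proof (induction ps)
    case (Cons p ps)
    have "\<forall>a\<in>set_tree (?t ps). fst p \<le> fst a \<longleftrightarrow> snd p \<le> snd a"
      unfolding set_t using Cons.prems[of 0] by (fastforce simp: in_set_conv_nth)
    moreover have "map_tree snd (?t ps) = bstree (map snd ps)"
      using Cons.prems[of "Suc _" "Suc _"] by (intro Cons.IH) auto
    ultimately show ?case by (simp add: snd_ins)
  qed simp
  have "shape (bstree u) = shape (map_tree fst (?t (zip u v)))"
    using assms(1) by (simp add: 1)
  also have "\<dots> = shape (map_tree snd (?t (zip u v)))"
    by (simp add: tree.map_comp comp_def)
  also have "\<dots> = shape (bstree v)"
    using assms by (subst 2) auto
  finally show ?thesis .
qed

text \<open>Numbering equal letters from left to right makes the earlier one smaller, and
  \<open>bst_insert\<close> sends an equal letter to the left as it does a smaller one. So all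
  comparisons with later letters survive standardization.\<close>

lemma bst_shape_std: "bst_shape (std w) = shape (bstree w)"
proof -
  let ?less = "\<lambda>i. {j. j < length w \<and> w ! j < w ! i}"
  let ?eq = "\<lambda>i. {j. j < i \<and> w ! j = w ! i}"
  have nth: "std w ! i = Suc (card (?less i) + card (?eq i))" if "i < length w" for i
    using that by (simp add: mstd_def)
  have disj: "card (?less i) + card (?eq i) = card (?less i \<union> ?eq i)" for i
    by (rule card_Un_disjoint[symmetric]) auto
  have "std w ! i \<le> std w ! j \<longleftrightarrow> w ! i \<le> w ! j" if ij: "i < j" "j < length w" for i j
  proof (cases "w ! i \<le> w ! j")
    case True
    have "card (?less i \<union> ?eq i) \<le> card (?less j \<union> ?eq j)"
      using True ij by (intro card_mono) auto
    then show ?thesis using True ij by (simp add: nth[unfolded One_nat_def] disj)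
  next
    case False
    have "j \<in> (?less i \<union> ?eq i) - (?less j \<union> ?eq j)" using False ij by auto
    moreover have "?less j \<union> ?eq j \<subseteq> ?less i \<union> ?eq i" using False ij by auto
    ultimately have "card (?less j \<union> ?eq j) < card (?less i \<union> ?eq i)"
      using ij by (intro psubset_card_mono) auto
    then show ?thesis using False ij by (simp add: nth[unfolded One_nat_def] disj)
  qed
  then show ?thesis
    unfolding bst_shape_def by (intro shape_bst_cong) auto
qed

section \<open>Restrictions of trees and Tamari intervals\<close>

text \<open>
  The trees induced on the first \<open>p\<close> nodes and on the remaining nodes, in infix order.
\<close>

fun low :: "nat \<Rightarrow> unit tree \<Rightarrow> unit tree"
  where
    "low p Leaf = Leaf"
  | "low p (Node l x r) = (if p \<le> size l then low p l else Node l x (low (p - size l - 1) r))"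

fun high :: "nat \<Rightarrow> unit tree \<Rightarrow> unit tree"
  where
    "high p Leaf = Leaf"
  | "high p (Node l x r) = (if p \<le> size l then Node (high p l) x r else high (p - size l - 1) r)"

section \<open>Antisymmetry of the Tamari order and monotonicity of restrictions\<close>

lemma tamari_refl [simp]: "tamari s s"
  by (simp add: tamari_def)

lemma tamari_trans: "tamari s t \<Longrightarrow> tamari t u \<Longrightarrow> tamari s u"
  by (simp add: tamari_def)

lemma tamari_rotation: "tamari (Node (Node a () b) () c) (Node a () (Node b () c))"
  unfolding tamari_def by (intro r_into_rtranclp right_rotation.root)

lemma tamari_left: "tamari l l' \<Longrightarrow> tamari (Node l () r) (Node l' () r)"
  unfolding tamari_def
  by (induction rule: rtranclp_induct) (auto intro: rtranclp.rtrancl_into_rtrancl right_rotation.left)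

lemma tamari_right: "tamari r r' \<Longrightarrow> tamari (Node l () r) (Node l () r')"
  unfolding tamari_def
  by (induction rule: rtranclp_induct) (auto intro: rtranclp.rtrancl_into_rtrancl right_rotation.right)

lemma right_rotation_tamari: "right_rotation s t \<Longrightarrow> tamari s t"
  unfolding tamari_def by (rule r_into_rtranclp)

lemma size_rotation: "right_rotation s t \<Longrightarrow> size s = size t"
  by (induction rule: right_rotation.induct) auto

lemma size_tamari: "tamari s t \<Longrightarrow> size s = size t"
  unfolding tamari_def by (induction rule: rtranclp_induct) (auto simp: size_rotation)

text \<open>The sum of the sizes of all right subtrees, a strict monovariant for antisymmetry: in
  the notation of \<open>right_rotation.root\<close>, a rotation increases it by
  \<open>size c + 1\<close>.\<close>

fun right_weight :: "'a tree \<Rightarrow> nat"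
  where
    "right_weight Leaf = 0"
  | "right_weight (Node l x r) = right_weight l + right_weight r + size r"

lemma right_weight_rotation: "right_rotation s t \<Longrightarrow> right_weight s < right_weight t"
  by (induction rule: right_rotation.induct) (auto simp: size_rotation)

lemma right_weight_tamari: "tamari s t \<Longrightarrow> s = t \<or> right_weight s < right_weight t"
  unfolding tamari_def
  by (induction rule: rtranclp_induct) (auto dest: right_weight_rotation intro: less_trans)

lemma tamari_antisym: "tamari s t \<Longrightarrow> tamari t s \<Longrightarrow> s = t"
  using right_weight_tamari less_asym by blast

lemma low_0 [simp]: "low 0 t = Leaf"
  by (induction t) auto

lemma high_0 [simp]: "high 0 t = t"
  by (induction t) auto

text \<open>A rotation restricts to a rotation when both rotated nodes are kept, and to an equality
  otherwise. The same holds for \<open>high\<close>.\<close>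

lemma tamari_low_rotation: "right_rotation s t \<Longrightarrow> tamari (low p s) (low p t)"
proof (induction arbitrary: p rule: right_rotation.induct)
  case (left l l' r)
  then show ?case by (simp add: size_rotation[OF left.hyps] tamari_left right_rotation_tamari)
qed (auto simp: tamari_rotation tamari_right right_rotation_tamari)

lemma tamari_high_rotation: "right_rotation s t \<Longrightarrow> tamari (high p s) (high p t)"
proof (induction arbitrary: p rule: right_rotation.induct)
  case (left l l' r)
  then show ?case by (simp add: size_rotation[OF left.hyps] tamari_left right_rotation_tamari)
qed (auto simp: tamari_rotation tamari_right right_rotation_tamari)

lemma tamari_low:
  assumes "tamari s t"
  shows "tamari (low p s) (low p t)"
  using assms[unfolded tamari_def]
proof (induction rule: rtranclp_induct)
  case (step t u)
  then show ?case by (blast intro: tamari_trans tamari_low_rotation)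
qed simp

lemma tamari_high:
  assumes "tamari s t"
  shows "tamari (high p s) (high p t)"
  using assms[unfolded tamari_def]
proof (induction rule: rtranclp_induct)
  case (step t u)
  then show ?case by (blast intro: tamari_trans tamari_high_rotation)
qed simp

lemma size_glue_left [simp]: "size (glue_left s t) = size s + size t"
  by (induction s t rule: glue_left.induct) auto

lemma size_glue_right [simp]: "size (glue_right s t) = size s + size t"
  by (induction s t rule: glue_right.induct) auto

lemma low_size [simp]: "size t \<le> p \<Longrightarrow> low p t = t"
  by (induction t arbitrary: p) auto

lemma high_size [simp]: "size t \<le> p \<Longrightarrow> high p t = Leaf"
  by (induction t arbitrary: p) auto

lemma low_glue_left: "low (size s) (glue_left s t) = s"
  by (induction s t rule: glue_left.induct) auto

lemma high_glue_left: "high (size s) (glue_left s t) = t"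
  by (induction s t rule: glue_left.induct) auto

lemma low_glue_right: "low (size s) (glue_right s t) = s"
  by (induction s t rule: glue_right.induct) auto

lemma high_glue_right: "high (size s) (glue_right s t) = t"
  by (induction s t rule: glue_right.induct) auto

text \<open>The node with left subtree \<open>l\<close> climbs the left branch of \<open>y\<close>,
  passing each node of the branch by one rotation.\<close>

lemma tamari_glue_left_Node: "tamari (glue_left (Node l () x) y) (Node l () (glue_left x y))"
proof (induction y)
  case (Node a u b)
  have "tamari (Node (glue_left (Node l () x) a) () b) (Node (Node l () (glue_left x a)) () b)"
    by (rule tamari_left[OF Node.IH(1)])
  then show ?case
    by (auto intro: tamari_trans tamari_rotation)
qed simp

text \<open>Mirror image: the root descends along the right branch of \<open>x\<close>, one rotation
  per node.\<close>

lemma tamari_glue_right_Node: "tamari (Node (glue_right x y) () r) (glue_right x (Node y () r))"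
proof (induction x)
  case (Node a u b)
  have "tamari (Node a () (Node (glue_right b y) () r)) (Node a () (glue_right b (Node y () r)))"
    by (rule tamari_right[OF Node.IH(2)])
  then show ?case
    by (auto intro: tamari_trans tamari_rotation)
qed simp

text \<open>If the cut falls into the right subtree, the root of \<open>u\<close> ends up at the
  bottom of the left branch of the high part, and the rotations of
  \<open>tamari_glue_left_Node\<close> bring it back to the top.\<close>

lemma tamari_glue_left_restrict: "tamari (glue_left (low p u) (high p u)) u"
proof (induction u arbitrary: p)
  case (Node l x r)
  then show ?case
    by (auto intro: tamari_left tamari_trans[OF tamari_glue_left_Node] tamari_right)
qed simp

lemma tamari_glue_right_restrict: "tamari u (glue_right (low p u) (high p u))"
proof (induction u arbitrary: p)
  case (Node l x r)
  then show ?case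
    by (auto intro: tamari_right tamari_trans[OF _ tamari_glue_right_Node] tamari_left)
qed simp

text \<open>Both ends of the interval have the restrictions \<open>s\<close> and \<open>t\<close>,
  so monotonicity and antisymmetry pin down the restrictions of every tree between them.\<close>

lemma tamari_interval_iff:
  assumes "size u = size s + size t"
  shows "tamari (glue_left s t) u \<and> tamari u (glue_right s t) \<longleftrightarrow>
    low (size s) u = s \<and> high (size s) u = t"
proof
  assume *: "tamari (glue_left s t) u \<and> tamari u (glue_right s t)"
  show "low (size s) u = s \<and> high (size s) u = t"
    using tamari_low[of "glue_left s t" u "size s"] tamari_low[of u "glue_right s t" "size s"]
      tamari_high[of "glue_left s t" u "size s"] tamari_high[of u "glue_right s t" "size s"] *
    by (simp add: low_glue_left low_glue_right high_glue_left high_glue_right tamari_antisym)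
next
  assume "low (size s) u = s \<and> high (size s) u = t"
  then show "tamari (glue_left s t) u \<and> tamari u (glue_right s t)"
    using tamari_glue_left_restrict[of "size s" u] tamari_glue_right_restrict[of u "size s"] by simp
qed

lemma tamari_glue: "tamari (glue_left s t) (glue_right s t)"
  using tamari_glue_left_restrict[of "size s" "glue_right s t"]
  by (simp add: low_glue_right high_glue_right)

section \<open>Cutting search trees by label\<close>

fun lowl :: "nat \<Rightarrow> nat tree \<Rightarrow> nat tree"
  where
    "lowl p Leaf = Leaf"
  | "lowl p (Node l a r) = (if a \<le> p then Node l a (lowl p r) else lowl p l)"

fun highl :: "nat \<Rightarrow> nat tree \<Rightarrow> nat tree"
  where
    "highl p Leaf = Leaf"
  | "highl p (Node l a r) = (if a \<le> p then highl p r else Node (highl p l) a r)"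

lemma lowl_bst_insert:
  "lowl p (bst_insert x t) = (if x \<le> p then bst_insert x (lowl p t) else lowl p t)"
  by (induction t) auto

lemma highl_bst_insert:
  "highl p (bst_insert x t) = (if x \<le> p then highl p t else bst_insert x (highl p t))"
  by (induction t) auto

lemma bst_filter_le: "bstree (filter (\<lambda>x. x \<le> p) w) = lowl p (bstree w)"
  by (induction w) (auto simp: lowl_bst_insert)

lemma bst_filter_gt: "bstree (filter (\<lambda>x. p < x) w) = highl p (bstree w)"
  by (induction w) (auto simp: highl_bst_insert)

lemma search_le_empty:
  fixes r :: "nat tree"
  assumes "\<forall>x\<in>set_tree r. p < x"
  shows "length (filter (\<lambda>x. x \<le> p) (inorder r)) = 0"
  using assms by (auto simp: filter_empty_conv dest: leD)

lemma search_le_all: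
  fixes l :: "nat tree"
  assumes "\<forall>x\<in>set_tree l. x \<le> p"
  shows "length (filter (\<lambda>x. x \<le> p) (inorder l)) = size l"
proof -
  have "filter (\<lambda>x. x \<le> p) (inorder l) = inorder l"
    using assms by (simp add: filter_id_conv)
  then show ?thesis by simp
qed

text \<open>In a search tree the labels up to \<open>p\<close> come first in infix order, so cutting
  by label is cutting after as many nodes as there are such labels.\<close>

lemma shape_lowl:
  assumes "search t"
  shows "shape (lowl p t) = low (length (filter (\<lambda>x. x \<le> p) (inorder t))) (shape t)"
  using assms
proof (induction t)
  case (Node l a r)
  show ?case
  proof (cases "a \<le> p")
    case True
    then have "length (filter (\<lambda>x. x \<le> p) (inorder l)) = size l"
      using Node.prems by (intro search_le_all) auto
    then show ?thesis using Node True by simp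
  next
    case False
    then have "length (filter (\<lambda>x. x \<le> p) (inorder r)) = 0"
      using Node.prems by (intro search_le_empty) auto
    moreover have "length (filter (\<lambda>x. x \<le> p) (inorder l)) \<le> size l"
      by (metis length_filter_le length_inorder)
    ultimately show ?thesis using Node False by simp
  qed
qed simp

lemma shape_highl:
  assumes "search t"
  shows "shape (highl p t) = high (length (filter (\<lambda>x. x \<le> p) (inorder t))) (shape t)"
  using assms
proof (induction t)
  case (Node l a r)
  show ?case
  proof (cases "a \<le> p")
    case True
    then have "length (filter (\<lambda>x. x \<le> p) (inorder l)) = size l"
      using Node.prems by (intro search_le_all) auto
    then show ?thesis using Node True by simp
  next
    case False
    then have "length (filter (\<lambda>x. x \<le> p) (inorder r)) = 0"
      using Node.prems by (intro search_le_empty) auto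
    moreover have "length (filter (\<lambda>x. x \<le> p) (inorder l)) \<le> size l"
      by (metis length_filter_le length_inorder)
    ultimately show ?thesis using Node False by simp
  qed
qed simp

lemma length_filter_inorder_bst:
  "length (filter C (inorder (bstree w))) = length (filter C w)"
  using mset_inorder_bst[of w] by (metis mset_filter size_mset)

lemma shape_bst_filter_le:
  "shape (bstree (filter (\<lambda>x. x \<le> p) w)) = low (length (filter (\<lambda>x. x \<le> p) w)) (shape (bstree w))"
  by (simp only: bst_filter_le shape_lowl[OF search_bst] length_filter_inorder_bst)

lemma shape_bst_filter_gt:
  "shape (bstree (filter (\<lambda>x. p < x) w)) = high (length (filter (\<lambda>x. x \<le> p) w)) (shape (bstree w))"
  by (simp only: bst_filter_gt shape_highl[OF search_bst] length_filter_inorder_bst)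

section \<open>\<open>m\<close>-binary trees\<close>

text \<open>
  In a tree whose nodes are preceded by \<open>s\<close> others, only the nodes at positions divisible by \<open>m\<close>
  (in infix order, counted from 1) may have a right child.
\<close>

fun mbin :: "nat \<Rightarrow> nat \<Rightarrow> 'a tree \<Rightarrow> bool"
  where
    "mbin m s Leaf \<longleftrightarrow> True"
  | "mbin m s (Node l x r) \<longleftrightarrow>
      mbin m s l \<and> (r \<noteq> Leaf \<longrightarrow> m dvd s + size l + 1) \<and> mbin m (s + size l + 1) r"

lemma mbin_shape [simp]: "mbin m s (shape t) \<longleftrightarrow> mbin m s t"
  by (induction t arbitrary: s) auto

lemma mbin_shift:
  assumes "m dvd k"
  shows "mbin m (k + s) t \<longleftrightarrow> mbin m s t"
proof (induction t arbitrary: s)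
  case (Node l x r)
  have "m dvd k + s + size l + 1 \<longleftrightarrow> m dvd s + size l + 1"
    using dvd_add_right_iff[OF assms, of "s + size l + 1"] by (simp add: add.assoc)
  then show ?case
    using Node[of s] Node(2)[of "s + size l + 1"] by (simp add: add.assoc)
qed simp

text \<open>The right-most node of \<open>t\<close> has position \<open>s + size t\<close> and
  acquires the right child \<open>u\<close>; all other nodes keep their positions and the presence
  or absence of a right child.\<close>

lemma mbin_glue_right:
  assumes "u \<noteq> Leaf"
  shows "mbin m s (glue_right t u) \<longleftrightarrow>
    mbin m s t \<and> (t \<noteq> Leaf \<longrightarrow> m dvd s + size t) \<and> mbin m (s + size t) u"
proof (induction t arbitrary: s)
  case (Node l x r)
  have "glue_right r u \<noteq> Leaf" using assms by (cases r) auto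
  then show ?case using Node(2)[of "Suc (s + size l)"]
    by (cases "r = Leaf") (auto simp: add.assoc)
qed simp

text \<open>The labels increase weakly in infix order and are constant on blocks of \<open>m\<close>
  positions. The only demand of \<open>search\<close> that can fail is strictness on the right: the
  position of a node with a right child must end a block.\<close>

lemma search_iff_mbin:
  assumes "inorder t = map (\<lambda>j. Suc (j div m)) [s..<s + size t]"
  shows "search t \<longleftrightarrow> mbin m s t"
  using assms
proof (induction t arbitrary: s)
  case (Node l a r)
  let ?f = "\<lambda>j. Suc (j div m)"
  let ?k = "s + size l"
  have split: "[s..<s + size (Node l a r)] = [s..<?k] @ ?k # [Suc ?k..<Suc ?k + size r]"
    using upt_add_eq_append[of s ?k "Suc (size r)"] by (simp add: upt_conv_Cons add.assoc del: upt_Suc)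
  have eqs: "inorder l = map ?f [s..<?k]" "a = ?f ?k" "inorder r = map ?f [Suc ?k..<Suc ?k + size r]"
    using Node.prems unfolding split by (auto simp: append_eq_append_conv)
  have l: "\<forall>x\<in>set_tree l. x \<le> a"
    unfolding set_inorder[symmetric] eqs by (auto intro: div_le_mono)
  have r: "(\<forall>x\<in>set_tree r. a < x) \<longleftrightarrow> (r \<noteq> Leaf \<longrightarrow> m dvd Suc ?k)"
  proof (cases "r = Leaf")
    case False
    have *: "?f ?k < ?f (Suc ?k) \<longleftrightarrow> m dvd Suc ?k"
      by (simp add: div_Suc dvd_eq_mod_eq_0)
    have "size r > 0" using False by (cases r) auto
    then have "Suc ?k \<in> set [Suc ?k..<Suc ?k + size r]"
      by (simp only: set_upt atLeastLessThan_iff) simp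
    then have "?f (Suc ?k) \<in> set_tree r"
      unfolding set_inorder[symmetric] eqs(3) set_map by (rule imageI)
    moreover have "?f (Suc ?k) \<le> x" if x: "x \<in> set_tree r" for x
    proof -
      obtain j where "x = ?f j" "Suc ?k \<le> j"
        using x unfolding set_inorder[symmetric] eqs(3) by auto
      then show ?thesis by (simp add: div_le_mono del: div_Suc)
    qed
    ultimately show ?thesis using False * eqs(2) by fastforce
  qed simp
  have "search l \<longleftrightarrow> mbin m s l" "search r \<longleftrightarrow> mbin m (Suc ?k) r"
    by (intro Node.IH eqs)+
  then show ?case
    using l r by (simp add: conj_commute)
qed simp

text \<open>The sorted \<open>m\<close>-permutation of \<open>n\<close>, written by positions so
  that it matches the labelling in \<open>search_iff_mbin\<close>.\<close>

definition flat :: "nat \<Rightarrow> nat \<Rightarrow> nat list"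
  where "flat m n = map (\<lambda>j. Suc (j div m)) [0..<m * n]"

lemma flat_Suc: "m \<ge> 1 \<Longrightarrow> flat m (Suc n) = flat m n @ replicate m (Suc n)"
proof -
  assume m: "m \<ge> 1"
  have "[0..<m * Suc n] = [0..<m * n] @ [m * n..<m * n + m]"
    using upt_add_eq_append[of 0 "m * n" m] by (simp add: add.commute)
  moreover have "map (\<lambda>j. Suc (j div m)) [m * n..<m * n + m] = replicate m (Suc n)"
  proof (rule replicate_eqI)
    fix y assume "y \<in> set (map (\<lambda>j. Suc (j div m)) [m * n..<m * n + m])"
    then obtain j where "y = Suc (j div m)" "m * n \<le> j" "j < m * n + m" by auto
    then show "y = Suc n" using m
      by (metis add.commute div_nat_eqI mult.commute mult_Suc)
  qed simp
  ultimately show ?thesis by (simp add: flat_def)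
qed

lemma count_list_replicate: "count_list (replicate k a) b = (if a = b then k else 0)"
  by (induction k) auto

lemma flat_mperm: "m \<ge> 1 \<Longrightarrow> flat m n \<in> mperms_of m n"
proof (induction n)
  case (Suc n)
  then have IH: "flat m n \<in> mperms_of m n" by simp
  then have "Suc n \<notin> set (flat m n)" using mperms_ofD(3) by fastforce
  then show ?case
    using IH Suc.prems by (auto simp: mperms_of_def flat_Suc count_list_replicate count_notin le_Suc_eq)
qed (simp add: flat_def)

lemma mset_eq_count_list: "count (mset w) = count_list w"
  by (induction w) auto

lemma mset_mperm: "w \<in> mperms_of m n \<Longrightarrow> w' \<in> mperms_of m n \<Longrightarrow> mset w = mset w'"
proof (rule multiset_eqI)
  fix a assume w: "w \<in> mperms_of m n" "w' \<in> mperms_of m n"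
  show "count (mset w) a = count (mset w') a"
  proof (cases "a \<in> {1..n}")
    case False
    then have "a \<notin> set w" "a \<notin> set w'" using w mperms_ofD(3) by blast+
    then show ?thesis by (simp add: mset_eq_count_list count_notin)
  qed (use w in \<open>simp add: mset_eq_count_list mperms_of_def\<close>)
qed

lemma mset_mperm_cong:
  assumes "w \<in> mperms_of m n" "mset w' = mset w"
  shows "w' \<in> mperms_of m n"
  using assms by (auto simp: mperms_of_def simp flip: mset_eq_count_list dest: mset_eq_setD)

lemma sorted_flat: "sorted (flat m n)"
  by (auto simp: flat_def sorted_iff_nth_mono intro: div_le_mono)

lemma sort_mperm: "m \<ge> 1 \<Longrightarrow> w \<in> mperms_of m n \<Longrightarrow> sort w = flat m n"
  using sorted_flat flat_mperm mset_mperm by (metis properties_for_sort)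

lemma mbin_bst_mperm:
  assumes "w \<in> mperms_of m n" "m \<ge> 1"
  shows "mbin m 0 (bstree w)" "size (bstree w) = m * n"
proof -
  have 1: "inorder (bstree w) = flat m n"
    using assms by (simp add: inorder_bst sort_mperm)
  then have "length (inorder (bstree w)) = m * n" by (simp add: flat_def)
  then show "size (bstree w) = m * n" by simp
  then show "mbin m 0 (bstree w)"
    using 1 search_iff_mbin[of "bstree w" m 0] search_bst by (simp add: flat_def)
qed

lemma ex_labelled: "length xs = size t \<Longrightarrow> \<exists>t'. shape t' = t \<and> inorder t' = xs"
proof (induction t arbitrary: xs)
  case (Node l u r)
  obtain l' where l': "shape l' = l" "inorder l' = take (size l) xs"
    using Node(1)[of "take (size l) xs"] Node.prems by auto
  obtain r' where r': "shape r' = r" "inorder r' = drop (Suc (size l)) xs"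
    using Node(2)[of "drop (Suc (size l)) xs"] Node.prems by auto
  have "shape (Node l' (xs ! size l) r') = Node l u r" "inorder (Node l' (xs ! size l) r') = xs"
    using l' r' Node.prems by (auto simp: Cons_nth_drop_Suc)
  then show ?case by blast
qed (rule exI[of _ Leaf], simp)

text \<open>Labelling \<open>t\<close> in infix order by \<open>flat m n\<close> gives a search tree
  by \<open>search_iff_mbin\<close>; its postorder reading is a word whose insertion rebuilds
  it.\<close>

lemma ex_mperm_shape:
  assumes "mbin m 0 t" "size t = m * n" "m \<ge> 1"
  shows "\<exists>w\<in>mperms_of m n. shape (bstree w) = t"
proof -
  obtain t' where t': "shape t' = t" "inorder t' = flat m n"
    using ex_labelled[of "flat m n" t] assms(2) by (auto simp: flat_def)
  have "size t' = m * n" using t'(1) assms(2) by (metis size_map_tree)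
  then have "search t'"
    using search_iff_mbin[of t' m 0] t' assms(1) by (auto simp: flat_def)
  then have "bstree (postorder t') = t'" by (rule bst_postorder)
  moreover have "postorder t' \<in> mperms_of m n"
  proof (rule mset_mperm_cong[OF flat_mperm[OF assms(3)]])
    have "mset (inorder t') = mset (postorder t')"
      using \<open>bstree (postorder t') = t'\<close> mset_inorder_bst[of "postorder t'"] by simp
    then show "mset (postorder t') = mset (flat m n)" using t'(2) by simp
  qed
  ultimately show ?thesis using t'(1) by metis
qed

section \<open>The bijection with \<open>(m+1)\<close>-ary trees\<close>

fun nodes :: "ptree \<Rightarrow> nat"
  where
    "nodes Tip = 0"
  | "nodes (Br ts) = Suc (sum_list (map nodes ts))"

text \<open>A list of \<open>k\<close> trees is joined by \<open>k - 1\<close> nodes; the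
  \<open>Suc\<close> stands for the root placed above them by \<open>to_bin\<close>.\<close>

lemma size_left_part: "ts \<noteq> [] \<Longrightarrow> Suc (size (left_part ts)) = sum_list (map size ts) + length ts"
  by (induction ts rule: left_part.induct) auto

text \<open>The joining nodes have no right child of their own. New right children appear only at
  the right-most node of a piece, whose position is a multiple of \<open>m\<close> because all sizes
  are.\<close>

lemma mbin_left_part:
  assumes "\<forall>t\<in>set ts. mbin m 0 t \<and> m dvd size t"
  shows "mbin m 0 (left_part ts)"
  using assms
proof (induction ts rule: left_part.induct)
  case (3 t t' ts)
  have "mbin m (size t) (Node (left_part (t' # ts)) () Leaf)"
    using 3 mbin_shift[of m "size t" 0] by auto
  then show ?case using 3 by (simp add: mbin_glue_right)
qed auto

lemma to_bin_Br:
  assumes "ts \<noteq> []"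
  shows "to_bin (Br ts) = Node (left_part (rev (map to_bin (butlast ts)))) () (to_bin (last ts))"
  using assms by (simp add: map_butlast last_map)

declare to_bin.simps(2) [simp del]

lemma sum_list_butlast_last:
  fixes f :: "'a \<Rightarrow> nat"
  shows "ts \<noteq> [] \<Longrightarrow> sum_list (map f (butlast ts)) + f (last ts) = sum_list (map f ts)"
  by (induction ts) auto

lemma to_bin_mbin:
  assumes "ary (Suc m) T" "m \<ge> 1"
  shows "size (to_bin T) = m * nodes T \<and> mbin m 0 (to_bin T)"
  using assms(1)
proof (induction T)
  case (Br ts)
  define bs where "bs = rev (map to_bin (butlast ts))"
  have ts: "length ts = Suc m" "ts \<noteq> []" using Br.prems by auto
  have IH: "size (to_bin t) = m * nodes t" "mbin m 0 (to_bin t)" if "t \<in> set ts" for t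
    using Br.IH[OF that] Br.prems that by auto
  have bs: "length bs = m" "bs \<noteq> []"
    using ts assms(2) by (auto simp: bs_def simp flip: length_0_conv)
  have "sum_list (map size bs) = sum_list (map (\<lambda>t. size (to_bin t)) (butlast ts))"
    by (simp add: bs_def rev_map[symmetric] comp_def)
  also have "\<dots> = sum_list (map (\<lambda>t. m * nodes t) (butlast ts))"
    using IH(1) in_set_butlastD by (intro arg_cong[of _ _ sum_list] map_cong) fastforce+
  \<comment> \<open>The root of the binary tree thus has a position divisible by \<open>m\<close>,
    as its right subtree requires.\<close>
  finally have size_l: "Suc (size (left_part bs)) = m * Suc (sum_list (map nodes (butlast ts)))"
    using size_left_part[OF bs(2)] bs(1) by (simp add: sum_list_const_mult)
  have size: "size (to_bin (Br ts)) = m * nodes (Br ts)"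
    using size_l IH(1)[of "last ts"] ts
    by (simp add: to_bin_Br sum_list_butlast_last[of ts nodes, symmetric] distrib_left flip: bs_def)
  have "mbin m 0 (left_part bs)"
    using IH in_set_butlastD by (intro mbin_left_part) (fastforce simp: bs_def)
  moreover have "m dvd Suc (size (left_part bs))" by (simp add: size_l)
  ultimately have "mbin m 0 (to_bin (Br ts))"
    using IH(2)[of "last ts"] ts mbin_shift[of m "Suc (size (left_part bs))" 0 "to_bin (last ts)"]
    by (simp add: to_bin_Br flip: bs_def)
  then show ?case using size by simp
qed simp

text \<open>The glued node is the last one on the right branch, so both parts can be read off from
  the result.\<close>

lemma glue_right_single_inj:
  "glue_right s (Node l () Leaf) = glue_right s' (Node l' () Leaf) \<Longrightarrow> s = s' \<and> l = l'"
proof (induction s arbitrary: s')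
  case Leaf
  then show ?case by (cases s') (auto, metis glue_right.elims tree.distinct(1))
next
  case (Node a u b)
  have "glue_right b (Node l () Leaf) \<noteq> Leaf" by (cases b) auto
  then obtain a' u' b' where s': "s' = Node a' u' b'" using Node.prems by (cases s') auto
  then show ?case using Node by auto
qed

lemma ex_glue_right_single: "t \<noteq> Leaf \<Longrightarrow> \<exists>s l. t = glue_right s (Node l () Leaf)"
proof (induction t)
  case (Node a u b)
  show ?case
  proof (cases "b = Leaf")
    case True
    then show ?thesis by (intro exI[of _ Leaf] exI[of _ a]) simp
  next
    case False
    then obtain s l where "b = glue_right s (Node l () Leaf)" using Node by auto
    then show ?thesis by (intro exI[of _ "Node a () s"] exI[of _ l]) simp
  qed
qed simp

text \<open>The pieces are peeled off along the right branches. The common length decides where the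
  peeling stops, since a non-empty last piece could itself be taken apart in the same way.\<close>

lemma left_part_inj:
  assumes "left_part ts = left_part ts'" "length ts = length ts'"
  shows "ts = ts'"
  using assms(2,1)
proof (induction ts ts' rule: list_induct2)
  case (Cons t ts t' ts')
  then show ?case by (cases ts; cases ts') (auto dest!: glue_right_single_inj)
qed simp

text \<open>The residue \<open>j\<close> is the number of joining nodes still to be removed. The
  last node on the right branch is one of them: the tree \<open>s\<close> before it is empty or its
  right-most node has a right child, so \<open>size s\<close> is divisible by \<open>m\<close>, and
  the left subtree \<open>l\<close> has a residue one smaller.\<close>

lemma ex_left_part:
  assumes "mbin m 0 t" "size t mod m = j" "j < m"
  shows "\<exists>ts. length ts = Suc j \<and> (\<forall>t\<in>set ts. mbin m 0 t \<and> m dvd size t) \<and> left_part ts = t"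
  using assms
proof (induction j arbitrary: t)
  case 0
  then show ?case by (intro exI[of _ "[t]"]) auto
next
  case (Suc j)
  then have "t \<noteq> Leaf" by auto
  then obtain s l where t: "t = glue_right s (Node l () Leaf)" using ex_glue_right_single by blast
  have s: "mbin m 0 s" "m dvd size s" and l: "mbin m (size s) l"
    using Suc.prems(1) by (cases "s = Leaf"; simp add: t mbin_glue_right)+
  obtain k where k: "size s = m * k" using s(2) by (auto elim: dvdE)
  have "Suc (size l) mod m = Suc j"
    using Suc.prems(2) by (simp add: t k)
  then have "size l mod m = j"
    using Suc.prems(3) by (metis mod_Suc nat.inject old.nat.distinct(1))
  moreover have "mbin m 0 l" using l mbin_shift[OF s(2), of 0 l] by simp
  ultimately obtain ts where ts: "length ts = Suc j" "\<forall>t\<in>set ts. mbin m 0 t \<and> m dvd size t" "left_part ts = l"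
    using Suc.IH Suc.prems(3) by auto
  then have "left_part (s # ts) = t" by (cases ts) (auto simp: t)
  then show ?case using s ts by (intro exI[of _ "s # ts"]) auto
qed

lemma to_bin_inj:
  assumes "ary (Suc m) S" "ary (Suc m) T" "to_bin S = to_bin T"
  shows "S = T"
  using assms
proof (induction S arbitrary: T)
  case Tip
  then show ?case by (cases T) (auto simp: to_bin.simps Let_def)
next
  case (Br ts)
  then obtain us where T: "T = Br us" by (cases T) (auto simp: to_bin.simps Let_def)
  have len: "length ts = Suc m" "length us = Suc m" using Br.prems T by auto
  then have ne: "ts \<noteq> []" "us \<noteq> []" by auto
  have "left_part (rev (map to_bin (butlast ts))) = left_part (rev (map to_bin (butlast us)))"
    and last: "to_bin (last ts) = to_bin (last us)"
    using Br.prems(3) by (simp_all add: T to_bin_Br ne)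
  then have "map to_bin (butlast ts) = map to_bin (butlast us)"
    using left_part_inj len by fastforce
  then have "map to_bin (butlast ts @ [last ts]) = map to_bin (butlast us @ [last us])"
    using last by simp
  then have maps: "map to_bin ts = map to_bin us" using ne by simp
  have "ts = us"
  proof (rule nth_equalityI)
    fix i assume i: "i < length ts"
    have "to_bin (ts ! i) = to_bin (us ! i)"
      using arg_cong[OF maps, of "\<lambda>xs. xs ! i"] i len by simp
    then show "ts ! i = us ! i"
      using Br.IH[of "ts ! i" "us ! i"] Br.prems(1,2) i len by (simp add: T)
  qed (simp add: len)
  then show ?case by (simp add: T)
qed

lemma to_bin_surj:
  assumes "mbin m 0 t" "m dvd size t" "m \<ge> 1"
  shows "\<exists>T. ary (Suc m) T \<and> to_bin T = t"
  using assms(1,2)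
proof (induction "size t" arbitrary: t rule: less_induct)
  case less
  show ?case
  proof (cases t)
    case Leaf
    then show ?thesis by (intro exI[of _ Tip]) simp
  next
    case (Node l u r)
    \<comment> \<open>For empty \<open>r\<close> this is the hypothesis on the size of
      \<open>t\<close>; otherwise it is the condition that \<open>mbin\<close> puts on a node with a
      right child.\<close>
    have dvd: "m dvd Suc (size l)"
      using less.prems by (cases "r = Leaf") (auto simp: Node)
    have r: "mbin m 0 r" "m dvd size r"
      using less.prems mbin_shift[OF dvd, of 0 r] dvd_add_right_iff[OF dvd, of "size r"]
      by (simp_all add: Node)
    \<comment> \<open>This residue yields exactly \<open>m\<close> pieces in
      \<open>ex_left_part\<close>.\<close>
    have "size l mod m = m - 1"
      using dvd assms(3) by (metis Suc_diff_1 diff_Suc_1 dvd_imp_mod_0 mod_Suc not_one_le_zero nat.distinct(1) neq0_conv)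
    then obtain ts where ts: "length ts = m" "\<forall>t\<in>set ts. mbin m 0 t \<and> m dvd size t" "left_part ts = l"
      using ex_left_part[of m l "m - 1"] less.prems assms(3) by (auto simp: Node)
    have "size t' < size t" if "t' \<in> set ts" for t'
    proof -
      have "size t' \<le> sum_list (map size ts)" using that by (simp add: member_le_sum_list)
      moreover have "Suc (size l) = sum_list (map size ts) + length ts"
        using size_left_part[of ts] ts assms(3) by (cases ts) auto
      ultimately show ?thesis using ts(1) assms(3) by (simp add: Node)
    qed
    then have "\<forall>t'\<in>set ts. \<exists>T. ary (Suc m) T \<and> to_bin T = t'"
      using less.hyps ts(2) by blast
    then obtain g where g: "\<And>t'. t' \<in> set ts \<Longrightarrow> ary (Suc m) (g t') \<and> to_bin (g t') = t'"
      by metis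
    obtain R where R: "ary (Suc m) R" "to_bin R = r"
      using less.hyps[of r] r by (auto simp: Node)
    have "map to_bin (map g ts) = ts" using g by (simp add: map_idI)
    then have "to_bin (Br (rev (map g ts) @ [R])) = t"
      using ts R by (simp add: to_bin_Br Node rev_map)
    moreover have "ary (Suc m) (Br (rev (map g ts) @ [R]))"
      using ts g R by auto
    ultimately show ?thesis by blast
  qed
qed

section \<open>Labelling of sylvester classes by trees\<close>

lemma sylv_unique:
  assumes "w \<in> mperms_of m n" "m \<ge> 1"
  shows "\<exists>!T. T \<in> ary_trees m \<and> to_bin T = shape (bstree w)"
  using to_bin_surj[of m "shape (bstree w)"] mbin_bst_mperm[OF assms] assms(2) to_bin_inj
  by (intro ex_ex1I) (simp_all, metis)

lemma sylv_spec:
  assumes "w \<in> mperms m" "m \<ge> 1"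
  shows "sylv m w \<in> ary_trees m" "to_bin (sylv m w) = shape (bstree w)"
proof -
  obtain n where "w \<in> mperms_of m n" using assms(1) by (auto simp: mperms_def)
  from theI'[OF sylv_unique[OF this assms(2)]]
  show "sylv m w \<in> ary_trees m" "to_bin (sylv m w) = shape (bstree w)"
    by (simp_all add: sylv_def bst_shape_std[unfolded One_nat_def])
qed

lemma sylv_eqI:
  assumes "w \<in> mperms m" "m \<ge> 1" "T \<in> ary_trees m" "to_bin T = shape (bstree w)"
  shows "sylv m w = T"
  using sylv_spec[OF assms(1,2)] assms(3,4) to_bin_inj by simp

lemma nodes_sylv:
  assumes "w \<in> mperms_of m n" "m \<ge> 1"
  shows "nodes (sylv m w) = n"
proof -
  have w: "w \<in> mperms m" using assms(1) by (auto simp: mperms_def)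
  have "m * nodes (sylv m w) = size (to_bin (sylv m w))"
    using to_bin_mbin[of m "sylv m w"] sylv_spec(1)[OF w assms(2)] assms(2) by simp
  then show ?thesis
    using sylv_spec(2)[OF w assms(2)] mbin_bst_mperm(2)[OF assms] assms(2) by simp
qed

lemma ex_sylv:
  assumes "T \<in> ary_trees m" "m \<ge> 1"
  shows "\<exists>w\<in>mperms_of m (nodes T). sylv m w = T"
proof -
  obtain w where "w \<in> mperms_of m (nodes T)" "shape (bstree w) = to_bin T"
    using ex_mperm_shape[of m "to_bin T" "nodes T"] to_bin_mbin[of m T] assms by auto
  then show ?thesis using sylv_eqI[of w m T] assms by (auto simp: mperms_def)
qed

text \<open>Equal trees have equal numbers of nodes, so the two words have the same content, and
  then equality of shapes suffices.\<close>

lemma sylvester_iff_sylv: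
  assumes "u \<in> mperms m" "v \<in> mperms m" "m \<ge> 1"
  shows "sylvester u v \<longleftrightarrow> sylv m u = sylv m v"
proof
  assume "sylvester u v"
  then show "sylv m u = sylv m v"
    using sylv_eqI[OF assms(1,3), of "sylv m v"] sylv_spec[OF assms(2,3)] sylvester_imp_bst by simp
next
  assume *: "sylv m u = sylv m v"
  obtain n where n: "u \<in> mperms_of m n" using assms(1) by (auto simp: mperms_def)
  obtain n' where n': "v \<in> mperms_of m n'" using assms(2) by (auto simp: mperms_def)
  have "n = n'" using nodes_sylv[OF n assms(3)] nodes_sylv[OF n' assms(3)] * by simp
  then have "mset u = mset v" using n n' mset_mperm by blast
  then show "sylvester u v"
    using sylvester_iff_shape sylv_spec(2)[OF assms(1,3)] sylv_spec(2)[OF assms(2,3)] * by simp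
qed

section \<open>The bounds of the product\<close>

lemma glue_left_glue_right: "b \<noteq> Leaf \<Longrightarrow> glue_left s (glue_right b u) = glue_right (glue_left s b) u"
  by (cases b) auto

text \<open>Leading empty pieces only prolong the left branch, so gluing at the left-most node
  reaches the piece \<open>b\<close>. If \<open>b\<close> were empty too and \<open>bs\<close> were
  not, the left-most node would have to be sought further on in \<open>bs\<close>; hence the
  condition.\<close>

lemma glue_left_left_part:
  assumes "b \<noteq> Leaf \<or> bs = []"
  shows "left_part (replicate k Leaf @ glue_left s b # bs) =
    glue_left s (left_part (replicate k Leaf @ b # bs))"
proof (induction k)
  case 0
  then show ?case using assms by (cases bs) (auto simp: glue_left_glue_right)
next
  case (Suc k)
  have *: "left_part (Leaf # replicate k Leaf @ x # bs) = Node (left_part (replicate k Leaf @ x # bs)) () Leaf" for x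
    by (cases k) auto
  show ?case using Suc by (simp add: *)
qed

lemma node_order_eq_Nil: "node_order T = [] \<longleftrightarrow> T = Tip"
  by (cases T) (auto simp: Let_def)

text \<open>The first \<open>m\<close> subtrees are visited from index \<open>m - 1\<close>
  downwards, and empty ones contribute no nodes, so the search for the first node arrives at index
  \<open>i\<close>.\<close>

lemma hd_node_order:
  assumes ts: "length ts = Suc m" and i: "i < m" "\<And>j. i < j \<Longrightarrow> j < m \<Longrightarrow> ts ! j = Tip"
  shows "hd (node_order (Br ts)) = (if ts ! i \<noteq> Tip then i # hd (node_order (ts ! i)) else
    hd (concat (map (\<lambda>j. map ((#) j) (node_order (ts ! j))) (rev [0..<i])) @ [[]]))"
proof -
  let ?f = "\<lambda>j. map ((#) j) (node_order (ts ! j))"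
  have split: "rev [0..<m] = rev [Suc i..<m] @ i # rev [0..<i]"
    using i(1) upt_add_eq_append[of 0 i "m - i"] by (simp add: upt_conv_Cons)
  have "concat (map ?f (rev [Suc i..<m])) = []"
    using i(2) by auto
  then have "concat (map ?f (rev [0..<m])) = ?f i @ concat (map ?f (rev [0..<i]))"
    unfolding split by simp
  moreover have "node_order (Br ts) = concat (map ?f (rev [0..<m])) @ [[]] @ ?f m"
    using ts by (auto simp: Let_def intro!: arg_cong[of _ _ concat])
  ultimately show ?thesis
    by (auto simp: node_order_eq_Nil hd_append hd_map)
qed

lemma ary_list_update:
  assumes "ary k (Br ts)" "ary k S"
  shows "ary k (Br (ts[i := S]))"
  using assms set_update_subset_insert[of ts i S] by auto

text \<open>\<open>left_part\<close> receives the first \<open>m\<close> subtrees in reverse, so the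
  empty ones above \<open>i\<close> are the leading empty pieces of
  \<open>glue_left_left_part\<close>. For \<open>i = 0\<close> no further piece follows, and an
  empty subtree is allowed there.\<close>

lemma to_bin_update_left:
  assumes ts: "length ts = Suc m" and i: "i < m" "\<And>j. i < j \<Longrightarrow> j < m \<Longrightarrow> ts ! j = Tip"
    and ne: "ts ! i \<noteq> Tip \<or> i = 0" and X: "to_bin X = glue_left s (to_bin (ts ! i))"
  shows "to_bin (Br (ts[i := X])) = glue_left s (to_bin (Br ts))"
proof -
  define bs where "bs = map to_bin (butlast ts)"
  have len: "length bs = m" using ts by (simp add: bs_def)
  have nth: "bs ! j = to_bin (ts ! j)" if "j < m" for j
    using that ts by (simp add: bs_def nth_butlast)
  have drop: "drop (Suc i) bs = replicate (m - Suc i) Leaf"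
    using i(2) by (intro nth_equalityI) (auto simp: len nth)
  have upd: "rev (bs[i := x]) = replicate (m - Suc i) Leaf @ x # rev (take i bs)" for x
    using i(1) len by (simp add: upd_conv_take_nth_drop drop)
  have orig: "rev bs = replicate (m - Suc i) Leaf @ to_bin (ts ! i) # rev (take i bs)"
    using upd[of "bs ! i", unfolded list_update_id] nth[OF i(1)] by simp
  have ne': "to_bin (ts ! i) \<noteq> Leaf \<or> rev (take i bs) = []"
    using ne by (cases "ts ! i") (auto simp: to_bin.simps Let_def)
  have "left_part (rev (bs[i := to_bin X])) = glue_left s (left_part (rev bs))"
    unfolding upd orig X by (rule glue_left_left_part[OF ne'])
  moreover have "map to_bin (butlast (ts[i := X])) = bs[i := to_bin X]"
    using ts i(1) by (simp add: bs_def butlast_list_update map_update)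
  moreover have "ts \<noteq> []" using ts by auto
  ultimately show ?thesis
    using ts i(1) by (simp add: to_bin_Br last_list_update flip: bs_def)
qed

lemma lower_bound_aux:
  assumes "ary (Suc m) S" "ary (Suc m) T" "T \<noteq> Tip" "m \<ge> 1"
  shows "ary (Suc m) (glue_at S (hd (node_order T)) 0 T) \<and>
    to_bin (glue_at S (hd (node_order T)) 0 T) = glue_left (to_bin S) (to_bin T)"
  using assms(2,3)
proof (induction T)
  case (Br ts)
  have ts: "length ts = Suc m" using Br.prems by simp
  show ?case
  proof (cases "\<exists>i<m. ts ! i \<noteq> Tip")
    case True
    \<comment> \<open>The non-empty subtree of largest index is the left-most one in the
      \<open>m\<close>-binary tree.\<close>
    define i where "i = Max {i. i < m \<and> ts ! i \<noteq> Tip}"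
    have fin: "finite {i. i < m \<and> ts ! i \<noteq> Tip}" by simp
    have i: "i < m" "ts ! i \<noteq> Tip"
      using Max_in[OF fin] True by (auto simp: i_def)
    have i_max: "ts ! j = Tip" if "i < j" "j < m" for j
    proof (rule ccontr)
      assume "ts ! j \<noteq> Tip"
      then have "j \<le> i" unfolding i_def using that by (intro Max_ge[OF fin]) simp
      then show False using that by simp
    qed
    have hd: "hd (node_order (Br ts)) = i # hd (node_order (ts ! i))"
      using hd_node_order[OF ts i(1) i_max] i(2) by simp
    have IH: "ary (Suc m) (glue_at S (hd (node_order (ts ! i))) 0 (ts ! i))"
      "to_bin (glue_at S (hd (node_order (ts ! i))) 0 (ts ! i)) = glue_left (to_bin S) (to_bin (ts ! i))"
      using Br.IH[of "ts ! i"] Br.prems i ts by auto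
    show ?thesis
      unfolding hd using ary_list_update[OF Br.prems(1) IH(1)] to_bin_update_left[OF ts i(1) i_max _ IH(2)] i(2)
      by simp
  next
    case False
    \<comment> \<open>Here the root is the left-most node. Its \<open>m\<close> binary nodes form a
      left chain, and the subtree of index 0 hangs below the last of them.\<close>
    then have Tip: "ts ! j = Tip" if "j < m" for j using that by auto
    have "concat (map (\<lambda>j. map ((#) j) (node_order (ts ! j))) (rev [0..<0])) = []" by simp
    then have hd: "hd (node_order (Br ts)) = []"
      using hd_node_order[OF ts, of 0] Tip assms(4) by simp
    have "to_bin S = glue_left (to_bin S) (to_bin (ts ! 0))"
      using Tip[of 0] assms(4) by simp
    from to_bin_update_left[OF ts _ _ _ this] show ?thesis
      unfolding hd using ary_list_update[OF Br.prems(1) assms(1)] Tip assms(4) by simp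
  qed
qed simp

lemma to_bin_lower_bound:
  assumes "T' \<in> ary_trees m" "T'' \<in> ary_trees m" "m \<ge> 1"
  shows "lower_bound T' T'' \<in> ary_trees m"
    "to_bin (lower_bound T' T'') = glue_left (to_bin T') (to_bin T'')"
  using lower_bound_aux[of m T' T''] assms by (auto simp: lower_bound_def)

text \<open>The right branch of the binary tree runs through the top binary nodes of the successive
  last subtrees, so the right-most nodes of both kinds of tree correspond.\<close>

lemma upper_bound_aux:
  assumes "ary (Suc m) S" "ary (Suc m) T" "T \<noteq> Tip" "m \<ge> 1"
  shows "ary (Suc m) (glue_at S (last (node_order T)) m T) \<and>
    to_bin (glue_at S (last (node_order T)) m T) = glue_right (to_bin T) (to_bin S)"
  using assms(2,3)
proof (induction T)
  case (Br ts)
  have ts: "length ts = Suc m" "ts \<noteq> []" using Br.prems by auto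
  then have last: "last ts = ts ! m" by (simp add: last_conv_nth)
  have last_order: "last (node_order (Br ts)) =
      (if ts ! m = Tip then [] else m # last (node_order (ts ! m)))"
    using ts by (auto simp: Let_def node_order_eq_Nil last_map)
  have upd: "to_bin (Br (ts[m := X])) = Node (left_part (rev (map to_bin (butlast ts)))) () (to_bin X)" for X
    using ts by (simp add: to_bin_Br last_list_update butlast_list_update)
  show ?case
  proof (cases "ts ! m = Tip")
    case True
    then show ?thesis
      using ary_list_update[OF Br.prems(1) assms(1), of m] ts
      by (simp add: last_order upd) (simp add: to_bin_Br last)
  next
    case False
    have IH: "ary (Suc m) (glue_at S (last (node_order (ts ! m))) m (ts ! m))"
      "to_bin (glue_at S (last (node_order (ts ! m))) m (ts ! m)) = glue_right (to_bin (ts ! m)) (to_bin S)"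
      using Br.IH[of "ts ! m"] Br.prems False ts by auto
    have order: "last (node_order (Br ts)) = m # last (node_order (ts ! m))"
      using last_order False by simp
    show ?thesis
      unfolding order using ary_list_update[OF Br.prems(1) IH(1), of m] ts
      by (simp add: upd IH) (simp add: to_bin_Br last)
  qed
qed simp

lemma to_bin_upper_bound:
  assumes "T' \<in> ary_trees m" "T'' \<in> ary_trees m" "m \<ge> 1"
  shows "upper_bound m T' T'' \<in> ary_trees m"
    "to_bin (upper_bound m T' T'') = glue_right (to_bin T') (to_bin T'')"
  using upper_bound_aux[of m T'' T'] assms by (auto simp: upper_bound_def)

section \<open>The Fuss-Catalan numbers\<close>

text \<open>Forests instead of single trees, because removing the root of a tree leaves
  \<open>k\<close> trees. Here \<open>r\<close> is the number of trees and \<open>n\<close> the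
  total number of internal nodes.\<close>

definition forests :: "nat \<Rightarrow> nat \<Rightarrow> nat \<Rightarrow> ptree list set"
  where "forests k r n = {ts. length ts = r \<and> (\<forall>t\<in>set ts. ary k t) \<and> sum_list (map nodes ts) = n}"

lemma forests_Suc_0: "forests k (Suc r) 0 = (#) Tip ` forests k r 0"
proof -
  have "nodes t = 0 \<longleftrightarrow> t = Tip" for t by (cases t) auto
  then show ?thesis by (auto simp: forests_def length_Suc_conv image_iff)
qed

lemma forests_Suc_Suc:
  "forests k (Suc r) (Suc n) = (#) Tip ` forests k r (Suc n) \<union>
    (\<lambda>zs. Br (take k zs) # drop k zs) ` forests k (r + k) n"
  (is "?L = ?A \<union> ?f ` ?B")
proof (intro equalityI subsetI)
  fix ts assume ts: "ts \<in> ?L"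
  then obtain t us where tus: "ts = t # us" by (cases ts) (auto simp: forests_def)
  show "ts \<in> ?A \<union> ?f ` ?B"
  proof (cases t)
    case Tip
    then show ?thesis using ts tus by (auto simp: forests_def)
  next
    case (Br vs)
    have "vs @ us \<in> ?B" "?f (vs @ us) = ts"
      using ts by (auto simp: forests_def tus Br)
    then show ?thesis by blast
  qed
next
  fix ts assume "ts \<in> ?A \<union> ?f ` ?B"
  then show "ts \<in> ?L"
  proof
    assume "ts \<in> ?f ` ?B"
    then obtain zs where zs: "zs \<in> ?B" "ts = ?f zs" by auto
    have "sum_list (map nodes (take k zs)) + sum_list (map nodes (drop k zs)) = sum_list (map nodes zs)"
      by (metis append_take_drop_id map_append sum_list_append)
    then show ?thesis
      using zs by (auto simp: forests_def dest: in_set_takeD in_set_dropD)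
  qed (auto simp: forests_def)
qed

lemma inj_on_split_forest: "inj_on (\<lambda>zs. Br (take k zs) # drop k zs) X"
  by (rule inj_onI) (metis append_take_drop_id list.inject ptree.inject)

lemma forests_0_0: "forests k 0 0 = {[]}"
  and forests_0_Suc: "forests k 0 (Suc n) = {}"
  by (auto simp: forests_def)

lemma finite_forests: "finite (forests k r n)"
proof (induction n arbitrary: r)
  case 0
  show ?case by (induction r) (auto simp: forests_0_0 forests_Suc_0)
next
  case (Suc n)
  show ?case by (induction r) (auto simp: forests_0_Suc forests_Suc_Suc Suc)
qed

lemma card_forests_Suc_Suc:
  assumes "k \<ge> 1"
  shows "card (forests k (Suc r) (Suc n)) = card (forests k r (Suc n)) + card (forests k (r + k) n)"
  unfolding forests_Suc_Suc
  by (subst card_Un_disjoint) (auto simp: finite_forests card_image inj_on_split_forest)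

text \<open>
  Removing the first tree of a forest, or the root of the first tree, gives the recurrence
  \<open>f(r+1,n+1) = f(r,n+1) + f(r+k,n)\<close> for the number \<open>f(r,n)\<close> of forests of \<open>r\<close> trees with \<open>n\<close> nodes.
\<close>

lemma card_forests:
  assumes "r > 0 \<or> n > 0" "k \<ge> 1"
  shows "real (card (forests k r n)) = real r / real (k * n + r) * real ((k * n + r) choose n)"
  using assms(1)
proof (induction n arbitrary: r)
  case 0
  have "card (forests k r 0) = 1"
    by (induction r) (auto simp: forests_0_0 forests_Suc_0 card_image)
  \<comment> \<open>For \<open>r = n = 0\<close> there is one forest, but the quotient would be
    \<open>0 / 0\<close>; this is why \<open>r > 0\<close> is used here.\<close>
  then show ?case using 0 by simp
next
  case (Suc n)
  note Suc_IH = Suc.IH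
  show ?case
  proof (induction r)
    case 0
    show ?case by (simp add: forests_0_Suc)
  next
    case (Suc r)
    \<comment> \<open>Both terms of the recurrence have this upper binomial index, and the left-hand
      side has \<open>Suc M\<close>.\<close>
    define M where "M = k * Suc n + r"
    have M: "M > 0" "k * n + (r + k) = M" "k * Suc n + Suc r = Suc M"
      using assms(2) by (auto simp: M_def)
    \<comment> \<open>The binomials \<open>M choose n\<close>, \<open>M choose Suc n\<close> and
      \<open>Suc M choose Suc n\<close> are all multiples of \<open>c\<close>, which then factors
      out of the recurrence.\<close>
    define c where "c = real (M choose n) / (real n + 1)"
    have n1: "real n + 1 \<noteq> 0" using of_nat_0_le_iff[of n] by linarith
    then have c1: "real (M choose n) = c * (real n + 1)"
      by (simp add: c_def)
    have "Suc n * (Suc M choose Suc n) = Suc M * (M choose n)"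
      by (rule Suc_times_binomial)
    then have "(real n + 1) * real (Suc M choose Suc n) = (real M + 1) * real (M choose n)"
      by (metis of_nat_Suc of_nat_mult add.commute)
    then have c3: "real (Suc M choose Suc n) = (real M + 1) * c"
      using n1 by (simp add: c_def field_simps del: binomial_Suc_Suc)
    have "real (Suc M choose Suc n) = real (M choose n) + real (M choose Suc n)"
      by simp
    then have c2: "real (M choose Suc n) = (real M - real n) * c"
      by (simp add: c1 c3 algebra_simps del: binomial_Suc_Suc)
    have rM: "real k * (real n + 1) = real M - real r" by (simp add: M_def algebra_simps)
    have M1: "real M + 1 \<noteq> 0" using of_nat_0_le_iff[of M] by linarith
    have A: "real (card (forests k r (Suc n))) = real r / real M * ((real M - real n) * c)"
      unfolding Suc.IH M_def[symmetric] c2 by (rule refl)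
    have "r + k > 0 \<or> n > 0" using assms(2) by simp
    then have B: "real (card (forests k (r + k) n)) = (real r + real k) / real M * (c * (real n + 1))"
      using Suc_IH[of "r + k"] unfolding M(2) c1 of_nat_add by blast
    have "real (card (forests k (Suc r) (Suc n))) =
        real r / real M * ((real M - real n) * c) + (real r + real k) / real M * (c * (real n + 1))"
      unfolding card_forests_Suc_Suc[OF assms(2)] of_nat_add A B by (rule refl)
    also have "\<dots> = c / real M * (real r * (real M - real n) + real r * (real n + 1) + real k * (real n + 1))"
      by (simp only: times_divide_eq_left times_divide_eq_right add_divide_distrib[symmetric])
        (simp add: algebra_simps)
    also have "\<dots> = c / real M * ((real r + 1) * real M)"
      unfolding rM by (simp add: algebra_simps)
    also have "\<dots> = (real r + 1) * c"
      using M(1) by simp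
    also have "\<dots> = (real r + 1) / (real M + 1) * ((real M + 1) * c)"
      using M1 by simp
    also have "\<dots> = real (Suc r) / real (Suc M) * real (Suc M choose Suc n)"
      unfolding c3 by (simp add: add.commute)
    finally show ?case unfolding M(3) .
  qed
qed

lemma ary_trees_conv_forests: "{T. ary k T \<and> nodes T = n} = hd ` forests k 1 n"
proof (intro equalityI subsetI)
  fix T assume "T \<in> {T. ary k T \<and> nodes T = n}"
  then have "[T] \<in> forests k 1 n" by (simp add: forests_def)
  then show "T \<in> hd ` forests k 1 n" by force
qed (auto simp: forests_def length_Suc_conv)

lemma finite_ary_trees: "finite {T. ary k T \<and> nodes T = n}"
  unfolding ary_trees_conv_forests by (simp add: finite_forests)

text \<open>The case \<open>r = 1\<close> of the forest count has upper index
  \<open>(m + 1) * n + 1\<close>; absorption lowers it by one and gives the Fuss-Catalan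
  form.\<close>

lemma card_ary_trees:
  "real (card {T. ary (Suc m) T \<and> nodes T = n}) =
    1 / (real m * real n + 1) * real ((m + 1) * n choose n)"
proof -
  let ?N = "Suc m * n"
  have "inj_on hd (forests (Suc m) 1 n)"
    by (rule inj_onI) (auto simp: forests_def length_Suc_conv)
  then have "real (card {T. ary (Suc m) T \<and> nodes T = n}) = 1 / real (?N + 1) * real (Suc ?N choose n)"
    by (simp add: ary_trees_conv_forests card_image card_forests)
  moreover have "(Suc ?N - n) * (Suc ?N choose n) = Suc ?N * (?N choose n)"
    using binomial_absorb_comp[of "Suc ?N" n] by simp
  then have "real (Suc ?N - n) * real (Suc ?N choose n) = real (Suc ?N) * real (?N choose n)"
    by (metis of_nat_mult)
  moreover have a: "real (Suc ?N - n) = real m * real n + 1" by (simp add: algebra_simps)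
  ultimately have eq: "(real m * real n + 1) * real (Suc ?N choose n) = real (Suc ?N) * real (?N choose n)"
    and card: "real (card {T. ary (Suc m) T \<and> nodes T = n}) = real (Suc ?N choose n) / real (Suc ?N)"
    by (simp_all add: add.commute)
  have "x / b = y / a" if "a * x = b * y" "a > 0" "b > 0" for a b x y :: real
    using that by (simp add: field_simps)
  moreover have "real m * real n + 1 > 0"
    by (intro add_nonneg_pos mult_nonneg_nonneg) simp_all
  moreover have "real (Suc ?N) > 0" by (rule of_nat_0_less_iff[THEN iffD2]) simp
  ultimately have "real (Suc ?N choose n) / real (Suc ?N) = real (?N choose n) / (real m * real n + 1)"
    using eq by blast
  then show ?thesis
    unfolding card by simp
qed

section \<open>The bialgebra of \<open>m\<close>-permutations\<close>

lemma linear_fq_mult_left: "Vector_Spaces.linear scl scl (\<lambda>x. fq_mult m x y)"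
  unfolding fq_mult_def by (rule linear_lin_ext)

lemma linear_fq_mult_right: "Vector_Spaces.linear scl scl (fq_mult m x)"
  unfolding fq_mult_def by (rule linear_lin_ext_fun[OF linear_lin_ext])

lemma linear_fq_comult: "Vector_Spaces.linear scl scl (fq_comult m)"
  unfolding fq_comult_def by (rule linear_lin_ext)

lemma fq_mult_F: "fq_mult m (F \<alpha>) (F \<beta>) = (\<Sum>\<gamma>\<in>shifted_shuffle m \<alpha> \<beta>. F \<gamma>)"
  by (simp add: fq_mult_def)

lemma fq_mult_sum_left: "fq_mult m (\<Sum>i\<in>I. f i) y = (\<Sum>i\<in>I. fq_mult m (f i) y)"
  by (rule linear_sumD[OF linear_fq_mult_left])

lemma fq_mult_sum_right: "fq_mult m x (\<Sum>i\<in>I. f i) = (\<Sum>i\<in>I. fq_mult m x (f i))"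
  by (rule linear_sumD[OF linear_fq_mult_right])

lemma finite_shifted_shuffle [simp]: "finite (shifted_shuffle m \<alpha> \<beta>)"
  by (simp add: shifted_shuffle_def)

lemma fq_mult_one_left: "fq_mult m (F []) x = x"
proof -
  have "map ((+) (0 :: nat)) \<beta> = \<beta>" for \<beta> by (rule map_idI) simp
  then show ?thesis by (simp add: fq_mult_def shifted_shuffle_def)
qed

lemma fq_mult_one_right: "fq_mult m x (F []) = x"
  by (simp add: fq_mult_def shifted_shuffle_def)

section \<open>Shuffles of words with disjoint alphabets\<close>

lemma shuffles_eq_filter:
  assumes "\<forall>x\<in>set u. C x" "\<forall>x\<in>set v. \<not> C x"
  shows "shuffles u v = {w. filter C w = u \<and> filter (\<lambda>x. \<not> C x) w = v}"
proof (intro equalityI subsetI)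
  fix w assume w: "w \<in> shuffles u v"
  have "filter C w \<in> shuffles (filter C u) (filter C v)"
    "filter (\<lambda>x. \<not> C x) w \<in> shuffles (filter (\<lambda>x. \<not> C x) u) (filter (\<lambda>x. \<not> C x) v)"
    using w by (auto simp: filter_shuffles[symmetric])
  moreover have "filter C u = u" "filter C v = []"
    "filter (\<lambda>x. \<not> C x) u = []" "filter (\<lambda>x. \<not> C x) v = v"
    using assms by (auto simp: filter_empty_conv filter_id_conv)
  ultimately show "w \<in> {w. filter C w = u \<and> filter (\<lambda>x. \<not> C x) w = v}" by simp
next
  fix w assume "w \<in> {w. filter C w = u \<and> filter (\<lambda>x. \<not> C x) w = v}"
  then show "w \<in> shuffles u v" using partition_in_shuffles[of w C] by auto
qed

lemma shuffles_map: "shuffles (map f u) (map f v) = map f ` shuffles u v"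
proof (induction u v rule: shuffles.induct)
  case (3 x xs y ys)
  then show ?case by (simp add: image_Un image_image)
qed auto

text \<open>\<open>wlow\<close> and \<open>whigh\<close> undo a shifted shuffle: with the cut at the
  degree of the left factor they recover both factors.\<close>

definition wlow :: "nat \<Rightarrow> nat list \<Rightarrow> nat list"
  where "wlow p w = filter (\<lambda>x. x \<le> p) w"

definition whigh :: "nat \<Rightarrow> nat list \<Rightarrow> nat list"
  where "whigh p w = map (\<lambda>x. x - p) (filter (\<lambda>x. p < x) w)"

text \<open>The letter 0 is excluded because shifting by \<open>p\<close> must produce letters
  strictly above \<open>p\<close>.\<close>

lemma map_plus_eq_iff: "filter (\<lambda>x. p < x) w = map ((+) p) v \<longleftrightarrow> whigh p w = v \<and> 0 \<notin> set v"
proof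
  assume *: "filter (\<lambda>x. p < x) w = map ((+) p) v"
  have "p < p + x" if "x \<in> set v" for x
  proof -
    have "p + x \<in> set (filter (\<lambda>x. p < x) w)" unfolding * using that by simp
    then show ?thesis by simp
  qed
  then show "whigh p w = v \<and> 0 \<notin> set v"
    by (fastforce simp: whigh_def * comp_def)
next
  assume "whigh p w = v \<and> 0 \<notin> set v"
  then have "map ((+) p) v = map (\<lambda>x. p + (x - p)) (filter (\<lambda>x. p < x) w)"
    by (auto simp: whigh_def)
  also have "\<dots> = filter (\<lambda>x. p < x) w" by (intro map_idI) auto
  finally show "filter (\<lambda>x. p < x) w = map ((+) p) v" by simp
qed

lemma mperm_0: "w \<in> mperms_of m n \<Longrightarrow> 0 \<notin> set w"
  using mperms_ofD(3) by fastforce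

lemma shifted_shuffle_iff:
  assumes "\<alpha> \<in> mperms_of m p" "\<beta> \<in> mperms_of m q" "m \<ge> 1"
  shows "\<gamma> \<in> shifted_shuffle m \<alpha> \<beta> \<longleftrightarrow> wlow p \<gamma> = \<alpha> \<and> whigh p \<gamma> = \<beta>"
proof -
  have p: "length \<alpha> div m = p" using mperms_ofD(1)[OF assms(1)] assms(3) by simp
  have "shuffles \<alpha> (map ((+) p) \<beta>) =
      {w. filter (\<lambda>x. x \<le> p) w = \<alpha> \<and> filter (\<lambda>x. \<not> x \<le> p) w = map ((+) p) \<beta>}"
  proof (rule shuffles_eq_filter)
    show "\<forall>x\<in>set \<alpha>. x \<le> p" using mperms_ofD(3)[OF assms(1)] by auto
    show "\<forall>x\<in>set (map ((+) p) \<beta>). \<not> x \<le> p"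
      using mperm_0[OF assms(2)] by (auto intro: ccontr)
  qed
  then show ?thesis
    using map_plus_eq_iff[of p \<gamma> \<beta>] mperm_0[OF assms(2)]
    by (auto simp: shifted_shuffle_def p wlow_def not_le)
qed

lemma count_list_filter: "count_list (filter C w) a = (if C a then count_list w a else 0)"
  by (induction w) auto

lemma wlow_mperm: "\<gamma> \<in> mperms_of m (p + q) \<Longrightarrow> wlow p \<gamma> \<in> mperms_of m p"
  by (auto simp: mperms_of_def wlow_def count_list_filter)

lemma whigh_mperm:
  assumes "\<gamma> \<in> mperms_of m (p + q)"
  shows "whigh p \<gamma> \<in> mperms_of m q"
proof -
  have inj: "inj_on (\<lambda>x. x - p) {p<..}" by (auto simp: inj_on_def)
  have "count_list (whigh p \<gamma>) i = m" if "i \<in> {1..q}" for i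
    using count_list_map_inj_on[OF inj, of "filter (\<lambda>x. p < x) \<gamma>" "p + i"] that assms
    by (auto simp: whigh_def count_list_filter mperms_of_def)
  moreover have "set (whigh p \<gamma>) \<subseteq> {1..q}"
    using mperms_ofD(3)[OF assms] by (fastforce simp: whigh_def)
  ultimately show ?thesis by (simp add: mperms_of_def)
qed

lemma shifted_shuffle_mperm:
  assumes "\<alpha> \<in> mperms_of m p" "\<beta> \<in> mperms_of m q" "m \<ge> 1" "\<gamma> \<in> shifted_shuffle m \<alpha> \<beta>"
  shows "\<gamma> \<in> mperms_of m (p + q)"
proof -
  have low: "filter (\<lambda>x. x \<le> p) \<gamma> = \<alpha>" and high: "whigh p \<gamma> = \<beta>"
    using assms(4) shifted_shuffle_iff[OF assms(1-3)] by (auto simp: wlow_def)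
  have high': "filter (\<lambda>x. p < x) \<gamma> = map ((+) p) \<beta>"
    using high mperm_0[OF assms(2)] by (simp add: map_plus_eq_iff)
  have "set \<gamma> = set (filter (\<lambda>x. x \<le> p) \<gamma>) \<union> set (filter (\<lambda>x. p < x) \<gamma>)" by auto
  then have "set \<gamma> \<subseteq> {1..p + q}"
    using mperms_ofD(3)[OF assms(1)] mperms_ofD(3)[OF assms(2)] unfolding low high' by fastforce
  moreover have "count_list \<gamma> i = m" if i: "i \<in> {1..p + q}" for i
  proof (cases "i \<le> p")
    case True
    then have "count_list \<gamma> i = count_list \<alpha> i" by (simp add: low[symmetric] count_list_filter)
    then show ?thesis using mperms_ofD(2)[OF assms(1)] True i by simp
  next
    case False
    then have "count_list \<gamma> i = count_list (map ((+) p) \<beta>) (p + (i - p))"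
      by (simp add: high'[symmetric] count_list_filter)
    also have "\<dots> = count_list \<beta> (i - p)"
      by (rule count_list_map_inj_on[of _ UNIV]) auto
    finally show ?thesis using mperms_ofD(2)[OF assms(2), of "i - p"] False i by (simp add: Suc_le_eq)
  qed
  ultimately show ?thesis by (simp add: mperms_of_def)
qed

lemma wlow_wlow: "wlow p (wlow (p + q) w) = wlow p w"
  and whigh_wlow: "whigh p (wlow (p + q) w) = wlow q (whigh p w)"
  and whigh_whigh: "whigh q (whigh p w) = whigh (p + q) w"
  by (induction w) (auto simp: wlow_def whigh_def)

text \<open>Both sides sum over the words whose restrictions to three consecutive intervals of
  letters, shifted down, are \<alpha>, \<beta> and \<delta>. Such a word determines the intermediate
  one, so the unions are disjoint.\<close>

lemma fq_mult_assoc_F: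
  assumes "\<alpha> \<in> mperms m" "\<beta> \<in> mperms m" "\<delta> \<in> mperms m" "m \<ge> 1"
  shows "fq_mult m (fq_mult m (F \<alpha>) (F \<beta>)) (F \<delta>) = (fq_mult m (F \<alpha>) (fq_mult m (F \<beta>) (F \<delta>)) :: _ \<Rightarrow>\<^sub>0 'k::field)"
proof -
  obtain p q r where pqr: "\<alpha> \<in> mperms_of m p" "\<beta> \<in> mperms_of m q" "\<delta> \<in> mperms_of m r"
    using assms(1-3) by (auto simp: mperms_def)
  let ?sh = "shifted_shuffle m"
  have sh: "\<gamma> \<in> mperms_of m (p + q)" if "\<gamma> \<in> ?sh \<alpha> \<beta>" for \<gamma>
    using shifted_shuffle_mperm[OF pqr(1,2) assms(4) that] .
  have sh': "\<gamma> \<in> mperms_of m (q + r)" if "\<gamma> \<in> ?sh \<beta> \<delta>" for \<gamma>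
    using shifted_shuffle_mperm[OF pqr(2,3) assms(4) that] .
  note iff = shifted_shuffle_iff[OF pqr(1,2) assms(4)] shifted_shuffle_iff[OF pqr(2,3) assms(4)]
  have iff': "\<epsilon> \<in> ?sh \<gamma> \<delta> \<longleftrightarrow> wlow (p + q) \<epsilon> = \<gamma> \<and> whigh (p + q) \<epsilon> = \<delta>" if "\<gamma> \<in> ?sh \<alpha> \<beta>" for \<gamma> \<epsilon>
    using shifted_shuffle_iff[OF sh[OF that] pqr(3) assms(4)] .
  have iff'': "\<epsilon> \<in> ?sh \<alpha> \<gamma> \<longleftrightarrow> wlow p \<epsilon> = \<alpha> \<and> whigh p \<epsilon> = \<gamma>" if "\<gamma> \<in> ?sh \<beta> \<delta>" for \<gamma> \<epsilon>
    using shifted_shuffle_iff[OF pqr(1) sh'[OF that] assms(4)] .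
  have "fq_mult m (fq_mult m (F \<alpha>) (F \<beta>)) (F \<delta>) = (\<Sum>\<gamma>\<in>?sh \<alpha> \<beta>. \<Sum>\<epsilon>\<in>?sh \<gamma> \<delta>. F \<epsilon>)"
    by (simp add: fq_mult_F fq_mult_sum_left)
  also have "\<dots> = (\<Sum>\<epsilon>\<in>(\<Union>\<gamma>\<in>?sh \<alpha> \<beta>. ?sh \<gamma> \<delta>). F \<epsilon>)"
    by (subst sum.UNION_disjoint) (auto simp: iff')
  also have "(\<Union>\<gamma>\<in>?sh \<alpha> \<beta>. ?sh \<gamma> \<delta>) = (\<Union>\<gamma>\<in>?sh \<beta> \<delta>. ?sh \<alpha> \<gamma>)"
  proof (rule set_eqI)
    fix \<epsilon>
    have "\<epsilon> \<in> (\<Union>\<gamma>\<in>?sh \<alpha> \<beta>. ?sh \<gamma> \<delta>) \<longleftrightarrow> wlow (p + q) \<epsilon> \<in> ?sh \<alpha> \<beta> \<and> whigh (p + q) \<epsilon> = \<delta>"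
      by (auto simp: iff')
    moreover have "\<epsilon> \<in> (\<Union>\<gamma>\<in>?sh \<beta> \<delta>. ?sh \<alpha> \<gamma>) \<longleftrightarrow> wlow p \<epsilon> = \<alpha> \<and> whigh p \<epsilon> \<in> ?sh \<beta> \<delta>"
      by (auto simp: iff'')
    ultimately show "\<epsilon> \<in> (\<Union>\<gamma>\<in>?sh \<alpha> \<beta>. ?sh \<gamma> \<delta>) \<longleftrightarrow> \<epsilon> \<in> (\<Union>\<gamma>\<in>?sh \<beta> \<delta>. ?sh \<alpha> \<gamma>)"
      by (simp add: iff wlow_wlow whigh_wlow whigh_whigh)
  qed
  also have "(\<Sum>\<epsilon>\<in>(\<Union>\<gamma>\<in>?sh \<beta> \<delta>. ?sh \<alpha> \<gamma>). F \<epsilon>) = (\<Sum>\<gamma>\<in>?sh \<beta> \<delta>. \<Sum>\<epsilon>\<in>?sh \<alpha> \<gamma>. F \<epsilon> :: _ \<Rightarrow>\<^sub>0 'k)"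
    by (subst sum.UNION_disjoint) (auto simp: iff'')
  also have "\<dots> = fq_mult m (F \<alpha>) (fq_mult m (F \<beta>) (F \<delta>))"
    by (simp add: fq_mult_F fq_mult_sum_right)
  finally show ?thesis .
qed

lemma fqsym_eq: "fqsym m = {x. keys x \<subseteq> mperms m}"
  unfolding fqsym_def by (rule span_bas)

lemma fqsym_deg_eq: "fqsym_deg m n = {x. keys x \<subseteq> mperms_of m n}"
  unfolding fqsym_deg_def by (rule span_bas)

lemma fq_mult_assoc:
  assumes "x \<in> fqsym m" "y \<in> fqsym m" "z \<in> fqsym m" "m \<ge> 1"
  shows "fq_mult m (fq_mult m x y) z = fq_mult m x (fq_mult m y z)"
proof -
  note lins = linear_fq_mult_left linear_fq_mult_right
  have keys: "a \<in> mperms m" if "a \<in> keys x \<union> keys y \<union> keys z" for a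
    using that assms(1-3) by (auto simp: fqsym_eq)
  show ?thesis
  proof (rule linear_eq_on_keys[where x = x])
    fix \<alpha> assume \<alpha>: "\<alpha> \<in> keys x"
    show "fq_mult m (fq_mult m (F \<alpha>) y) z = fq_mult m (F \<alpha>) (fq_mult m y z)"
    proof (rule linear_eq_on_keys[where x = y])
      fix \<beta> assume \<beta>: "\<beta> \<in> keys y"
      show "fq_mult m (fq_mult m (F \<alpha>) (F \<beta>)) z = fq_mult m (F \<alpha>) (fq_mult m (F \<beta>) z)"
        by (rule linear_eq_on_keys[where x = z])
          (use \<alpha> \<beta> keys in \<open>auto intro!: fq_mult_assoc_F assms(4) lins linear_comp[OF linear_fq_mult_right linear_fq_mult_right]\<close>)
    qed (intro linear_comp[OF linear_fq_mult_right linear_fq_mult_left] linear_comp[OF linear_fq_mult_left linear_fq_mult_right])+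
  qed (intro linear_comp[OF linear_fq_mult_left linear_fq_mult_left] linear_fq_mult_left)+
qed

text \<open>Factorizations as pairs of words instead of cut positions, so that they can be reindexed
  by maps on words.\<close>

definition splits :: "nat \<Rightarrow> nat list \<Rightarrow> (nat list \<times> nat list) set"
  where "splits m w = {(u, v). u @ v = w \<and> mword m u \<and> mword m v}"

lemma splits_eq_image:
  "splits m w = (\<lambda>k. (take k w, drop k w)) ` {k. k \<le> length w \<and> mword m (take k w) \<and> mword m (drop k w)}"
proof (intro equalityI subsetI)
  fix x assume "x \<in> splits m w"
  then obtain u v where x: "x = (u, v)" "u @ v = w" "mword m u" "mword m v" by (auto simp: splits_def)
  then have "take (length u) w = u" "drop (length u) w = v" "length u \<le> length w" by auto
  then show "x \<in> (\<lambda>k. (take k w, drop k w)) ` {k. k \<le> length w \<and> mword m (take k w) \<and> mword m (drop k w)}"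
    using x by (intro image_eqI[of _ _ "length u"]) auto
qed (auto simp: splits_def)

lemma finite_splits [simp]: "finite (splits m w)"
  unfolding splits_eq_image by simp

lemma fq_comult_F: "fq_comult m (F \<alpha>) = (\<Sum>(u, v)\<in>splits m \<alpha>. bas (mstd m u, mstd m v))"
proof -
  have "inj_on (\<lambda>k. (take k \<alpha>, drop k \<alpha>)) {k. k \<le> length \<alpha> \<and> mword m (take k \<alpha>) \<and> mword m (drop k \<alpha>)}"
    by (rule inj_onI) (metis (mono_tags, lifting) Pair_inject length_take mem_Collect_eq min.absorb2)
  then show ?thesis
    by (simp add: fq_comult_def splits_eq_image sum.reindex)
qed

lemma mword_append: "mword m u \<Longrightarrow> mword m v \<Longrightarrow> mword m (u @ v)"
  by (simp add: mword_def)

text \<open>Either side runs over the factorizations of \<open>w\<close> into three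
  \<open>m\<close>-words.\<close>

lemma sum_splits_assoc:
  "(\<Sum>(u, c)\<in>splits m w. \<Sum>(a, b)\<in>splits m u. h a b c) =
    (\<Sum>(a, v)\<in>splits m w. \<Sum>(b, c)\<in>splits m v. h a b c)"
proof -
  have "(\<Sum>(u, c)\<in>splits m w. \<Sum>(a, b)\<in>splits m u. h a b c) =
    (\<Sum>(p, s)\<in>Sigma (splits m w) (\<lambda>p. splits m (fst p)). h (fst s) (snd s) (snd p))"
    unfolding case_prod_beta by (subst sum.Sigma) (auto simp: case_prod_beta)
  also have "\<dots> = (\<Sum>(p, s)\<in>Sigma (splits m w) (\<lambda>p. splits m (snd p)). h (fst p) (fst s) (snd s))"
    by (rule sum.reindex_bij_witness[where
        i = "\<lambda>(p, s). ((fst p @ fst s, snd s), (fst p, fst s))" and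
        j = "\<lambda>(p, s). ((fst s, snd s @ snd p), (snd s, snd p))"])
      (auto simp: splits_def mword_append)
  also have "\<dots> = (\<Sum>(a, v)\<in>splits m w. \<Sum>(b, c)\<in>splits m v. h a b c)"
    unfolding case_prod_beta by (subst sum.Sigma) (auto simp: case_prod_beta)
  finally show ?thesis .
qed

text \<open>Relabelling by rank matches the factorizations of \<open>w\<close> with those of its
  standardization, and standardizing a factor forgets the relabelling. Standardization can thus be
  postponed to the end of a computation.\<close>

lemma sum_splits_mstd:
  assumes "uniform m w" "m \<ge> 1"
  shows "(\<Sum>(u, v)\<in>splits m (mstd m w). h (mstd m u) (mstd m v)) =
    (\<Sum>(u, v)\<in>splits m w. h (mstd m u) (mstd m v))"
proof -
  let ?f = "rk (set w)"
  have mono: "strict_mono_on (set w) ?f" by (simp add: strict_mono_on_rk)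
  then have inj: "inj_on ?f (set w)" by (rule strict_mono_on_imp_inj_on)
  have sub: "strict_mono_on A ?f" "inj_on ?f A" if "A \<subseteq> set w" for A
    using that mono inj by (blast intro: monotone_on_subset inj_on_subset)+
  have eq: "splits m (mstd m w) = (\<lambda>(u, v). (map ?f u, map ?f v)) ` splits m w"
  proof (intro equalityI subsetI)
    fix x assume "x \<in> splits m (mstd m w)"
    then obtain u v where x: "x = (u, v)" "u @ v = map ?f w" "mword m u" "mword m v"
      by (auto simp: splits_def mstd_eq_map_rk[OF assms])
    obtain u' v' where w: "w = u' @ v'" "u = map ?f u'" "v = map ?f v'"
      using x(2) by (metis append_eq_map_conv)
    then show "x \<in> (\<lambda>(u, v). (map ?f u, map ?f v)) ` splits m w"
      using x sub by (intro image_eqI[of _ _ "(u', v')"]) (auto simp: splits_def mword_map_inj_on)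
  next
    fix x assume "x \<in> (\<lambda>(u, v). (map ?f u, map ?f v)) ` splits m w"
    then obtain u v where x: "x = (map ?f u, map ?f v)" "u @ v = w" "mword m u" "mword m v"
      by (auto simp: splits_def)
    have "set u \<subseteq> set w" "set v \<subseteq> set w" using x(2) by auto
    then have "mword m (map ?f u)" "mword m (map ?f v)"
      using x(3,4) sub(2) mword_map_inj_on by blast+
    then show "x \<in> splits m (mstd m w)"
      using x(1) unfolding mstd_eq_map_rk[OF assms] by (auto simp: splits_def x(2)[symmetric])
  qed
  have "inj_on (\<lambda>(u, v). (map ?f u, map ?f v)) (splits m w)"
  proof (rule inj_onI, clarify)
    fix u v u' v' assume "(u, v) \<in> splits m w" "(u', v') \<in> splits m w" "map ?f u = map ?f u'" "map ?f v = map ?f v'"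
    then have "length u = length u'" "u @ v = u' @ v'"
      by (auto simp: splits_def dest: map_eq_imp_length_eq)
    then show "u = u' \<and> v = v'" by simp
  qed
  then have "(\<Sum>(u, v)\<in>splits m (mstd m w). h (mstd m u) (mstd m v)) =
      (\<Sum>(u, v)\<in>splits m w. h (mstd m (map ?f u)) (mstd m (map ?f v)))"
    unfolding eq by (subst sum.reindex) (auto simp: case_prod_beta intro!: sum.cong)
  also have "\<dots> = (\<Sum>(u, v)\<in>splits m w. h (mstd m u) (mstd m v))"
  proof (intro sum.cong refl, clarify)
    fix u v assume "(u, v) \<in> splits m w"
    then have uv: "u @ v = w" "mword m u" by (auto simp: splits_def)
    then have "mstd m (map ?f u) = mstd m u" "mstd m (map ?f v) = mstd m v"
      using uniform_appendD[of m u v] assms sub by (auto intro!: mstd_map_strict_mono)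
    then show "h (mstd m (map ?f u)) (mstd m (map ?f v)) = h (mstd m u) (mstd m v)" by simp
  qed
  finally show ?thesis .
qed

lemma splits_uniform:
  assumes "(u, v) \<in> splits m w" "uniform m w"
  shows "uniform m u" "uniform m v" "set u \<inter> set v = {}" "w = u @ v"
  using assms uniform_appendD[of m u v] by (auto simp: splits_def)

lemma fq_comult_mstd:
  assumes "uniform m w" "m \<ge> 1"
  shows "fq_comult m (F (mstd m w)) = (\<Sum>(u, v)\<in>splits m w. bas (mstd m u, mstd m v))"
  unfolding fq_comult_F by (rule sum_splits_mstd[OF assms])

lemma fq_coassoc_F:
  assumes "\<alpha> \<in> mperms m" "m \<ge> 1"
  shows "tens_assoc (tens_map (fq_comult m) id (fq_comult m (F \<alpha>))) =
    tens_map id (fq_comult m) (fq_comult m (F \<alpha>))"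
proof -
  have un: "uniform m \<alpha>" using assms uniform_mperm by (auto simp: mperms_def)
  have "tens_assoc (tens_map (fq_comult m) id (fq_comult m (F \<alpha>))) =
      (\<Sum>(u, v)\<in>splits m \<alpha>. tens_assoc (tens (fq_comult m (F (mstd m u))) (F (mstd m v))))"
    by (simp add: fq_comult_F[of m \<alpha>] tens_map_def tens_assoc_def lin_ext_sum case_prod_beta)
  also have "\<dots> = (\<Sum>(u, v)\<in>splits m \<alpha>. \<Sum>(a, b)\<in>splits m u. bas (mstd m a, mstd m b, mstd m v))"
  proof (intro sum.cong refl, clarify)
    fix u v assume "(u, v) \<in> splits m \<alpha>"
    then have "uniform m u" using splits_uniform un by blast
    then show "tens_assoc (tens (fq_comult m (F (mstd m u))) (F (mstd m v))) =
        (\<Sum>(a, b)\<in>splits m u. bas (mstd m a, mstd m b, mstd m v))"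
      using assms(2)
      by (simp add: fq_comult_mstd tens_sum_left tens_assoc_def lin_ext_sum case_prod_beta)
  qed
  also have "\<dots> = (\<Sum>(a, v)\<in>splits m \<alpha>. \<Sum>(b, c)\<in>splits m v. bas (mstd m a, mstd m b, mstd m c))"
    by (rule sum_splits_assoc)
  also have "\<dots> = (\<Sum>(u, v)\<in>splits m \<alpha>. tens (F (mstd m u)) (fq_comult m (F (mstd m v))))"
  proof (intro sum.cong refl, clarify)
    fix u v assume "(u, v) \<in> splits m \<alpha>"
    then have "uniform m v" using splits_uniform un by blast
    then show "(\<Sum>(b, c)\<in>splits m v. bas (mstd m u, mstd m b, mstd m c)) =
        tens (F (mstd m u)) (fq_comult m (F (mstd m v)))"
      using assms(2) by (simp add: fq_comult_mstd tens_sum_right case_prod_beta)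
  qed
  also have "\<dots> = tens_map id (fq_comult m) (fq_comult m (F \<alpha>))"
    by (simp add: fq_comult_F[of m \<alpha>] tens_map_def lin_ext_sum case_prod_beta)
  finally show ?thesis .
qed

section \<open>Compatibility of product and coproduct\<close>

lemma uniform_append:
  assumes "uniform m u" "uniform m v" "set u \<inter> set v = {}"
  shows "uniform m (u @ v)"
  using assms by (auto simp: uniform_def count_list_0_iff)

lemma uniform_mset_cong: "mset u = mset v \<Longrightarrow> uniform m u \<Longrightarrow> uniform m v"
  unfolding uniform_def by (metis mset_eq_count_list mset_eq_setD)

lemma mset_shuffles: "w \<in> shuffles u v \<Longrightarrow> mset w = mset u + mset v"
  by (induction u v arbitrary: w rule: shuffles.induct) auto

lemma rk_Un_below:
  assumes "finite A" "finite B" "\<And>a b. a \<in> A \<Longrightarrow> b \<in> B \<Longrightarrow> a < b"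
  shows "a \<in> A \<Longrightarrow> rk (A \<union> B) a = rk A a" "b \<in> B \<Longrightarrow> rk (A \<union> B) b = card A + rk B b"
proof -
  assume "a \<in> A"
  then have "{x \<in> A \<union> B. x \<le> a} = {x \<in> A. x \<le> a}" using assms(3) by fastforce
  then show "rk (A \<union> B) a = rk A a" by (simp add: rk_def)
next
  assume "b \<in> B"
  then have "{x \<in> A \<union> B. x \<le> b} = A \<union> {x \<in> B. x \<le> b}" using assms(3) by fastforce
  moreover have "A \<inter> {x \<in> B. x \<le> b} = {}" using assms(3) by fastforce
  ultimately show "rk (A \<union> B) b = card A + rk B b"
    using assms by (simp add: rk_def card_Un_disjoint)
qed

text \<open>All letters of \<open>c\<close> exceed those of \<open>a\<close>. Ranks in the joint
  alphabet are therefore ranks in \<open>a\<close>, or ranks in \<open>c\<close> shifted by the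
  number of letters of \<open>a\<close>, which is the shift in
  \<open>shifted_shuffle\<close>.\<close>

lemma sum_shifted_shuffle_mstd:
  assumes "uniform m a" "uniform m c" "m \<ge> 1" "\<And>x y. x \<in> set a \<Longrightarrow> y \<in> set c \<Longrightarrow> x < y"
  shows "(\<Sum>\<gamma>\<in>shifted_shuffle m (mstd m a) (mstd m c). g \<gamma>) = (\<Sum>u\<in>shuffles a c. g (mstd m u))"
proof -
  let ?f = "rk (set a \<union> set c)"
  have disj: "set a \<inter> set c = {}" using assms(4) by fastforce
  have f: "strict_mono_on (set a \<union> set c) ?f" by (simp add: strict_mono_on_rk)
  then have inj: "inj_on ?f (set a \<union> set c)" by (rule strict_mono_on_imp_inj_on)
  have un: "uniform m u" "set u = set a \<union> set c" if "u \<in> shuffles a c" for u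
  proof -
    have "mset (a @ c) = mset u" using mset_shuffles[OF that] by simp
    then show "uniform m u" using uniform_mset_cong uniform_append[OF assms(1,2) disj] by blast
    show "set u = set a \<union> set c" by (rule set_shuffles[OF that])
  qed
  have fa: "map ?f a = mstd m a"
    using assms rk_Un_below(1)[of "set a" "set c"] by (auto simp: mstd_eq_map_rk)
  have "length a div m = card (set a)"
    using uniform_length[OF assms(1)] assms(3) by simp
  then have fc: "map ?f c = map ((+) (length (mstd m a) div m)) (mstd m c)"
    using assms rk_Un_below(2)[of "set a" "set c"] by (auto simp: mstd_eq_map_rk)
  have "shifted_shuffle m (mstd m a) (mstd m c) = map ?f ` shuffles a c"
    unfolding shifted_shuffle_def fc[symmetric] by (simp only: fa[symmetric] shuffles_map)
  moreover have "inj_on (map ?f) (shuffles a c)"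
  proof (rule inj_onI)
    fix u v assume "u \<in> shuffles a c" "v \<in> shuffles a c" "map ?f u = map ?f v"
    then show "u = v" using un inj by (intro map_inj_on[of ?f u v]) auto
  qed
  ultimately have "(\<Sum>\<gamma>\<in>shifted_shuffle m (mstd m a) (mstd m c). g \<gamma>) = (\<Sum>u\<in>shuffles a c. g (map ?f u))"
    by (simp add: sum.reindex)
  also have "\<dots> = (\<Sum>u\<in>shuffles a c. g (mstd m u))"
    using un assms(3) by (intro sum.cong refl) (simp add: mstd_eq_map_rk)
  finally show ?thesis .
qed

text \<open>A cut of a shuffle cuts both words, and its halves are shuffles of the corresponding
  factors. The predicate \<open>C\<close> tells the letters of \<open>u\<close> from those of
  \<open>v\<close> and so makes this a bijection; a word is an \<open>m\<close>-word iff both its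
  restrictions are.\<close>

lemma sum_splits_shuffles:
  assumes "\<And>x. x \<in> set u \<Longrightarrow> C x" "\<And>x. x \<in> set v \<Longrightarrow> \<not> C x"
  shows "(\<Sum>w\<in>shuffles u v. \<Sum>(x, y)\<in>splits m w. h x y) =
    (\<Sum>(a, a')\<in>splits m u. \<Sum>(b, b')\<in>splits m v. \<Sum>x\<in>shuffles a b. \<Sum>y\<in>shuffles a' b'. h x y)"
proof -
  let ?D = "\<lambda>x. \<not> C x"
  have sh: "w \<in> shuffles a b \<longleftrightarrow> filter C w = a \<and> filter ?D w = b" if "set a \<subseteq> set u" "set b \<subseteq> set v" for w a b
    using shuffles_eq_filter[of a C b] that assms by blast
  have mw: "mword m w \<longleftrightarrow> mword m (filter C w) \<and> mword m (filter ?D w)" for w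
    by (auto simp: mword_def count_list_filter)
  have "(\<Sum>w\<in>shuffles u v. \<Sum>(x, y)\<in>splits m w. h x y) =
      (\<Sum>(w, s)\<in>Sigma (shuffles u v) (splits m). h (fst s) (snd s))"
    unfolding case_prod_beta by (subst sum.Sigma) (auto simp: case_prod_beta)
  also have "\<dots> = (\<Sum>(s, t, x, y)\<in>Sigma (splits m u) (\<lambda>s. Sigma (splits m v) (\<lambda>t.
      shuffles (fst s) (fst t) \<times> shuffles (snd s) (snd t))). h x y)"
  proof (rule sum.reindex_bij_witness[where
        j = "\<lambda>(w, x, y). ((filter C x, filter C y), (filter ?D x, filter ?D y), x, y)" and
        i = "\<lambda>(s, t, x, y). (x @ y, x, y)"], goal_cases)
    case (1 a)
    then obtain w x y where a: "a = (w, x, y)" "w \<in> shuffles u v" "(x, y) \<in> splits m w" by auto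
    then show ?case by (auto simp: splits_def)
  next
    case (2 a)
    then obtain w x y where a: "a = (w, x, y)" "w \<in> shuffles u v" "(x, y) \<in> splits m w" by auto
    have w: "x @ y = w" "mword m x" "mword m y" "filter C w = u" "filter ?D w = v"
      using a sh[of u v] by (auto simp: splits_def)
    have uv: "filter C x @ filter C y = u" "filter ?D x @ filter ?D y = v"
      using w by auto
    have "x \<in> shuffles (filter C x) (filter ?D x)" "y \<in> shuffles (filter C y) (filter ?D y)"
      using partition_in_shuffles by auto
    then show ?case using a w uv by (simp add: splits_def mw[of x] mw[of y])
  next
    case (3 b)
    then obtain a a' b0 b' x y where b: "b = ((a, a'), (b0, b'), x, y)" "(a, a') \<in> splits m u"
      "(b0, b') \<in> splits m v" "x \<in> shuffles a b0" "y \<in> shuffles a' b'" by auto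
    have "set a \<subseteq> set u" "set a' \<subseteq> set u" "set b0 \<subseteq> set v" "set b' \<subseteq> set v"
      using b by (auto simp: splits_def)
    then show ?case using b sh by auto
  next
    case (4 b)
    then obtain a a' b0 b' x y where b: "b = ((a, a'), (b0, b'), x, y)" "(a, a') \<in> splits m u"
      "(b0, b') \<in> splits m v" "x \<in> shuffles a b0" "y \<in> shuffles a' b'" by auto
    have "set a \<subseteq> set u" "set a' \<subseteq> set u" "set b0 \<subseteq> set v" "set b' \<subseteq> set v"
      using b by (auto simp: splits_def)
    then have f: "filter C x = a" "filter ?D x = b0" "filter C y = a'" "filter ?D y = b'"
      using b sh by auto
    have "x @ y \<in> shuffles u v"
      using b f by (auto simp: sh splits_def)
    moreover have "mword m x" "mword m y"
      using b f by (auto simp: mw[of x] mw[of y] splits_def)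
    ultimately show ?case using b by (simp add: splits_def)
  qed auto
  also have "\<dots> = (\<Sum>(a, a')\<in>splits m u. \<Sum>(b, b')\<in>splits m v. \<Sum>x\<in>shuffles a b. \<Sum>y\<in>shuffles a' b'. h x y)"
    by (simp add: sum.Sigma[symmetric]) (simp add: case_prod_beta)
  finally show ?thesis .
qed

lemma sum_splits_map_shift:
  "(\<Sum>(u, v)\<in>splits m (map ((+) p) w). h u v) = (\<Sum>(u, v)\<in>splits m w. h (map ((+) (p :: nat)) u) (map ((+) p) v))"
proof -
  have inj: "inj_on ((+) p) A" for A :: "nat set" by (simp add: inj_on_def)
  have "splits m (map ((+) p) w) = (\<lambda>(u, v). (map ((+) p) u, map ((+) p) v)) ` splits m w"
  proof (intro equalityI subsetI)
    fix x assume "x \<in> splits m (map ((+) p) w)"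
    then obtain u v where x: "x = (u, v)" "u @ v = map ((+) p) w" "mword m u" "mword m v"
      by (auto simp: splits_def)
    obtain u' v' where w: "w = u' @ v'" "u = map ((+) p) u'" "v = map ((+) p) v'"
      using x(2) by (metis append_eq_map_conv)
    then show "x \<in> (\<lambda>(u, v). (map ((+) p) u, map ((+) p) v)) ` splits m w"
      using x by (intro image_eqI[of _ _ "(u', v')"]) (auto simp: splits_def mword_map_inj_on[OF inj])
  qed (auto simp: splits_def mword_map_inj_on[OF inj])
  moreover have "inj_on (\<lambda>(u, v). (map ((+) p) u, map ((+) p) v)) (splits m w)"
    by (rule inj_onI) (auto simp: inj_map_eq_map[OF inj])
  ultimately show ?thesis
    by (simp only: sum.reindex) (auto simp: case_prod_beta intro!: sum.cong)
qed

lemma fq_comult_mult_F: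
  assumes "\<alpha> \<in> mperms m" "\<beta> \<in> mperms m" "m \<ge> 1"
  shows "fq_comult m (fq_mult m (F \<alpha>) (F \<beta>)) =
    tens_mult (fq_mult m) (fq_comult m (F \<alpha>)) (fq_comult m (F \<beta>))"
proof -
  obtain p q where pq: "\<alpha> \<in> mperms_of m p" "\<beta> \<in> mperms_of m q"
    using assms(1,2) by (auto simp: mperms_def)
  have len: "length \<alpha> div m = p" using mperms_ofD(1)[OF pq(1)] assms(3) by simp
  let ?sh = "map ((+) p)"
  let ?g = "\<lambda>x y. bas (mstd m x, mstd m y)"
  have un: "uniform m \<alpha>" "uniform m \<beta>" using pq uniform_mperm by auto
  have lt: "x < y" if "x \<in> set \<alpha>" "y \<in> set (?sh \<beta>)" for x y
    using that mperms_ofD(3)[OF pq(1)] mperms_ofD(3)[OF pq(2)] by fastforce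
  have "fq_comult m (fq_mult m (F \<alpha>) (F \<beta>)) =
      (\<Sum>w\<in>shuffles \<alpha> (?sh \<beta>). \<Sum>(x, y)\<in>splits m w. ?g x y)"
    by (simp add: fq_mult_F linear_sumD[OF linear_fq_comult] fq_comult_F shifted_shuffle_def len)
  also have "\<dots> = (\<Sum>(a, a')\<in>splits m \<alpha>. \<Sum>(b, b')\<in>splits m (?sh \<beta>).
      \<Sum>x\<in>shuffles a b. \<Sum>y\<in>shuffles a' b'. ?g x y)"
    by (rule sum_splits_shuffles[where C = "\<lambda>x. x \<le> p"])
      (use mperms_ofD(3)[OF pq(1)] mperms_ofD(3)[OF pq(2)] in fastforce)+
  also have "\<dots> = (\<Sum>(a, a')\<in>splits m \<alpha>. \<Sum>(b, b')\<in>splits m \<beta>.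
      \<Sum>x\<in>shuffles a (?sh b). \<Sum>y\<in>shuffles a' (?sh b'). ?g x y)"
    by (simp add: sum_splits_map_shift)
  also have "\<dots> = (\<Sum>(a, a')\<in>splits m \<alpha>. \<Sum>(b, b')\<in>splits m \<beta>.
      tens (fq_mult m (F (mstd m a)) (F (mstd m b))) (fq_mult m (F (mstd m a')) (F (mstd m b'))))"
  proof (intro sum.cong refl, clarify, intro sum.cong refl, clarify)
    fix a a' b b' assume ab: "(a, a') \<in> splits m \<alpha>" "(b, b') \<in> splits m \<beta>"
    have un': "uniform m a" "uniform m a'" "uniform m b" "uniform m b'"
      using splits_uniform ab un by blast+
    have mono: "strict_mono_on A ((+) p)" for A by (simp add: strict_mono_on_def)
    have un'': "uniform m (?sh b)" "uniform m (?sh b')"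
      using un' by (auto intro!: uniform_map)
    have sub: "set a \<subseteq> set \<alpha>" "set a' \<subseteq> set \<alpha>" "set b \<subseteq> set \<beta>" "set b' \<subseteq> set \<beta>"
      using ab by (auto simp: splits_def)
    have lt': "x < y" if "x \<in> set a \<union> set a'" "y \<in> set (?sh b) \<union> set (?sh b')" for x y
      using that sub by (intro lt) auto
    have std: "mstd m (?sh b) = mstd m b" "mstd m (?sh b') = mstd m b'"
      using un' assms(3) mono by (auto intro!: mstd_map_strict_mono)
    have "(\<Sum>x\<in>shuffles a (?sh b). \<Sum>y\<in>shuffles a' (?sh b'). ?g x y) =
      tens (\<Sum>x\<in>shuffles a (?sh b). F (mstd m x)) (\<Sum>y\<in>shuffles a' (?sh b'). F (mstd m y))"
      by (simp only: tens_sum_left) (simp add: tens_sum_right)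
    also have "(\<Sum>x\<in>shuffles a (?sh b). F (mstd m x)) = fq_mult m (F (mstd m a)) (F (mstd m b))"
      unfolding fq_mult_F std(1)[symmetric]
      by (rule sum_shifted_shuffle_mstd[symmetric]) (use un' un'' assms(3) lt' in blast)+
    also have "(\<Sum>y\<in>shuffles a' (?sh b'). F (mstd m y)) = fq_mult m (F (mstd m a')) (F (mstd m b'))"
      unfolding fq_mult_F std(2)[symmetric]
      by (rule sum_shifted_shuffle_mstd[symmetric]) (use un' un'' assms(3) lt' in blast)+
    finally show "(\<Sum>x\<in>shuffles a (?sh b). \<Sum>y\<in>shuffles a' (?sh b'). ?g x y) =
        tens (fq_mult m (F (mstd m a)) (F (mstd m b))) (fq_mult m (F (mstd m a')) (F (mstd m b')))" .
  qed
  also have "\<dots> = tens_mult (fq_mult m) (fq_comult m (F \<alpha>)) (fq_comult m (F \<beta>))"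
    by (simp add: tens_mult_def fq_comult_F lin_ext_sum case_prod_beta)
  finally show ?thesis .
qed

lemma linear_tens_mult_left: "Vector_Spaces.linear scl scl (\<lambda>z. tens_mult mul z w)"
  unfolding tens_mult_def by (rule linear_lin_ext)

lemma linear_tens_mult_right: "Vector_Spaces.linear scl scl (tens_mult mul z)"
  unfolding tens_mult_def case_prod_beta by (rule linear_lin_ext_fun[OF linear_lin_ext])

lemma fq_comult_mult:
  assumes "x \<in> fqsym m" "y \<in> fqsym m" "m \<ge> 1"
  shows "fq_comult m (fq_mult m x y) = tens_mult (fq_mult m) (fq_comult m x) (fq_comult m y)"
proof (rule linear_eq_on_keys[where x = x])
  fix \<alpha> assume \<alpha>: "\<alpha> \<in> keys x"
  show "fq_comult m (fq_mult m (F \<alpha>) y) = tens_mult (fq_mult m) (fq_comult m (F \<alpha>)) (fq_comult m y)"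
  proof (rule linear_eq_on_keys[where x = y])
    fix \<beta> assume "\<beta> \<in> keys y"
    then show "fq_comult m (fq_mult m (F \<alpha>) (F \<beta>)) =
        tens_mult (fq_mult m) (fq_comult m (F \<alpha>)) (fq_comult m (F \<beta>))"
      using \<alpha> assms by (intro fq_comult_mult_F) (auto simp: fqsym_eq)
  qed (intro linear_comp[OF linear_fq_mult_right linear_fq_comult]
      linear_comp[OF linear_fq_comult linear_tens_mult_right])+
qed (intro linear_comp[OF linear_fq_mult_left linear_fq_comult]
    linear_comp[OF linear_fq_comult linear_tens_mult_left])+

lemma fq_coassoc:
  assumes "x \<in> fqsym m" "m \<ge> 1"
  shows "tens_assoc (tens_map (fq_comult m) id (fq_comult m x)) = tens_map id (fq_comult m) (fq_comult m x)"
proof (rule linear_eq_on_keys[where x = x])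
  show "tens_assoc (tens_map (fq_comult m) id (fq_comult m (F \<alpha>))) = tens_map id (fq_comult m) (fq_comult m (F \<alpha>))"
    if "\<alpha> \<in> keys x" for \<alpha>
    using that assms by (intro fq_coassoc_F) (auto simp: fqsym_eq)
  have lin: "Vector_Spaces.linear scl scl (tens_map f g)" for f :: "('c \<Rightarrow>\<^sub>0 'k::field) \<Rightarrow> ('d \<Rightarrow>\<^sub>0 'k)" and g :: "('e \<Rightarrow>\<^sub>0 'k) \<Rightarrow> ('f \<Rightarrow>\<^sub>0 'k)"
    unfolding tens_map_def by (rule linear_lin_ext)
  show "Vector_Spaces.linear scl scl (\<lambda>x. tens_map id (fq_comult m) (fq_comult m x))"
    by (rule linear_comp[OF linear_fq_comult lin])
  show "Vector_Spaces.linear scl scl (\<lambda>x. tens_assoc (tens_map (fq_comult m) id (fq_comult m x)))"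
    unfolding tens_assoc_def by (intro linear_comp[OF _ linear_lin_ext] linear_comp[OF linear_fq_comult lin])
qed

lemma Nil_splits: "mword m w \<Longrightarrow> ([], w) \<in> splits m w" "mword m w \<Longrightarrow> (w, []) \<in> splits m w"
  by (auto simp: splits_def mword_def)

lemma mstd_eq_Nil [simp]: "mstd m w = [] \<longleftrightarrow> w = []"
  by (metis length_0_conv length_mstd)

text \<open>For the counit axioms: the counit kills non-empty words, so only a trivial factorization
  contributes.\<close>

lemma sum_splits_single:
  fixes g :: "_ \<Rightarrow> 'b::comm_monoid_add"
  assumes "mword m w"
  shows "(\<Sum>(u, v)\<in>splits m w. if u = [] then g v else 0) = g w"
    "(\<Sum>(u, v)\<in>splits m w. if v = [] then g u else 0) = g w"
proof -
  have "(\<Sum>(u, v)\<in>splits m w. if u = [] then g v else 0) =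
      (\<Sum>(u, v)\<in>{([] :: nat list, w)}. if u = [] then g v else 0)"
  proof (rule sum.mono_neutral_right[OF finite_splits])
    show "{([], w)} \<subseteq> splits m w" using Nil_splits(1)[OF assms] by simp
    show "\<forall>i\<in>splits m w - {([], w)}. (case i of (u, v) \<Rightarrow> if u = [] then g v else 0) = 0"
      by (auto simp: splits_def split: if_splits)
  qed
  then show "(\<Sum>(u, v)\<in>splits m w. if u = [] then g v else 0) = g w" by simp
  have "(\<Sum>(u, v)\<in>splits m w. if v = [] then g u else 0) =
      (\<Sum>(u, v)\<in>{(w, [] :: nat list)}. if v = [] then g u else 0)"
  proof (rule sum.mono_neutral_right[OF finite_splits])
    show "{(w, [])} \<subseteq> splits m w" using Nil_splits(2)[OF assms] by simp
    show "\<forall>i\<in>splits m w - {(w, [])}. (case i of (u, v) \<Rightarrow> if v = [] then g u else 0) = 0"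
      by (auto simp: splits_def split: if_splits)
  qed
  then show "(\<Sum>(u, v)\<in>splits m w. if v = [] then g u else 0) = g w" by simp
qed

lemma fq_counit_F: "fq_counit (F w) = (if w = [] then 1 else 0)"
  by (simp add: fq_counit_def lookup_single when_def)

lemma fq_counit_left:
  assumes "x \<in> fqsym m" "m \<ge> 1"
  shows "lin_ext (\<lambda>(a, b). scl (fq_counit (bas a)) (bas b)) (fq_comult m x) = x"
proof (rule linear_eq_on_keys[where x = x and L' = "\<lambda>x. x"])
  fix \<alpha> assume "\<alpha> \<in> keys x"
  then obtain n where \<alpha>: "\<alpha> \<in> mperms_of m n" using assms by (auto simp: fqsym_eq mperms_def)
  have "lin_ext (\<lambda>(a, b). scl (fq_counit (bas a)) (bas b)) (fq_comult m (F \<alpha>)) =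
      (\<Sum>(u, v)\<in>splits m \<alpha>. if u = [] then F (mstd m v) else 0)"
    unfolding fq_comult_F lin_ext_sum by (intro sum.cong refl) (auto simp: fq_counit_F)
  also have "\<dots> = F (mstd m \<alpha>)"
    by (rule sum_splits_single(1)[OF uniform_mword[OF uniform_mperm[OF \<alpha>]]])
  finally show "lin_ext (\<lambda>(a, b). scl (fq_counit (bas a)) (bas b)) (fq_comult m (F \<alpha>)) = F \<alpha>"
    by (simp add: mstd_mperm[OF \<alpha> assms(2)])
qed (auto intro!: linear_comp[OF linear_fq_comult linear_lin_ext] linear_sclI)

lemma fq_counit_right:
  assumes "x \<in> fqsym m" "m \<ge> 1"
  shows "lin_ext (\<lambda>(a, b). scl (fq_counit (bas b)) (bas a)) (fq_comult m x) = x"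
proof (rule linear_eq_on_keys[where x = x and L' = "\<lambda>x. x"])
  fix \<alpha> assume "\<alpha> \<in> keys x"
  then obtain n where \<alpha>: "\<alpha> \<in> mperms_of m n" using assms by (auto simp: fqsym_eq mperms_def)
  have "lin_ext (\<lambda>(a, b). scl (fq_counit (bas b)) (bas a)) (fq_comult m (F \<alpha>)) =
      (\<Sum>(u, v)\<in>splits m \<alpha>. if v = [] then F (mstd m u) else 0)"
    unfolding fq_comult_F lin_ext_sum by (intro sum.cong refl) (auto simp: fq_counit_F)
  also have "\<dots> = F (mstd m \<alpha>)"
    by (rule sum_splits_single(2)[OF uniform_mword[OF uniform_mperm[OF \<alpha>]]])
  finally show "lin_ext (\<lambda>(a, b). scl (fq_counit (bas b)) (bas a)) (fq_comult m (F \<alpha>)) = F \<alpha>"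
    by (simp add: mstd_mperm[OF \<alpha> assms(2)])
qed (auto intro!: linear_comp[OF linear_fq_comult linear_lin_ext] linear_sclI)

lemma fq_comult_one: "fq_comult m (F []) = tens (F []) (F [])"
proof -
  have "splits m [] = {([], [])}" by (auto simp: splits_def mword_def)
  then show ?thesis by (simp add: fq_comult_F mstd_def)
qed

lemma fq_counit_mult: "fq_counit (fq_mult m x y) = fq_counit x * fq_counit y"
proof -
  have "lookup (fq_mult m (F \<alpha>) (F \<beta>)) [] = (if \<alpha> = [] then if \<beta> = [] then 1 else 0 else (0 :: 'a))" for \<alpha> \<beta>
    by (simp add: fq_mult_F lookup_sum_bas) (simp add: shifted_shuffle_def)
  then have *: "lookup (fq_mult m (F \<alpha>) y) [] = (if \<alpha> = [] then lookup y [] else 0)" for \<alpha>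
    by (subst linear_expand[OF linear_fq_mult_right])
      (simp add: lookup_lin_ext sum_keys_delta)
  show ?thesis
    unfolding fq_counit_def
    by (subst linear_expand[OF linear_fq_mult_left]) (simp add: lookup_lin_ext * sum_keys_delta)
qed

section \<open>The antipode\<close>

text \<open>
  The convolution inverse of the identity is computed by recursion on the length from the left
  and from the right; both inverses agree.
\<close>

function antiL :: "nat \<Rightarrow> nat list \<Rightarrow> (nat list \<Rightarrow>\<^sub>0 'k::field)"
  where "antiL m w = (if w = [] then F [] else
    - (\<Sum>s\<in>{s \<in> splits m w. snd s \<noteq> []}. fq_mult m (antiL m (mstd m (fst s))) (F (mstd m (snd s)))))"
  by pat_completeness auto
termination
  by (relation "measure (\<lambda>(m, w). length w)") (auto simp: splits_def)

function antiR :: "nat \<Rightarrow> nat list \<Rightarrow> (nat list \<Rightarrow>\<^sub>0 'k::field)"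
  where "antiR m w = (if w = [] then F [] else
    - (\<Sum>s\<in>{s \<in> splits m w. fst s \<noteq> []}. fq_mult m (F (mstd m (fst s))) (antiR m (mstd m (snd s)))))"
  by pat_completeness auto
termination
  by (relation "measure (\<lambda>(m, w). length w)") (auto simp: splits_def)

declare antiL.simps [simp del] antiR.simps [simp del]

lemma antiL_Nil [simp]: "antiL m [] = F []"
  and antiR_Nil [simp]: "antiR m [] = F []"
  by (simp_all add: antiL.simps antiR.simps)

lemma splits_Nil: "splits m [] = {([], [])}"
  by (auto simp: splits_def mword_def)

text \<open>The factorization \<open>(w, [])\<close> contributes \<open>antiL m w\<close>, which for
  non-empty \<open>w\<close> is by its recursion the negative of the remaining terms.\<close>

lemma antiL_sum_mperm:
  assumes "w \<in> mperms_of m n" "m \<ge> 1"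
  shows "(\<Sum>(u, v)\<in>splits m w. fq_mult m (antiL m (mstd m u)) (F (mstd m v))) =
    (if w = [] then F [] else 0)"
proof (cases "w = []")
  case True
  then show ?thesis by (simp add: splits_Nil fq_mult_one_right mstd_def)
next
  case False
  let ?g = "\<lambda>s. fq_mult m (antiL m (mstd m (fst s))) (F (mstd m (snd s)))"
  have "splits m w = insert (w, []) {s \<in> splits m w. snd s \<noteq> []}"
    using Nil_splits(2)[OF uniform_mword[OF uniform_mperm[OF assms(1)]]] by (auto simp: splits_def)
  then have "(\<Sum>s\<in>splits m w. ?g s) = (\<Sum>s\<in>insert (w, []) {s \<in> splits m w. snd s \<noteq> []}. ?g s)"
    by simp
  also have "\<dots> = ?g (w, []) + (\<Sum>s\<in>{s \<in> splits m w. snd s \<noteq> []}. ?g s)"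
    by (rule sum.insert) simp_all
  also have "?g (w, []) = antiL m w"
    using mstd_mperm[OF assms] by (simp add: mstd_def fq_mult_one_right)
  finally show ?thesis
    using False by (simp add: antiL.simps[of m w] case_prod_beta)
qed

lemma antiR_sum_mperm:
  assumes "w \<in> mperms_of m n" "m \<ge> 1"
  shows "(\<Sum>(u, v)\<in>splits m w. fq_mult m (F (mstd m u)) (antiR m (mstd m v))) =
    (if w = [] then F [] else 0)"
proof (cases "w = []")
  case True
  then show ?thesis by (simp add: splits_Nil fq_mult_one_right mstd_def)
next
  case False
  let ?g = "\<lambda>s. fq_mult m (F (mstd m (fst s))) (antiR m (mstd m (snd s)))"
  have "splits m w = insert ([], w) {s \<in> splits m w. fst s \<noteq> []}"
    using Nil_splits(1)[OF uniform_mword[OF uniform_mperm[OF assms(1)]]] by (auto simp: splits_def)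
  then have "(\<Sum>s\<in>splits m w. ?g s) = (\<Sum>s\<in>insert ([], w) {s \<in> splits m w. fst s \<noteq> []}. ?g s)"
    by simp
  also have "\<dots> = ?g ([], w) + (\<Sum>s\<in>{s \<in> splits m w. fst s \<noteq> []}. ?g s)"
    by (rule sum.insert) simp_all
  also have "?g ([], w) = antiR m w"
    using mstd_mperm[OF assms] by (simp add: mstd_def fq_mult_one_left)
  finally show ?thesis
    using False by (simp add: antiR.simps[of m w] case_prod_beta)
qed

text \<open>Factors of an \<open>m\<close>-permutation need not be standardized, hence this version
  for uniform words.\<close>

lemma antiL_sum:
  assumes "uniform m w" "m \<ge> 1"
  shows "(\<Sum>(u, v)\<in>splits m w. fq_mult m (antiL m (mstd m u)) (F (mstd m v))) =
    (if w = [] then F [] else (0 :: _ \<Rightarrow>\<^sub>0 'k::field))"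
proof -
  have "(\<Sum>(u, v)\<in>splits m (mstd m w). fq_mult m (antiL m (mstd m u)) (F (mstd m v))) =
      (if w = [] then F [] else (0 :: _ \<Rightarrow>\<^sub>0 'k))"
    using antiL_sum_mperm[OF mstd_mperms_of[OF assms] assms(2)] by (simp only: mstd_eq_Nil)
  moreover have "(\<Sum>(u, v)\<in>splits m (mstd m w). fq_mult m (antiL m (mstd m u)) (F (mstd m v)) :: _ \<Rightarrow>\<^sub>0 'k) =
      (\<Sum>(u, v)\<in>splits m w. fq_mult m (antiL m (mstd m u)) (F (mstd m v)))"
    by (rule sum_splits_mstd[OF assms, of "\<lambda>u v. fq_mult m (antiL m u) (F v)"])
  ultimately show ?thesis by (simp only:)
qed

lemma antiR_sum:
  assumes "uniform m w" "m \<ge> 1"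
  shows "(\<Sum>(u, v)\<in>splits m w. fq_mult m (F (mstd m u)) (antiR m (mstd m v))) =
    (if w = [] then F [] else (0 :: _ \<Rightarrow>\<^sub>0 'k::field))"
proof -
  have "(\<Sum>(u, v)\<in>splits m (mstd m w). fq_mult m (F (mstd m u)) (antiR m (mstd m v))) =
      (if w = [] then F [] else (0 :: _ \<Rightarrow>\<^sub>0 'k))"
    using antiR_sum_mperm[OF mstd_mperms_of[OF assms] assms(2)] by (simp only: mstd_eq_Nil)
  moreover have "(\<Sum>(u, v)\<in>splits m (mstd m w). fq_mult m (F (mstd m u)) (antiR m (mstd m v)) :: _ \<Rightarrow>\<^sub>0 'k) =
      (\<Sum>(u, v)\<in>splits m w. fq_mult m (F (mstd m u)) (antiR m (mstd m v)))"
    by (rule sum_splits_mstd[OF assms, of "\<lambda>u v. fq_mult m (F u) (antiR m v)"])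
  ultimately show ?thesis by (simp only:)
qed

lemma fqsym_subspace: "pm.subspace (fqsym m)"
  unfolding fqsym_def by (rule pm.subspace_span)

lemma F_fqsym: "w \<in> mperms m \<Longrightarrow> F w \<in> fqsym m"
  by (simp add: fqsym_eq)

lemma fq_mult_fqsym:
  assumes "x \<in> fqsym m" "y \<in> fqsym m" "m \<ge> 1"
  shows "fq_mult m x y \<in> fqsym m"
proof -
  have "fq_mult m (F \<alpha>) (F \<beta>) \<in> fqsym m" if "\<alpha> \<in> mperms m" "\<beta> \<in> mperms m" for \<alpha> \<beta>
    using that by (auto simp: fq_mult_F fqsym_eq keys_sum_bas mperms_def
        dest: shifted_shuffle_mperm[OF _ _ assms(3)])
  moreover have lin: "L z \<in> fqsym m"
    if "Vector_Spaces.linear scl scl L" "z \<in> fqsym m" "\<And>\<beta>. \<beta> \<in> mperms m \<Longrightarrow> L (F \<beta>) \<in> fqsym m"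
    for L and z :: "_ \<Rightarrow>\<^sub>0 'a"
  proof -
    have "L z = (\<Sum>\<beta>\<in>keys z. scl (lookup z \<beta>) (L (F \<beta>)))"
      by (subst linear_expand[OF that(1)]) (simp only: lin_ext_def)
    also have "\<dots> \<in> fqsym m"
    proof (intro pm.subspace_sum[OF fqsym_subspace] pm.subspace_scale[OF fqsym_subspace])
      fix \<beta> assume "\<beta> \<in> keys z"
      then have "\<beta> \<in> mperms m" using that(2) by (auto simp: fqsym_eq)
      then show "L (F \<beta>) \<in> fqsym m" by (rule that(3))
    qed
    finally show ?thesis .
  qed
  ultimately show ?thesis
    using lin[OF linear_fq_mult_left assms(1)] lin[OF linear_fq_mult_right assms(2)] by blast
qed

lemma mstd_splits_mperms:
  assumes "(u, v) \<in> splits m w" "w \<in> mperms m" "m \<ge> 1"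
  shows "mstd m u \<in> mperms m" "mstd m v \<in> mperms m"
proof -
  have "uniform m w" using assms(2) uniform_mperm by (auto simp: mperms_def)
  then have "uniform m u" "uniform m v" using splits_uniform assms(1) by blast+
  then show "mstd m u \<in> mperms m" "mstd m v \<in> mperms m"
    using mstd_mperms_of assms(3) by (auto simp: mperms_def)
qed

lemma antiL_fqsym: "m \<ge> 1 \<Longrightarrow> w \<in> mperms m \<Longrightarrow> (antiL m w :: _ \<Rightarrow>\<^sub>0 'k::field) \<in> fqsym m"
proof (induction "length w" arbitrary: w rule: less_induct)
  case less
  show ?case
  proof (cases "w = []")
    case False
    have "fq_mult m (antiL m (mstd m (fst s))) (F (mstd m (snd s)) :: _ \<Rightarrow>\<^sub>0 'k) \<in> fqsym m"
      if s: "s \<in> {s \<in> splits m w. snd s \<noteq> []}" for s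
    proof -
      obtain u v where uv: "s = (u, v)" "(u, v) \<in> splits m w" "v \<noteq> []"
        using s by (cases s) auto
      then have "length (mstd m u) < length w" by (auto simp: splits_def)
      then show ?thesis
        using less.hyps[of "mstd m u"] less.prems mstd_splits_mperms[OF uv(2)]
        by (auto simp: uv intro!: fq_mult_fqsym F_fqsym)
    qed
    then show ?thesis
      using False by (subst antiL.simps)
        (auto intro!: pm.subspace_neg[OF fqsym_subspace] pm.subspace_sum[OF fqsym_subspace])
  qed (simp add: F_fqsym)
qed

lemma antiR_fqsym: "m \<ge> 1 \<Longrightarrow> w \<in> mperms m \<Longrightarrow> (antiR m w :: _ \<Rightarrow>\<^sub>0 'k::field) \<in> fqsym m"
proof (induction "length w" arbitrary: w rule: less_induct)
  case less
  show ?case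
  proof (cases "w = []")
    case False
    have "fq_mult m (F (mstd m (fst s)) :: _ \<Rightarrow>\<^sub>0 'k) (antiR m (mstd m (snd s))) \<in> fqsym m"
      if s: "s \<in> {s \<in> splits m w. fst s \<noteq> []}" for s
    proof -
      obtain u v where uv: "s = (u, v)" "(u, v) \<in> splits m w" "u \<noteq> []"
        using s by (cases s) auto
      then have "length (mstd m v) < length w" by (auto simp: splits_def)
      then show ?thesis
        using less.hyps[of "mstd m v"] less.prems mstd_splits_mperms[OF uv(2)]
        by (auto simp: uv intro!: fq_mult_fqsym F_fqsym)
    qed
    then show ?thesis
      using False by (subst antiR.simps)
        (auto intro!: pm.subspace_neg[OF fqsym_subspace] pm.subspace_sum[OF fqsym_subspace])
  qed (simp add: F_fqsym)
qed

lemma fq_mult_zero_left [simp]: "fq_mult m 0 y = 0"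
  by (simp add: fq_mult_def)

lemma fq_mult_zero_right [simp]: "fq_mult m x 0 = 0"
  using fq_mult_sum_right[of m x "\<lambda>_. 0" "{}"] by simp

text \<open>In the convolution algebra a left inverse L and a right inverse R of the identity F
  agree, by L = L (F R) = (L F) R = R, written out over factorizations of \<open>w\<close>.\<close>

lemma antiL_eq_antiR:
  assumes "w \<in> mperms_of m n" "m \<ge> 1"
  shows "antiL m w = (antiR m w :: _ \<Rightarrow>\<^sub>0 'k::field)"
proof -
  let ?L = "\<lambda>u. antiL m (mstd m u) :: _ \<Rightarrow>\<^sub>0 'k" and ?R = "\<lambda>u. antiR m (mstd m u) :: _ \<Rightarrow>\<^sub>0 'k"
    and ?F = "\<lambda>u. F (mstd m u) :: _ \<Rightarrow>\<^sub>0 'k"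
  have un: "uniform m w" and mw: "mword m w"
    using uniform_mperm[OF assms(1)] uniform_mword by blast+
  have mp: "mstd m u \<in> mperms m" if "uniform m u" for u
    using mstd_mperms_of[OF that assms(2)] by (auto simp: mperms_def)
  have "antiL m w = (\<Sum>(u, v)\<in>splits m w. if v = [] then ?L u else 0)"
    by (simp only: sum_splits_single(2)[OF mw] mstd_mperm[OF assms])
  also have "\<dots> = (\<Sum>(a, v)\<in>splits m w. fq_mult m (?L a) (\<Sum>(b, c)\<in>splits m v. fq_mult m (?F b) (?R c)))"
  proof (intro sum.cong refl, clarify)
    fix u v assume "(u, v) \<in> splits m w"
    then have "uniform m v" using splits_uniform un by blast
    then show "(if v = [] then ?L u else 0) = fq_mult m (?L u) (\<Sum>(b, c)\<in>splits m v. fq_mult m (?F b) (?R c))"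
      unfolding antiR_sum[OF \<open>uniform m v\<close> assms(2)] by (simp add: fq_mult_one_right)
  qed
  also have "\<dots> = (\<Sum>(a, v)\<in>splits m w. \<Sum>(b, c)\<in>splits m v. fq_mult m (fq_mult m (?L a) (?F b)) (?R c))"
  proof (intro sum.cong refl, clarify)
    fix a v assume av: "(a, v) \<in> splits m w"
    then have un': "uniform m a" "uniform m v" using splits_uniform un by blast+
    have "fq_mult m (?L a) (fq_mult m (?F b) (?R c)) = fq_mult m (fq_mult m (?L a) (?F b)) (?R c)"
      if "(b, c) \<in> splits m v" for b c
    proof -
      have "uniform m b" "uniform m c" using splits_uniform that un' by blast+
      then show ?thesis
        using assms(2) un' mp
        by (intro fq_mult_assoc[symmetric] antiL_fqsym antiR_fqsym F_fqsym) auto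
    qed
    then show "fq_mult m (?L a) (\<Sum>(b, c)\<in>splits m v. fq_mult m (?F b) (?R c)) =
        (\<Sum>(b, c)\<in>splits m v. fq_mult m (fq_mult m (?L a) (?F b)) (?R c))"
      unfolding fq_mult_sum_right by (intro sum.cong) auto
  qed
  also have "\<dots> = (\<Sum>(u, c)\<in>splits m w. \<Sum>(a, b)\<in>splits m u. fq_mult m (fq_mult m (?L a) (?F b)) (?R c))"
    by (rule sum_splits_assoc[symmetric])
  also have "\<dots> = (\<Sum>(u, c)\<in>splits m w. if u = [] then ?R c else 0)"
  proof (intro sum.cong refl, clarify)
    fix u c assume "(u, c) \<in> splits m w"
    then have "uniform m u" using splits_uniform un by blast
    then have "(\<Sum>(a, b)\<in>splits m u. fq_mult m (?L a) (?F b)) = (if u = [] then F [] else 0)"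
      by (rule antiL_sum[OF _ assms(2)])
    then have "fq_mult m (\<Sum>(a, b)\<in>splits m u. fq_mult m (?L a) (?F b)) (?R c) = (if u = [] then ?R c else 0)"
      by (simp add: fq_mult_one_left)
    then show "(\<Sum>(a, b)\<in>splits m u. fq_mult m (fq_mult m (?L a) (?F b)) (?R c)) = (if u = [] then ?R c else 0)"
      by (simp add: fq_mult_sum_left case_prod_beta)
  qed
  also have "\<dots> = antiR m w"
    by (simp only: sum_splits_single(1)[OF mw] mstd_mperm[OF assms])
  finally show ?thesis .
qed

definition fq_antipode :: "nat \<Rightarrow> (nat list \<Rightarrow>\<^sub>0 'k::field) \<Rightarrow> (nat list \<Rightarrow>\<^sub>0 'k)"
  where "fq_antipode m = lin_ext (antiL m)"

lemma linear_fq_antipode: "Vector_Spaces.linear scl scl (fq_antipode m)"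
  by (simp add: fq_antipode_def)

lemma linear_scl_counit: "Vector_Spaces.linear scl scl (\<lambda>x. scl (fq_counit x) y)"
  by (rule linear_sclI) (simp_all add: fq_counit_def lookup_add pm.scale_left_distrib)

text \<open>The first identity is the defining property of the left inverse; for the second, the
  left inverse is exchanged for the right one in each term.\<close>

lemma fq_antipode:
  assumes "x \<in> fqsym m" "m \<ge> 1"
  shows "lin_ext (\<lambda>(a, b). fq_mult m (fq_antipode m (bas a)) (bas b)) (fq_comult m x) = scl (fq_counit x) (F [])"
    "lin_ext (\<lambda>(a, b). fq_mult m (bas a) (fq_antipode m (bas b))) (fq_comult m x) = scl (fq_counit x) (F [])"
proof -
  have mp: "\<exists>n. \<alpha> \<in> mperms_of m n" if "\<alpha> \<in> keys x" for \<alpha>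
    using that assms by (auto simp: fqsym_eq mperms_def)
  show "lin_ext (\<lambda>(a, b). fq_mult m (fq_antipode m (bas a)) (bas b)) (fq_comult m x) = scl (fq_counit x) (F [])"
  proof (rule linear_eq_on_keys[where x = x])
    fix \<alpha> assume "\<alpha> \<in> keys x"
    then have un: "uniform m \<alpha>" using mp uniform_mperm by blast
    have "lin_ext (\<lambda>(a, b). fq_mult m (fq_antipode m (bas a)) (bas b)) (fq_comult m (F \<alpha>)) =
        (\<Sum>(u, v)\<in>splits m \<alpha>. fq_mult m (antiL m (mstd m u)) (F (mstd m v)))"
      by (simp add: fq_antipode_def fq_comult_F lin_ext_sum case_prod_beta)
    then show "lin_ext (\<lambda>(a, b). fq_mult m (fq_antipode m (bas a)) (bas b)) (fq_comult m (F \<alpha>)) =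
        scl (fq_counit (F \<alpha>)) (F [])"
      unfolding antiL_sum[OF un assms(2)] by (simp only: fq_counit_F if_distrib[of "\<lambda>c. scl c (F [])"] pm.scale_one pm.scale_zero_left)
  qed (rule linear_comp[OF linear_fq_comult linear_lin_ext] linear_scl_counit)+
  show "lin_ext (\<lambda>(a, b). fq_mult m (bas a) (fq_antipode m (bas b))) (fq_comult m x) = scl (fq_counit x) (F [])"
  proof (rule linear_eq_on_keys[where x = x])
    fix \<alpha> assume "\<alpha> \<in> keys x"
    then have un: "uniform m \<alpha>" using mp uniform_mperm by blast
    have eq: "antiL m (mstd m v) = antiR m (mstd m v)" if "(u, v) \<in> splits m \<alpha>" for u v
      using splits_uniform(2)[OF that un] by (intro antiL_eq_antiR[OF mstd_mperms_of[OF _ assms(2)] assms(2)])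
    have "lin_ext (\<lambda>(a, b). fq_mult m (bas a) (fq_antipode m (bas b))) (fq_comult m (F \<alpha>)) =
        (\<Sum>(u, v)\<in>splits m \<alpha>. fq_mult m (F (mstd m u)) (antiR m (mstd m v)))"
      unfolding fq_comult_F lin_ext_sum
      by (intro sum.cong refl) (auto simp: fq_antipode_def eq)
    then show "lin_ext (\<lambda>(a, b). fq_mult m (bas a) (fq_antipode m (bas b))) (fq_comult m (F \<alpha>)) =
        scl (fq_counit (F \<alpha>)) (F [])"
      unfolding antiR_sum[OF un assms(2)] by (simp only: fq_counit_F if_distrib[of "\<lambda>c. scl c (F [])"] pm.scale_one pm.scale_zero_left)
  qed (rule linear_comp[OF linear_fq_comult linear_lin_ext] linear_scl_counit)+
qed

section \<open>The subspace spanned by the sums over sylvester classes\<close>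

lemma mperms_conv_sylv:
  assumes "m \<ge> 1"
  shows "{\<alpha> \<in> mperms m. sylv m \<alpha> = T} = {\<alpha> \<in> mperms_of m (nodes T). sylv m \<alpha> = T}"
  using nodes_sylv assms by (auto simp: mperms_def)

lemma finite_sylv_class: "m \<ge> 1 \<Longrightarrow> finite {\<alpha> \<in> mperms m. sylv m \<alpha> = T}"
  unfolding mperms_conv_sylv by (rule finite_subset[OF _ finite_mperms_of[of m "nodes T"]]) auto

lemma lookup_P:
  assumes "m \<ge> 1"
  shows "lookup (P m T :: _ \<Rightarrow>\<^sub>0 'k::field) \<alpha> = (if \<alpha> \<in> mperms m \<and> sylv m \<alpha> = T then 1 else 0)"
  unfolding P_def by (subst lookup_sum_bas[OF finite_sylv_class[OF assms]]) simp

lemma keys_P: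
  assumes "m \<ge> 1"
  shows "keys (P m T :: _ \<Rightarrow>\<^sub>0 'k::field) = {\<alpha> \<in> mperms_of m (nodes T). sylv m \<alpha> = T}"
  unfolding P_def by (subst keys_sum_bas[OF finite_sylv_class[OF assms]]) (rule mperms_conv_sylv[OF assms])

text \<open>A fixed word in the class of \<open>T\<close>. Distinct trees have disjoint classes, so
  the coefficient at \<open>rep m T\<close> is the coordinate along \<open>P m T\<close>.\<close>

definition rep :: "nat \<Rightarrow> ptree \<Rightarrow> nat list"
  where "rep m T = (SOME w. w \<in> mperms_of m (nodes T) \<and> sylv m w = T)"

lemma rep:
  assumes "T \<in> ary_trees m" "m \<ge> 1"
  shows "rep m T \<in> mperms_of m (nodes T)" "sylv m (rep m T) = T" "rep m T \<in> mperms m"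
proof -
  have "\<exists>w. w \<in> mperms_of m (nodes T) \<and> sylv m w = T" using ex_sylv[OF assms] by blast
  then have "rep m T \<in> mperms_of m (nodes T) \<and> sylv m (rep m T) = T"
    unfolding rep_def by (rule someI_ex)
  then show "rep m T \<in> mperms_of m (nodes T)" "sylv m (rep m T) = T" "rep m T \<in> mperms m"
    by (auto simp: mperms_def)
qed

lemma lookup_P_rep:
  assumes "S \<in> ary_trees m" "m \<ge> 1"
  shows "lookup (P m T :: _ \<Rightarrow>\<^sub>0 'k::field) (rep m S) = (if S = T then 1 else 0)"
  using rep[OF assms] by (simp add: lookup_P[OF assms(2)])

lemma lookup_sum_scl_P:
  assumes "finite X" "S \<in> ary_trees m" "m \<ge> 1"
  shows "lookup (\<Sum>T\<in>X. scl (c T) (P m T :: _ \<Rightarrow>\<^sub>0 'k::field)) (rep m S) = (if S \<in> X then c S else 0)"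
  using assms by (simp add: lookup_sum lookup_P_rep if_distrib[of "(*) _"] cong: if_cong)

definition sylv_invariant :: "nat \<Rightarrow> (nat list \<Rightarrow>\<^sub>0 'k::field) \<Rightarrow> bool"
  where "sylv_invariant m x \<longleftrightarrow> keys x \<subseteq> mperms m \<and>
    (\<forall>u\<in>mperms m. \<forall>v\<in>mperms m. sylv m u = sylv m v \<longrightarrow> lookup x u = lookup x v)"

lemma sylv_invariantD:
  assumes "sylv_invariant m x" "u \<in> mperms m" "v \<in> mperms m" "sylv m u = sylv m v"
  shows "lookup x u = lookup x v"
  using assms unfolding sylv_invariant_def by blast

lemma sylv_invariant_expand:
  fixes x :: "nat list \<Rightarrow>\<^sub>0 'k::field"
  assumes "sylv_invariant m x" "finite X" "sylv m ` keys x \<subseteq> X" "X \<subseteq> ary_trees m" "m \<ge> 1"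
  shows "x = (\<Sum>T\<in>X. scl (lookup x (rep m T)) (P m T))"
proof (rule poly_mapping_eqI)
  fix \<alpha>
  let ?r = "\<Sum>T\<in>X. scl (lookup x (rep m T)) (P m T)"
  show "lookup x \<alpha> = lookup ?r \<alpha>"
  proof (cases "\<alpha> \<in> mperms m")
    case True
    have "lookup ?r \<alpha> = (if sylv m \<alpha> \<in> X then lookup x (rep m (sylv m \<alpha>)) else 0)"
      using True assms(2,5) by (simp add: lookup_sum lookup_P if_distrib[of "(*) _"] cong: if_cong)
    also have "\<dots> = lookup x \<alpha>"
    proof (cases "sylv m \<alpha> \<in> X")
      case T: True
      then have "sylv m \<alpha> \<in> ary_trees m" using assms(4) by blast
      note r = rep[OF this assms(5)]
      show ?thesis
        using T sylv_invariantD[OF assms(1) r(3) True r(2)] by simp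
    next
      case False
      then have "\<alpha> \<notin> keys x" using assms(3) by blast
      then show ?thesis using False by (simp add: in_keys_iff)
    qed
    finally show ?thesis by simp
  next
    case False
    then have "lookup x \<alpha> = 0"
      using assms(1) by (auto simp: sylv_invariant_def in_keys_iff)
    then show ?thesis using False assms(5) by (simp add: lookup_sum lookup_P)
  qed
qed

lemma sylv_in_ary: "w \<in> mperms m \<Longrightarrow> m \<ge> 1 \<Longrightarrow> sylv m w \<in> ary_trees m"
  by (rule sylv_spec(1))

lemma pbt_eq:
  assumes "m \<ge> 1"
  shows "pbt m = {x :: _ \<Rightarrow>\<^sub>0 'k::field. sylv_invariant m x}"
proof
  have "pm.subspace {x :: _ \<Rightarrow>\<^sub>0 'k. sylv_invariant m x}"
  proof (unfold pm.subspace_def, intro conjI ballI allI)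
    show "0 \<in> {x :: _ \<Rightarrow>\<^sub>0 'k. sylv_invariant m x}" by (simp add: sylv_invariant_def)
  next
    fix x y :: "_ \<Rightarrow>\<^sub>0 'k" assume "x \<in> {x. sylv_invariant m x}" "y \<in> {x. sylv_invariant m x}"
    then have x: "sylv_invariant m x" and y: "sylv_invariant m y" by simp_all
    then have "keys (x + y) \<subseteq> mperms m"
      using Poly_Mapping.keys_add[of x y] unfolding sylv_invariant_def by blast
    then show "x + y \<in> {x. sylv_invariant m x}"
      using sylv_invariantD[OF x] sylv_invariantD[OF y]
      unfolding sylv_invariant_def mem_Collect_eq lookup_add by metis
  next
    fix c and x :: "_ \<Rightarrow>\<^sub>0 'k" assume "x \<in> {x. sylv_invariant m x}"
    then have x: "sylv_invariant m x" by simp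
    moreover have "keys (scl c x) \<subseteq> keys x"
      by (auto simp: in_keys_iff)
    ultimately have "keys (scl c x) \<subseteq> mperms m"
      unfolding sylv_invariant_def by blast
    then show "scl c x \<in> {x. sylv_invariant m x}"
      using sylv_invariantD[OF x] unfolding sylv_invariant_def mem_Collect_eq lookup_scl by metis
  qed
  moreover have "sylv_invariant m (P m T :: _ \<Rightarrow>\<^sub>0 'k)" for T
    using assms by (auto simp: sylv_invariant_def lookup_P in_keys_iff split: if_splits)
  ultimately show "pbt m \<subseteq> {x :: _ \<Rightarrow>\<^sub>0 'k. sylv_invariant m x}"
    unfolding pbt_def by (intro pm.span_minimal) auto
next
  show "{x :: _ \<Rightarrow>\<^sub>0 'k. sylv_invariant m x} \<subseteq> pbt m"
  proof
    fix x :: "_ \<Rightarrow>\<^sub>0 'k" assume "x \<in> {x. sylv_invariant m x}"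
    then have x: "sylv_invariant m x" by simp
    let ?X = "sylv m ` keys x"
    have X: "?X \<subseteq> ary_trees m"
      using x sylv_in_ary[OF _ assms] by (auto simp: sylv_invariant_def)
    have "x = (\<Sum>T\<in>?X. scl (lookup x (rep m T)) (P m T))"
      using sylv_invariant_expand[OF x _ order_refl X assms] by simp
    also have "\<dots> \<in> pbt m"
      unfolding pbt_def using X by (intro pm.span_sum pm.span_scale pm.span_base) blast
    finally show "x \<in> pbt m" .
  qed
qed

lemma pbt_subset_fqsym: "m \<ge> 1 \<Longrightarrow> x \<in> pbt m \<Longrightarrow> x \<in> fqsym m"
  by (simp add: pbt_eq fqsym_eq sylv_invariant_def)

lemma pbt_deg_eq:
  assumes "m \<ge> 1"
  shows "pbt_deg m n = {x :: _ \<Rightarrow>\<^sub>0 'k::field. sylv_invariant m x \<and> keys x \<subseteq> mperms_of m n}"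
  unfolding pbt_deg_def pbt_eq[OF assms] fqsym_deg_eq by auto

lemma P_pbt: "T \<in> ary_trees m \<Longrightarrow> P m T \<in> pbt m"
  unfolding pbt_def by (intro pm.span_base) auto

lemma P_pbt_deg: "T \<in> ary_trees m \<Longrightarrow> m \<ge> 1 \<Longrightarrow> P m T \<in> pbt_deg m (nodes T)"
  by (simp add: pbt_deg_def P_pbt fqsym_deg_eq keys_P)

lemma subspace_pbt_deg: "pm.subspace (pbt_deg m n)"
  unfolding pbt_deg_def pbt_def fqsym_deg_def
  by (intro pm.subspace_inter pm.subspace_span)

lemma pbt_deg_expand:
  fixes x :: "nat list \<Rightarrow>\<^sub>0 'k::field"
  assumes "x \<in> pbt_deg m n" "m \<ge> 1"
  shows "x = (\<Sum>T\<in>{T. ary (Suc m) T \<and> nodes T = n}. scl (lookup x (rep m T)) (P m T))"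
proof (rule sylv_invariant_expand[OF _ finite_ary_trees _ _ assms(2)])
  show "sylv_invariant m x" using assms by (simp add: pbt_deg_eq)
  show "sylv m ` keys x \<subseteq> {T. ary (Suc m) T \<and> nodes T = n}"
  proof clarify
    fix w assume "w \<in> keys x"
    then have w: "w \<in> mperms_of m n" using assms by (auto simp: pbt_deg_eq)
    then have "w \<in> mperms m" by (auto simp: mperms_def)
    then show "ary (Suc m) (sylv m w) \<and> nodes (sylv m w) = n"
      using sylv_in_ary[of w m] nodes_sylv[OF w] assms(2) by simp
  qed
qed auto

lemma pbt_deg_span:
  assumes "m \<ge> 1"
  shows "pbt_deg m n = pm.span ((P m :: _ \<Rightarrow> _ \<Rightarrow>\<^sub>0 'k::field) ` {T. ary (Suc m) T \<and> nodes T = n})"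
proof
  show "pbt_deg m n \<subseteq> pm.span ((P m :: _ \<Rightarrow> _ \<Rightarrow>\<^sub>0 'k) ` {T. ary (Suc m) T \<and> nodes T = n})"
  proof
    fix x :: "_ \<Rightarrow>\<^sub>0 'k" assume "x \<in> pbt_deg m n"
    from pbt_deg_expand[OF this assms]
    show "x \<in> pm.span (P m ` {T. ary (Suc m) T \<and> nodes T = n})"
      by (metis (no_types, lifting) image_eqI pm.span_base pm.span_scale pm.span_sum)
  qed
  show "pm.span ((P m :: _ \<Rightarrow> _ \<Rightarrow>\<^sub>0 'k) ` {T. ary (Suc m) T \<and> nodes T = n}) \<subseteq> pbt_deg m n"
    using P_pbt_deg[OF _ assms] by (intro pm.span_minimal subspace_pbt_deg) auto
qed

section \<open>The basis and the graded dimension\<close>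

lemma inj_on_P:
  assumes "m \<ge> 1"
  shows "inj_on (P m :: _ \<Rightarrow> _ \<Rightarrow>\<^sub>0 'k::field) (ary_trees m)"
proof (rule inj_onI)
  fix S T assume ST: "S \<in> ary_trees m" "T \<in> ary_trees m" "P m S = (P m T :: _ \<Rightarrow>\<^sub>0 'k)"
  then have "lookup (P m S :: _ \<Rightarrow>\<^sub>0 'k) (rep m S) = lookup (P m T :: _ \<Rightarrow>\<^sub>0 'k) (rep m S)"
    by simp
  then show "S = T" by (simp add: lookup_P_rep[OF ST(1) assms] split: if_splits)
qed

lemma independent_P:
  assumes "m \<ge> 1"
  shows "pm.independent ((P m :: _ \<Rightarrow> _ \<Rightarrow>\<^sub>0 'k::field) ` ary_trees m)"
  unfolding pm.independent_explicit_module
proof (intro allI impI)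
  fix B c b assume B: "B \<subseteq> (P m :: _ \<Rightarrow> _ \<Rightarrow>\<^sub>0 'k) ` ary_trees m" "finite B"
    and 0: "(\<Sum>b\<in>B. scl (c b) b) = 0" and b: "b \<in> B"
  obtain X where X: "X \<subseteq> ary_trees m" "finite X" "B = P m ` X"
    using B by (metis finite_subset_image)
  obtain S where S: "S \<in> X" "b = P m S" using b X by auto
  have "inj_on (P m :: _ \<Rightarrow> _ \<Rightarrow>\<^sub>0 'k) X" using inj_on_P[OF assms] X(1) by (rule inj_on_subset)
  then have "(\<Sum>T\<in>X. scl (c (P m T)) (P m T)) = 0"
    using 0 by (simp add: X(3) sum.reindex)
  moreover have "lookup (\<Sum>T\<in>X. scl (c (P m T)) (P m T)) (rep m S) = c b"
    using lookup_sum_scl_P[OF X(2), of S m "\<lambda>T. c (P m T)"] X S assms by auto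
  ultimately show "c b = 0" by simp
qed

lemma dim_pbt_deg:
  assumes "m \<ge> 1"
  shows "pm.dim (pbt_deg m n :: (_ \<Rightarrow>\<^sub>0 'k::field) set) = card {T. ary (Suc m) T \<and> nodes T = n}"
proof -
  let ?X = "{T. ary (Suc m) T \<and> nodes T = n}"
  have sub: "?X \<subseteq> ary_trees m" by auto
  have "pm.independent ((P m :: _ \<Rightarrow> _ \<Rightarrow>\<^sub>0 'k) ` ?X)"
    using sub by (intro pm.independent_mono[OF independent_P[OF assms]] image_mono)
  then have "pm.dim ((P m :: _ \<Rightarrow> _ \<Rightarrow>\<^sub>0 'k) ` ?X) = card ((P m :: _ \<Rightarrow> _ \<Rightarrow>\<^sub>0 'k) ` ?X)"
    by (rule pm.dim_eq_card_independent)
  also have "\<dots> = card ?X"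
    using inj_on_P[OF assms] sub by (intro card_image) (rule inj_on_subset)
  finally show ?thesis by (simp add: pbt_deg_span[OF assms])
qed

section \<open>The product\<close>

lemma keys_fq_mult:
  assumes "keys x \<subseteq> mperms_of m p" "keys y \<subseteq> mperms_of m q" "m \<ge> 1"
  shows "keys (fq_mult m x y :: _ \<Rightarrow>\<^sub>0 'k::field) \<subseteq> mperms_of m (p + q)"
proof -
  have "keys (fq_mult m (F \<alpha>) (F \<beta>) :: _ \<Rightarrow>\<^sub>0 'k) \<subseteq> mperms_of m (p + q)"
    if "\<alpha> \<in> keys x" "\<beta> \<in> keys y" for \<alpha> \<beta>
    using that assms shifted_shuffle_mperm[of \<alpha> m p \<beta> q] by (auto simp: fq_mult_F keys_sum_bas)
  then have "keys (fq_mult m (F \<alpha>) y) \<subseteq> mperms_of m (p + q)" if "\<alpha> \<in> keys x" for \<alpha>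
    using that by (subst linear_expand[OF linear_fq_mult_right])
      (rule order_trans[OF keys_lin_ext], blast)
  then show ?thesis
    by (subst linear_expand[OF linear_fq_mult_left])
      (rule order_trans[OF keys_lin_ext], blast)
qed

text \<open>Homogeneity of \<open>x\<close> fixes the place \<open>p\<close> at which the letters of
  \<gamma> are cut, so at most one pair of basis words contributes.\<close>

lemma lookup_fq_mult:
  fixes x y :: "nat list \<Rightarrow>\<^sub>0 'k::field"
  assumes "keys x \<subseteq> mperms_of m p" "keys y \<subseteq> mperms_of m q" "m \<ge> 1"
  shows "lookup (fq_mult m x y) \<gamma> = lookup x (wlow p \<gamma>) * lookup y (whigh p \<gamma>)"
proof -
  have F: "lookup (fq_mult m (F \<alpha>) (F \<beta>)) \<gamma> =
      (if \<alpha> = wlow p \<gamma> then if \<beta> = whigh p \<gamma> then 1 else 0 else (0 :: 'k))"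
    if "\<alpha> \<in> keys x" "\<beta> \<in> keys y" for \<alpha> \<beta>
    using that assms shifted_shuffle_iff[of \<alpha> m p \<beta> q \<gamma>]
    by (auto simp: fq_mult_F lookup_sum_bas)
  have "lookup (fq_mult m (F \<alpha>) y) \<gamma> =
      (if \<alpha> = wlow p \<gamma> then lookup y (whigh p \<gamma>) else 0)" if "\<alpha> \<in> keys x" for \<alpha>
  proof -
    have "lookup (fq_mult m (F \<alpha>) y) \<gamma> =
        (\<Sum>\<beta>\<in>keys y. lookup y \<beta> * lookup (fq_mult m (F \<alpha>) (F \<beta>)) \<gamma>)"
      by (subst linear_expand[OF linear_fq_mult_right]) (simp add: lookup_lin_ext)
    also have "\<dots> = (\<Sum>\<beta>\<in>keys y. lookup y \<beta> *
        (if \<beta> = whigh p \<gamma> then if \<alpha> = wlow p \<gamma> then 1 else 0 else 0))"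
      using F that by (intro sum.cong) auto
    finally show ?thesis unfolding sum_keys_delta by simp
  qed
  then have "(\<Sum>\<alpha>\<in>keys x. lookup x \<alpha> * lookup (fq_mult m (F \<alpha>) y) \<gamma>) =
      (\<Sum>\<alpha>\<in>keys x. lookup x \<alpha> *
        (if \<alpha> = wlow p \<gamma> then lookup y (whigh p \<gamma>) else 0))"
    by (intro sum.cong) auto
  then show ?thesis
    unfolding sum_keys_delta
    by (subst linear_expand[OF linear_fq_mult_left]) (simp add: lookup_lin_ext)
qed

lemma sylvester_wlow: "sylvester u v \<Longrightarrow> sylvester (wlow p u) (wlow p v)"
  unfolding wlow_def by (erule sylvester_filter) auto

lemma strict_mono_on_minus: "strict_mono_on (set (filter (\<lambda>x. p < x) w)) (\<lambda>x. x - (p :: nat))"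
  by (auto simp: strict_mono_on_def)

lemma sylvester_whigh: "sylvester u v \<Longrightarrow> sylvester (whigh p u) (whigh p v)"
  unfolding whigh_def
  by (rule sylvester_map[OF sylvester_filter strict_mono_on_minus]) auto

lemma shape_bst_map:
  assumes "strict_mono_on (set w) f"
  shows "shape (bstree (map f w)) = shape (bstree w)"
  by (rule shape_bst_cong) (use strict_mono_on_less_eq[OF assms] in auto)

lemma pbt_deg_mult:
  assumes "x \<in> pbt_deg m p" "y \<in> pbt_deg m q" "m \<ge> 1"
  shows "fq_mult m x y \<in> pbt_deg m (p + q)"
proof -
  have keys: "keys x \<subseteq> mperms_of m p" "keys y \<subseteq> mperms_of m q"
    and inv: "sylv_invariant m x" "sylv_invariant m y"
    using assms by (auto simp: pbt_deg_eq)
  note keys_xy = keys_fq_mult[OF keys assms(3)]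
  have "lookup (fq_mult m x y) u = lookup (fq_mult m x y) v"
    if uv: "u \<in> mperms m" "v \<in> mperms m" "sylv m u = sylv m v" for u v
  proof -
    have syl: "sylvester u v" using sylvester_iff_sylv[OF uv(1,2) assms(3)] uv(3) by simp
    then have mset: "mset u = mset v" by (rule sylvester_mset)
    show ?thesis
    proof (cases "u \<in> mperms_of m (p + q)")
      case True
      then have v: "v \<in> mperms_of m (p + q)" using mset_mperm_cong mset by metis
      have w: "wlow p u \<in> mperms m" "wlow p v \<in> mperms m" "whigh p u \<in> mperms m" "whigh p v \<in> mperms m"
        using wlow_mperm[OF True] wlow_mperm[OF v] whigh_mperm[OF True] whigh_mperm[OF v]
        by (auto simp: mperms_def)
      have "sylv m (wlow p u) = sylv m (wlow p v)" "sylv m (whigh p u) = sylv m (whigh p v)"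
        using sylvester_wlow[OF syl] sylvester_whigh[OF syl]
          sylvester_iff_sylv[OF w(1,2) assms(3)] sylvester_iff_sylv[OF w(3,4) assms(3)] by blast+
      then show ?thesis
        unfolding lookup_fq_mult[OF keys assms(3)]
        using sylv_invariantD[OF inv(1) w(1,2)] sylv_invariantD[OF inv(2) w(3,4)] by simp
    next
      case False
      then have "v \<notin> mperms_of m (p + q)" using mset_mperm_cong mset by metis
      then have "u \<notin> keys (fq_mult m x y)" "v \<notin> keys (fq_mult m x y)"
        using False keys_xy by blast+
      then show ?thesis by (simp add: in_keys_iff)
    qed
  qed
  then show ?thesis
    using keys_xy assms(3) by (auto simp: pbt_deg_eq sylv_invariant_def mperms_def)
qed

text \<open>The letters up to \<open>p\<close> occupy \<open>m * p\<close> nodes, which converts a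
  cut by letter into a cut by position.\<close>

lemma to_bin_sylv_wlow_whigh:
  assumes "\<gamma> \<in> mperms_of m (p + q)" "m \<ge> 1"
  shows "to_bin (sylv m (wlow p \<gamma>)) = low (m * p) (to_bin (sylv m \<gamma>))"
    "to_bin (sylv m (whigh p \<gamma>)) = high (m * p) (to_bin (sylv m \<gamma>))"
proof -
  have low: "wlow p \<gamma> \<in> mperms_of m p" and high: "whigh p \<gamma> \<in> mperms_of m q"
    using wlow_mperm[OF assms(1)] whigh_mperm[OF assms(1)] .
  have mp: "\<gamma> \<in> mperms m" "wlow p \<gamma> \<in> mperms m" "whigh p \<gamma> \<in> mperms m"
    using assms(1) low high by (auto simp: mperms_def)
  have len: "length (filter (\<lambda>x. x \<le> p) \<gamma>) = m * p"
    using mperms_ofD(1)[OF low] by (simp add: wlow_def)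
  show "to_bin (sylv m (wlow p \<gamma>)) = low (m * p) (to_bin (sylv m \<gamma>))"
    using sylv_spec(2)[OF mp(1) assms(2)] sylv_spec(2)[OF mp(2) assms(2)] shape_bst_filter_le[of p \<gamma>]
    by (simp add: len wlow_def)
  show "to_bin (sylv m (whigh p \<gamma>)) = high (m * p) (to_bin (sylv m \<gamma>))"
    using sylv_spec(2)[OF mp(1) assms(2)] sylv_spec(2)[OF mp(3) assms(2)] shape_bst_filter_gt[of p \<gamma>]
      shape_bst_map[OF strict_mono_on_minus, of p \<gamma>]
    by (simp add: len whigh_def)
qed

text \<open>The coefficient of \<gamma> in the product is 1 or 0 according to whether its two
  restrictions have the trees \<open>T'\<close> and \<open>T''\<close>. On trees this is the
  membership test of \<open>tamari_interval_iff\<close>.\<close>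

lemma fq_mult_P:
  assumes "T' \<in> ary_trees m" "T'' \<in> ary_trees m" "m \<ge> 1"
  shows "fq_mult m (P m T') (P m T'' :: nat list \<Rightarrow>\<^sub>0 'k::field) =
    (\<Sum>T\<in>{T. mtamari m (lower_bound T' T'') T \<and> mtamari m T (upper_bound m T' T'')}. P m T)"
proof (rule poly_mapping_eqI)
  fix \<gamma>
  let ?I = "{T. mtamari m (lower_bound T' T'') T \<and> mtamari m T (upper_bound m T' T'')}"
  let ?p = "nodes T'" and ?q = "nodes T''"
  let ?s = "to_bin T'" and ?t = "to_bin T''"
  have size: "size ?s = m * ?p" "size ?t = m * ?q"
    using to_bin_mbin[of m T'] to_bin_mbin[of m T''] assms by auto
  have I: "T \<in> ?I \<longleftrightarrow> ary (Suc m) T \<and> tamari (glue_left ?s ?t) (to_bin T) \<and> tamari (to_bin T) (glue_right ?s ?t)" for T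
    using to_bin_lower_bound[OF assms] to_bin_upper_bound[OF assms] by (auto simp: mtamari_def)
  \<comment> \<open>Comparable trees have the same size, which makes the interval finite; over an
    infinite index set \<open>sum\<close> would default to 0.\<close>
  have nodes: "ary (Suc m) T \<and> nodes T = ?p + ?q" if "T \<in> ?I" for T
  proof -
    have "size (to_bin T) = m * (?p + ?q)"
      using size_tamari[of "glue_left ?s ?t" "to_bin T"] that size unfolding I by (simp add: distrib_left)
    then show ?thesis using to_bin_mbin[of m T] that assms(3) unfolding I by simp
  qed
  have fin: "finite ?I"
    by (rule finite_subset[OF _ finite_ary_trees[of "Suc m" "?p + ?q"]]) (use nodes in blast)
  have keys: "keys (P m T' :: _ \<Rightarrow>\<^sub>0 'k) \<subseteq> mperms_of m ?p"
    "keys (P m T'' :: _ \<Rightarrow>\<^sub>0 'k) \<subseteq> mperms_of m ?q"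
    using keys_P[OF assms(3)] by auto
  have rhs: "lookup (\<Sum>T\<in>?I. P m T :: _ \<Rightarrow>\<^sub>0 'k) \<gamma> = (if \<gamma> \<in> mperms m \<and> sylv m \<gamma> \<in> ?I then 1 else 0)"
    using fin by (cases "\<gamma> \<in> mperms m") (simp_all add: lookup_sum lookup_P[OF assms(3)])
  show "lookup (fq_mult m (P m T') (P m T'' :: _ \<Rightarrow>\<^sub>0 'k)) \<gamma> = lookup (\<Sum>T\<in>?I. P m T) \<gamma>"
  proof (cases "\<gamma> \<in> mperms_of m (?p + ?q)")
    case True
    have low: "wlow ?p \<gamma> \<in> mperms m" and high: "whigh ?p \<gamma> \<in> mperms m"
      using wlow_mperm[OF True] whigh_mperm[OF True] by (auto simp: mperms_def)
    have \<gamma>: "\<gamma> \<in> mperms m" using True by (auto simp: mperms_def)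
    have ary: "ary (Suc m) (sylv m \<gamma>)" using sylv_in_ary[OF \<gamma> assms(3)] by simp
    have sz: "size (to_bin (sylv m \<gamma>)) = size ?s + size ?t"
      using to_bin_mbin[OF ary assms(3)] nodes_sylv[OF True assms(3)] by (simp add: size distrib_left)
    have "sylv m \<gamma> \<in> ?I \<longleftrightarrow> low (m * ?p) (to_bin (sylv m \<gamma>)) = ?s \<and> high (m * ?p) (to_bin (sylv m \<gamma>)) = ?t"
      unfolding I using ary tamari_interval_iff[OF sz] by (simp add: size)
    also have "\<dots> \<longleftrightarrow> sylv m (wlow ?p \<gamma>) = T' \<and> sylv m (whigh ?p \<gamma>) = T''"
      unfolding to_bin_sylv_wlow_whigh[OF True assms(3), symmetric]
      using to_bin_inj[of m "sylv m (wlow ?p \<gamma>)" T'] to_bin_inj[of m "sylv m (whigh ?p \<gamma>)" T'']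
        sylv_in_ary[OF low assms(3)] sylv_in_ary[OF high assms(3)] assms(1,2)
      unfolding mem_Collect_eq by metis
    finally have mem: "sylv m \<gamma> \<in> ?I \<longleftrightarrow> sylv m (wlow ?p \<gamma>) = T' \<and> sylv m (whigh ?p \<gamma>) = T''" .
    show ?thesis
      unfolding rhs mem lookup_fq_mult[OF keys assms(3)] lookup_P[OF assms(3)]
      by (cases "sylv m (wlow ?p \<gamma>) = T'"; cases "sylv m (whigh ?p \<gamma>) = T''")
        (simp_all only: low high \<gamma> simp_thms if_True if_False mult_1 mult_zero_left mult_zero_right)
  next
    case False
    then have "\<gamma> \<notin> keys (fq_mult m (P m T') (P m T'' :: _ \<Rightarrow>\<^sub>0 'k))"
      using keys_fq_mult[OF keys assms(3)] by blast
    moreover have "\<not> (\<gamma> \<in> mperms m \<and> sylv m \<gamma> \<in> ?I)"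
      using nodes[of "sylv m \<gamma>"] nodes_sylv[of \<gamma> m] False assms(3) by (auto simp: mperms_def)
    ultimately show ?thesis unfolding rhs by (simp add: in_keys_iff)
  qed
qed

section \<open>The coproduct\<close>

text \<open>The inverse of the rank: \<open>i\<close> is sent to the i-th smallest element of
  \<open>A\<close>.\<close>

definition enum :: "nat set \<Rightarrow> nat \<Rightarrow> nat"
  where "enum A = inv_into A (rk A)"

lemma enum:
  assumes "finite A"
  shows "enum A ` {1..card A} = A" "strict_mono_on {1..card A} (enum A)" "a \<in> A \<Longrightarrow> enum A (rk A a) = a"
proof -
  have mono: "strict_mono_on A (rk A)" using assms by (rule strict_mono_on_rk)
  then have inj: "inj_on (rk A) A" by (rule strict_mono_on_imp_inj_on)
  note im = rk_image_eq[OF assms]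
  show "enum A ` {1..card A} = A"
    unfolding enum_def im[symmetric] using inj by (auto simp: image_image)
  show "a \<in> A \<Longrightarrow> enum A (rk A a) = a"
    unfolding enum_def by (rule inv_into_f_f[OF inj])
  show "strict_mono_on {1..card A} (enum A)"
  proof (rule strict_mono_onI)
    fix i j assume ij: "i \<in> {1..card A}" "j \<in> {1..card A}" "i < j"
    have mem: "enum A i \<in> A" "enum A j \<in> A" and rk: "rk A (enum A i) = i" "rk A (enum A j) = j"
      using ij im by (auto simp: enum_def inv_into_into f_inv_into_f)
    show "enum A i < enum A j"
    proof (rule ccontr)
      assume "\<not> enum A i < enum A j"
      then have "rk A (enum A j) \<le> rk A (enum A i)" using rk_mono[OF assms] by simp
      then show False using rk ij by simp
    qed
  qed
qed

text \<open>
  The words with a given pair of standardized factors are indexed by the alphabets of the left factor.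
\<close>

definition unstd :: "nat \<Rightarrow> nat list \<Rightarrow> nat list \<Rightarrow> nat set \<Rightarrow> nat list"
  where "unstd n \<sigma> \<tau> A = map (enum A) \<sigma> @ map (enum ({1..n} - A)) \<tau>"

lemma lookup_fq_comult_F:
  assumes \<alpha>: "\<alpha> \<in> mperms_of m (i + j)" and \<sigma>: "\<sigma> \<in> mperms_of m i" and \<tau>: "\<tau> \<in> mperms_of m j" and m: "m \<ge> 1"
  shows "lookup (fq_comult m (F \<alpha>)) (\<sigma>, \<tau>) =
    (if \<alpha> \<in> unstd (i + j) \<sigma> \<tau> ` {A. A \<subseteq> {1..i + j} \<and> card A = i} then 1 else (0 :: 'k::field))"
proof -
  let ?n = "i + j"
  let ?A = "{A. A \<subseteq> {1..?n} \<and> card A = i}"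
  have len: "length \<sigma> = m * i" using mperms_ofD(1)[OF \<sigma>] .
  \<comment> \<open>The length of the left factor is the cut position, so no pair of
    standardizations occurs twice and the coefficient is 0 or 1.\<close>
  have "inj_on (\<lambda>(u, v). (mstd m u, mstd m v)) (splits m \<alpha>)"
  proof (rule inj_onI, clarify)
    fix u v u' v' assume "(u, v) \<in> splits m \<alpha>" "(u', v') \<in> splits m \<alpha>" "mstd m u = mstd m u'"
    then have "length u = length u'" "u @ v = u' @ v'" by (auto simp: splits_def dest: arg_cong[of _ _ length])
    then show "u = u' \<and> v = v'" by simp
  qed
  then have "fq_comult m (F \<alpha>) = (\<Sum>p\<in>(\<lambda>(u, v). (mstd m u, mstd m v)) ` splits m \<alpha>. bas p :: _ \<Rightarrow>\<^sub>0 'k)"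
    unfolding fq_comult_F by (subst sum.reindex) (auto simp: case_prod_beta)
  then have "lookup (fq_comult m (F \<alpha>)) (\<sigma>, \<tau>) =
      (if (\<sigma>, \<tau>) \<in> (\<lambda>(u, v). (mstd m u, mstd m v)) ` splits m \<alpha> then 1 else (0 :: 'k))"
    by (simp only: lookup_sum_bas finite_imageI finite_splits)
  moreover have "(\<sigma>, \<tau>) \<in> (\<lambda>(u, v). (mstd m u, mstd m v)) ` splits m \<alpha> \<longleftrightarrow> \<alpha> \<in> unstd ?n \<sigma> \<tau> ` ?A"
  proof
    assume "(\<sigma>, \<tau>) \<in> (\<lambda>(u, v). (mstd m u, mstd m v)) ` splits m \<alpha>"
    then obtain u v where uv: "(u, v) \<in> splits m \<alpha>" "\<sigma> = mstd m u" "\<tau> = mstd m v" by auto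
    note s = splits_uniform[OF uv(1) uniform_mperm[OF \<alpha>]]
    have set: "set u \<union> set v = {1..?n}" using set_mperm[OF \<alpha> m] s(4) by auto
    have v: "set v = {1..?n} - set u" using set s(3) by auto
    have "card (set u) = i"
      using uniform_length[OF s(1)] len m uv(2) by simp
    moreover have "map (enum (set u)) \<sigma> = u" "map (enum (set v)) \<tau> = v"
      using enum(3) by (simp_all add: uv mstd_eq_map_rk[OF s(1) m] mstd_eq_map_rk[OF s(2) m] map_idI)
    then have "\<alpha> = unstd ?n \<sigma> \<tau> (set u)"
      unfolding unstd_def v[symmetric] using s(4) by simp
    ultimately show "\<alpha> \<in> unstd ?n \<sigma> \<tau> ` ?A"
      using set by (intro image_eqI[of _ _ "set u"]) auto
  next
    assume "\<alpha> \<in> unstd ?n \<sigma> \<tau> ` ?A"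
    then obtain A where A: "A \<subseteq> {1..?n}" "card A = i" "\<alpha> = unstd ?n \<sigma> \<tau> A" by auto
    have fin: "finite A" "finite ({1..?n} - A)" using A(1) finite_subset by auto
    have card: "card ({1..?n} - A) = j" using A by (simp add: card_Diff_subset fin)
    let ?u = "map (enum A) \<sigma>" and ?v = "map (enum ({1..?n} - A)) \<tau>"
    have mono: "strict_mono_on (set \<sigma>) (enum A)" "strict_mono_on (set \<tau>) (enum ({1..?n} - A))"
      using enum(2)[OF fin(1), unfolded A(2)] enum(2)[OF fin(2), unfolded card]
      by (simp_all only: set_mperm[OF \<sigma> m] set_mperm[OF \<tau> m])
    have un: "uniform m \<sigma>" "uniform m \<tau>" using \<sigma> \<tau> uniform_mperm by blast+
    have "mword m ?u" "mword m ?v"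
      using uniform_map[OF un(1) strict_mono_on_imp_inj_on[OF mono(1)]]
        uniform_map[OF un(2) strict_mono_on_imp_inj_on[OF mono(2)]] uniform_mword by blast+
    then have "(?u, ?v) \<in> splits m \<alpha>" by (simp add: splits_def A(3) unstd_def)
    moreover have "mstd m ?u = \<sigma>" "mstd m ?v = \<tau>"
      using mstd_map_strict_mono[OF un(1) m mono(1)] mstd_map_strict_mono[OF un(2) m mono(2)]
      by (simp_all add: mstd_mperm[OF \<sigma> m] mstd_mperm[OF \<tau> m])
    ultimately show "(\<sigma>, \<tau>) \<in> (\<lambda>(u, v). (mstd m u, mstd m v)) ` splits m \<alpha>"
      by (intro image_eqI[of _ _ "(?u, ?v)"]) auto
  qed
  ultimately show ?thesis by simp
qed

text \<open>The alphabet can be read off as the set of the first \<open>length \<sigma>\<close>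
  letters.\<close>

lemma inj_on_unstd:
  assumes "\<sigma> \<in> mperms_of m i" "m \<ge> 1"
  shows "inj_on (unstd n \<sigma> \<tau>) {A. A \<subseteq> {1..n} \<and> card A = i}"
proof (rule inj_onI)
  have set: "set (take (length \<sigma>) (unstd n \<sigma> \<tau> A)) = A" if "A \<in> {A. A \<subseteq> {1..n} \<and> card A = i}" for A
  proof -
    have "finite A" using that finite_subset by auto
    then show ?thesis using that enum(1)[of A] set_mperm[OF assms] by (simp add: unstd_def)
  qed
  fix A B assume A: "A \<in> {A. A \<subseteq> {1..n} \<and> card A = i}" and B: "B \<in> {A. A \<subseteq> {1..n} \<and> card A = i}"
    and eq: "unstd n \<sigma> \<tau> A = unstd n \<sigma> \<tau> B"
  show "A = B" using set[OF A] set[OF B] unfolding eq by simp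
qed

lemma lookup_fq_comult:
  fixes x :: "nat list \<Rightarrow>\<^sub>0 'k::field"
  assumes x: "keys x \<subseteq> mperms_of m (i + j)"
    and \<sigma>: "\<sigma> \<in> mperms_of m i" and \<tau>: "\<tau> \<in> mperms_of m j" and m: "m \<ge> 1"
  shows "lookup (fq_comult m x) (\<sigma>, \<tau>) =
    (\<Sum>A\<in>{A. A \<subseteq> {1..i + j} \<and> card A = i}. lookup x (unstd (i + j) \<sigma> \<tau> A))"
proof -
  let ?A = "{A. A \<subseteq> {1..i + j} \<and> card A = i}"
  let ?D = "unstd (i + j) \<sigma> \<tau> ` ?A"
  have fin: "finite ?A" by simp
  have "lookup (fq_comult m x) (\<sigma>, \<tau>) =
      (\<Sum>\<alpha>\<in>keys x. lookup x \<alpha> * lookup (fq_comult m (F \<alpha>)) (\<sigma>, \<tau>))"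
    by (subst linear_expand[OF linear_fq_comult]) (simp only: lookup_lin_ext)
  also have "\<dots> = (\<Sum>\<alpha>\<in>keys x. if \<alpha> \<in> ?D then lookup x \<alpha> else 0)"
  proof (rule sum.cong[OF refl])
    fix \<alpha> assume "\<alpha> \<in> keys x"
    then have "\<alpha> \<in> mperms_of m (i + j)" using x by blast
    then show "lookup x \<alpha> * lookup (fq_comult m (F \<alpha>)) (\<sigma>, \<tau>) =
        (if \<alpha> \<in> ?D then lookup x \<alpha> else 0)"
      by (simp only: lookup_fq_comult_F[OF _ \<sigma> \<tau> m] split: if_split) simp
  qed
  also have "\<dots> = (\<Sum>\<alpha>\<in>?D. lookup x \<alpha>)"
    using fin by (subst sum.inter_restrict[symmetric])
      (auto intro!: sum.mono_neutral_left simp: in_keys_iff)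
  also have "\<dots> = (\<Sum>A\<in>?A. lookup x (unstd (i + j) \<sigma> \<tau> A))"
    by (subst sum.reindex[OF inj_on_unstd[OF \<sigma> m]]) simp
  finally show ?thesis .
qed

text \<open>For a fixed alphabet both relabellings are increasing, and the congruence is compatible
  with increasing relabelling and with concatenation.\<close>

lemma sylvester_unstd:
  assumes "\<sigma> \<in> mperms_of m i" "\<tau> \<in> mperms_of m j" "m \<ge> 1" "sylvester \<sigma> \<sigma>'" "sylvester \<tau> \<tau>'"
    and "A \<subseteq> {1..i + j}" "card A = i"
  shows "sylvester (unstd (i + j) \<sigma> \<tau> A) (unstd (i + j) \<sigma>' \<tau>' A)"
proof -
  have fin: "finite A" "finite ({1..i + j} - A)" using assms(6) finite_subset by auto
  have "card ({1..i + j} - A) = j" using assms(6,7) by (simp add: card_Diff_subset fin)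
  then show ?thesis
    unfolding unstd_def using enum(2)[OF fin(1)] enum(2)[OF fin(2)] assms
    by (intro sylvester_append sylvester_map) (simp_all add: set_mperm[OF assms(1,3)] set_mperm[OF assms(2,3)])
qed

text \<open>Congruent words have the same content, so either both are \<open>m\<close>-permutations
  or both coefficients are 0.\<close>

lemma sylv_invariant_sylvester:
  assumes "sylv_invariant m x" "sylvester u v" "m \<ge> 1"
  shows "lookup x u = lookup x v"
proof (cases "u \<in> mperms m")
  case True
  then have v: "v \<in> mperms m"
    using sylvester_mset[OF assms(2)] mset_mperm_cong unfolding mperms_def by fastforce
  show ?thesis
    using sylv_invariantD[OF assms(1) True v] sylvester_iff_sylv[OF True v assms(3)] assms(2) by blast
next
  case False
  then have "v \<notin> mperms m"
    using sylvester_mset[OF assms(2)] mset_mperm_cong unfolding mperms_def by fastforce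
  then have "u \<notin> keys x" "v \<notin> keys x"
    using False assms(1) unfolding sylv_invariant_def by blast+
  then show ?thesis by (simp add: in_keys_iff)
qed

lemma keys_fq_comult:
  fixes x :: "nat list \<Rightarrow>\<^sub>0 'k::field"
  assumes "keys x \<subseteq> mperms_of m n" "m \<ge> 1" "(\<sigma>, \<tau>) \<in> keys (fq_comult m x)"
  shows "\<exists>i j. n = i + j \<and> \<sigma> \<in> mperms_of m i \<and> \<tau> \<in> mperms_of m j"
proof -
  have "(\<sigma>, \<tau>) \<in> keys (lin_ext (\<lambda>a. fq_comult m (F a)) x)"
    using assms(3) by (subst (asm) linear_expand[OF linear_fq_comult])
  then have "(\<sigma>, \<tau>) \<in> (\<Union>a\<in>keys x. keys (fq_comult m (F a :: _ \<Rightarrow>\<^sub>0 'k)))"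
    by (rule subsetD[OF keys_lin_ext])
  then obtain \<alpha> where \<alpha>: "\<alpha> \<in> keys x"
    "(\<sigma>, \<tau>) \<in> keys (fq_comult m (F \<alpha> :: _ \<Rightarrow>\<^sub>0 'k))"
    by (elim UN_E)
  then have mp: "\<alpha> \<in> mperms_of m n" using assms(1) by blast
  have "(\<Sum>s\<in>splits m \<alpha>. lookup (bas (mstd m (fst s), mstd m (snd s)) :: _ \<Rightarrow>\<^sub>0 'k) (\<sigma>, \<tau>)) \<noteq> 0"
    using \<alpha>(2) by (simp add: in_keys_iff fq_comult_F lookup_sum case_prod_beta)
  then obtain s where s: "s \<in> splits m \<alpha>"
    and "lookup (bas (mstd m (fst s), mstd m (snd s)) :: _ \<Rightarrow>\<^sub>0 'k) (\<sigma>, \<tau>) \<noteq> 0"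
    by (rule sum.not_neutral_contains_not_neutral)
  then have \<sigma>\<tau>: "\<sigma> = mstd m (fst s)" "\<tau> = mstd m (snd s)"
    by (auto simp: lookup_single when_def split: if_splits)
  obtain u v where uv: "s = (u, v)" "(u, v) \<in> splits m \<alpha>" using s by (cases s) auto
  note su = splits_uniform[OF uv(2) uniform_mperm[OF mp]]
  have "m * n = m * card (set u) + m * card (set v)"
    using mperms_ofD(1)[OF mp] su(4) uniform_length[OF su(1)] uniform_length[OF su(2)] by simp
  then have "n = card (set u) + card (set v)" using assms(2) by (simp add: distrib_left[symmetric])
  moreover have "mstd m u \<in> mperms_of m (card (set u))" "mstd m v \<in> mperms_of m (card (set v))"
    using mstd_mperms_of[OF su(1) assms(2)] mstd_mperms_of[OF su(2) assms(2)]
      uniform_length[OF su(1)] uniform_length[OF su(2)] assms(2) by simp_all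
  ultimately show ?thesis using \<sigma>\<tau> uv by auto
qed

definition tree_pairs :: "nat \<Rightarrow> nat \<Rightarrow> (ptree \<times> ptree) set"
  where "tree_pairs m n = {(U, V). ary (Suc m) U \<and> ary (Suc m) V \<and> nodes U + nodes V = n}"

lemma finite_tree_pairs: "finite (tree_pairs m n)"
proof (rule finite_subset)
  show "tree_pairs m n \<subseteq> (\<Union>i\<le>n. {T. ary (Suc m) T \<and> nodes T = i}) \<times> (\<Union>i\<le>n. {T. ary (Suc m) T \<and> nodes T = i})"
    by (auto simp: tree_pairs_def)
qed (simp add: finite_ary_trees)

text \<open>In \<open>lookup_fq_comult\<close> the range of alphabets depends only on the degrees,
  and replacing the two factors by congruent words moves each word in the sum within its class. So a
  coefficient of the coproduct depends only on the two trees and may be taken at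
  representatives.\<close>

lemma fq_comult_pbt_deg:
  fixes x :: "nat list \<Rightarrow>\<^sub>0 'k::field"
  assumes "x \<in> pbt_deg m n" "m \<ge> 1"
  shows "fq_comult m x = (\<Sum>(U, V)\<in>tree_pairs m n.
    scl (lookup (fq_comult m x) (rep m U, rep m V)) (tens (P m U) (P m V)))"
proof (rule poly_mapping_eqI)
  fix p :: "nat list \<times> nat list"
  obtain \<sigma> \<tau> where p: "p = (\<sigma>, \<tau>)" by (cases p)
  have inv: "sylv_invariant m x" and keys: "keys x \<subseteq> mperms_of m n"
    using assms by (auto simp: pbt_deg_eq)
  let ?c = "\<lambda>U V. lookup (fq_comult m x) (rep m U, rep m V)"
  let ?r = "\<Sum>(U, V)\<in>tree_pairs m n. scl (?c U V) (tens (P m U) (P m V))"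
  have r: "lookup ?r (\<sigma>, \<tau>) = (\<Sum>q\<in>tree_pairs m n.
      if \<sigma> \<in> mperms m \<and> \<tau> \<in> mperms m \<and> q = (sylv m \<sigma>, sylv m \<tau>) then ?c (fst q) (snd q) else 0)"
    unfolding lookup_sum by (intro sum.cong refl) (auto simp: lookup_P[OF assms(2)] split: if_splits)
  show "lookup (fq_comult m x) p = lookup ?r p"
  proof (cases "\<exists>i j. n = i + j \<and> \<sigma> \<in> mperms_of m i \<and> \<tau> \<in> mperms_of m j")
    case True
    then obtain i j where ij: "n = i + j" "\<sigma> \<in> mperms_of m i" "\<tau> \<in> mperms_of m j" by blast
    then have mp: "\<sigma> \<in> mperms m" "\<tau> \<in> mperms m" by (auto simp: mperms_def)
    let ?U = "sylv m \<sigma>" and ?V = "sylv m \<tau>"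
    have UV: "?U \<in> ary_trees m" "?V \<in> ary_trees m" "nodes ?U = i" "nodes ?V = j"
      using sylv_in_ary[OF mp(1) assms(2)] sylv_in_ary[OF mp(2) assms(2)]
        nodes_sylv[OF ij(2) assms(2)] nodes_sylv[OF ij(3) assms(2)] by auto
    note rU = rep[OF UV(1) assms(2), unfolded UV(3)] and rV = rep[OF UV(2) assms(2), unfolded UV(4)]
    have syl: "sylvester (rep m ?U) \<sigma>" "sylvester (rep m ?V) \<tau>"
      using sylvester_iff_sylv[OF rU(3) mp(1) assms(2)] sylvester_iff_sylv[OF rV(3) mp(2) assms(2)] rU(2) rV(2)
      by simp_all
    have "?c ?U ?V = lookup (fq_comult m x) (\<sigma>, \<tau>)"
      unfolding lookup_fq_comult[OF keys[unfolded ij(1)] rU(1) rV(1) assms(2)]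
        lookup_fq_comult[OF keys[unfolded ij(1)] ij(2,3) assms(2)]
      using sylv_invariant_sylvester[OF inv sylvester_unstd[OF rU(1) rV(1) assms(2) syl] assms(2)]
      by (intro sum.cong refl) blast
    moreover have "(?U, ?V) \<in> tree_pairs m n" using UV ij(1) by (simp add: tree_pairs_def)
    ultimately show ?thesis
      unfolding p r using mp finite_tree_pairs[of m n] by simp
  next
    case False
    then have "(\<sigma>, \<tau>) \<notin> keys (fq_comult m x)"
      using keys_fq_comult[OF keys assms(2)] by blast
    moreover have "\<not> (\<sigma> \<in> mperms m \<and> \<tau> \<in> mperms m \<and> q = (sylv m \<sigma>, sylv m \<tau>))" if "q \<in> tree_pairs m n" for q
    proof
      assume *: "\<sigma> \<in> mperms m \<and> \<tau> \<in> mperms m \<and> q = (sylv m \<sigma>, sylv m \<tau>)"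
      then obtain i j where ij: "\<sigma> \<in> mperms_of m i" "\<tau> \<in> mperms_of m j" by (auto simp: mperms_def)
      then have "n = i + j"
        using that * nodes_sylv[OF ij(1) assms(2)] nodes_sylv[OF ij(2) assms(2)] by (auto simp: tree_pairs_def)
      then show False using False ij by blast
    qed
    then have "lookup ?r (\<sigma>, \<tau>) = 0"
      unfolding r by (intro sum.neutral) auto
    ultimately show ?thesis
      unfolding p by (simp add: in_keys_iff)
  qed
qed

lemma fq_comult_pbt_deg_span:
  assumes "x \<in> pbt_deg m n" "m \<ge> 1"
  shows "fq_comult m x \<in> pm.span (\<Union>i\<le>n. {tens y z | y z. y \<in> pbt_deg m i \<and> z \<in> pbt_deg m (n - i)})"
proof -
  have gen: "tens (P m U) (P m V) \<in> (\<Union>i\<le>n. {tens y z | y z. y \<in> pbt_deg m i \<and> z \<in> pbt_deg m (n - i)})"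
    if "(U, V) \<in> tree_pairs m n" for U V
  proof -
    have "nodes U \<le> n" "P m U \<in> pbt_deg m (nodes U)" "P m V \<in> pbt_deg m (n - nodes U)"
      using that P_pbt_deg[of U m] P_pbt_deg[of V m] assms(2) by (auto simp: tree_pairs_def)
    then show ?thesis by blast
  qed
  show ?thesis
  proof (subst fq_comult_pbt_deg[OF assms], rule pm.span_sum)
    fix q assume "q \<in> tree_pairs m n"
    then show "(case q of (U, V) \<Rightarrow> scl (lookup (fq_comult m x) (rep m U, rep m V))
        (tens (P m U) (P m V))) \<in> pm.span (\<Union>i\<le>n. {tens y z | y z. y \<in> pbt_deg m i \<and> z \<in> pbt_deg m (n - i)})"
      by (cases q) (simp only: prod.case, intro pm.span_scale pm.span_base gen)
  qed
qed

section \<open>The Hopf algebra of \<open>(m+1)\<close>-ary trees\<close>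

lemma P_Tip: "m \<ge> 1 \<Longrightarrow> P m Tip = F []"
proof -
  assume m: "m \<ge> 1"
  have "sylv m [] = Tip"
    by (rule sylv_eqI) (use m in auto)
  then have "{\<alpha> \<in> mperms m. sylv m \<alpha> = Tip} = {[]}"
    unfolding mperms_conv_sylv[OF m] by auto
  then show ?thesis by (simp add: P_def)
qed

lemma nodes_eq_0: "nodes T = 0 \<longleftrightarrow> T = Tip"
  by (cases T) auto

text \<open>The recursion of \<open>antiL\<close> over words is replaced by one over trees: in the
  coproduct of \<open>x\<close> the terms with right factor 1 add up to \<open>x\<close> tensor 1,
  and the antipode identity gives \<open>fq_antipode m x\<close> in terms of products of antipodes
  of smaller degree with some \<open>P m V\<close>.\<close>

lemma fq_antipode_pbt_deg:
  "m \<ge> 1 \<Longrightarrow> x \<in> pbt_deg m n \<Longrightarrow> fq_antipode m x \<in> (pbt_deg m n :: (_ \<Rightarrow>\<^sub>0 'k::field) set)"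
proof (induction n arbitrary: x rule: less_induct)
  case (less n)
  note m = less.prems(1)
  show ?case
  proof (cases "n = 0")
    case True
    have "x = (\<Sum>T\<in>{T. ary (Suc m) T \<and> nodes T = 0}. scl (lookup x (rep m T)) (P m T))"
      using pbt_deg_expand[OF less.prems(2) m] True by simp
    also have "{T. ary (Suc m) T \<and> nodes T = 0} = {Tip}" by (auto simp: nodes_eq_0)
    finally have x: "x = scl (lookup x (rep m Tip)) (F [])" by (simp add: P_Tip[OF m])
    have "fq_antipode m (scl c (F [])) = scl c (F [])" for c
      by (simp add: linear_sclD[OF linear_fq_antipode]) (simp add: fq_antipode_def)
    then have "fq_antipode m x = x" using x by metis
    then show ?thesis using less.prems by simp
  next
    case False
    define c where "c q = lookup (fq_comult m x) (rep m (fst q), rep m (snd q))" for q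
    let ?X = "tree_pairs m n"
    let ?Y = "{q \<in> ?X. snd q \<noteq> Tip}" and ?Z = "{q \<in> ?X. snd q = Tip}"
    have xA: "x \<in> fqsym m"
      using less.prems by (auto simp: pbt_deg_eq fqsym_eq sylv_invariant_def)
    have "fq_comult m x = (\<Sum>q\<in>?X. scl (c q) (tens (P m (fst q)) (P m (snd q))))"
      by (rule trans[OF fq_comult_pbt_deg[OF less.prems(2) m]]) (auto simp: c_def intro!: sum.cong)
    also have "\<dots> = (\<Sum>q\<in>?Y \<union> ?Z. scl (c q) (tens (P m (fst q)) (P m (snd q))))"
      by (rule sum.cong) auto
    also have "\<dots> = (\<Sum>q\<in>?Y. scl (c q) (tens (P m (fst q)) (P m (snd q)))) +
        (\<Sum>q\<in>?Z. scl (c q) (tens (P m (fst q)) (F [])))"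
      using finite_tree_pairs[of m n] by (subst sum.union_disjoint) (auto simp: P_Tip[OF m])
    also have "(\<Sum>q\<in>?Z. scl (c q) (tens (P m (fst q)) (F []))) = tens (\<Sum>q\<in>?Z. scl (c q) (P m (fst q))) (F [])"
      by (simp add: tens_sum_left tens_scl_left)
    \<comment> \<open>The terms with right factor 1 are collected in \<open>x'\<close>; the counit
      axiom will identify it with \<open>x\<close>, since the counit of \<open>P m V\<close>
      vanishes for non-empty \<open>V\<close>.\<close>
    finally obtain x' where comult:
      "fq_comult m x = (\<Sum>q\<in>?Y. scl (c q) (tens (P m (fst q)) (P m (snd q)))) + tens x' (F [])" by blast
    have counit_P: "fq_counit (P m V :: _ \<Rightarrow>\<^sub>0 'k) = 0" if "V \<noteq> Tip" "ary (Suc m) V" for V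
    proof -
      have "[] \<notin> keys (P m V :: _ \<Rightarrow>\<^sub>0 'k)"
        using that keys_P[OF m, of V] mperms_ofD(1)[of "[]" m "nodes V"] m nodes_eq_0[of V] by auto
      then show ?thesis by (simp add: fq_counit_def in_keys_iff)
    qed
    let ?E = "lin_ext (\<lambda>(a, b). scl (fq_counit (bas b)) (bas a)) :: _ \<Rightarrow> _ \<Rightarrow>\<^sub>0 'k"
    have counit_expand: "fq_counit z = (\<Sum>b\<in>keys z. lookup z b * fq_counit (bas b))" for z :: "_ \<Rightarrow>\<^sub>0 'k"
      by (auto simp: fq_counit_F if_distrib[of "(*) _"] in_keys_iff fq_counit_def[of z] cong: if_cong)
    have E: "?E (tens y z) = scl (fq_counit z) y" for y z :: "_ \<Rightarrow>\<^sub>0 'k"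
    proof -
      have "?E (tens y z) = lin_ext (\<lambda>a. scl (fq_counit z) (bas a)) y"
        by (simp add: lin_ext_tens) (simp add: lin_ext_def counit_expand[of z] pm.scale_sum_left)
      then show ?thesis by (simp add: lin_ext_fun_scl)
    qed
    have Y: "ary (Suc m) (fst q)" "ary (Suc m) (snd q)" "nodes (fst q) < n" "snd q \<noteq> Tip"
      "nodes (fst q) + nodes (snd q) = n" if "q \<in> ?Y" for q
      using that nodes_eq_0[of "snd q"] by (auto simp: tree_pairs_def)
    have "x = ?E (fq_comult m x)"
      by (rule fq_counit_right[OF xA m, symmetric])
    also have "\<dots> = (\<Sum>q\<in>?Y. scl (c q) (scl (fq_counit (P m (snd q) :: _ \<Rightarrow>\<^sub>0 'k)) (P m (fst q)))) + x'"
      unfolding comult lin_ext_add lin_ext_sum lin_ext_scl E by (simp add: fq_counit_F)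
    also have "(\<Sum>q\<in>?Y. scl (c q) (scl (fq_counit (P m (snd q) :: _ \<Rightarrow>\<^sub>0 'k)) (P m (fst q)))) = 0"
      by (rule sum.neutral) (simp add: counit_P[OF Y(4,2)])
    finally have x': "x' = x" by simp
    let ?M = "lin_ext (\<lambda>(a, b). fq_mult m (fq_antipode m (bas a)) (bas b)) :: _ \<Rightarrow> _ \<Rightarrow>\<^sub>0 'k"
    have M: "?M (tens y z) = fq_mult m (fq_antipode m y) z" for y z :: "_ \<Rightarrow>\<^sub>0 'k"
    proof -
      have "?M (tens y z) = lin_ext (\<lambda>a. fq_mult m (fq_antipode m (F a)) z) y"
        unfolding lin_ext_tens
        by (rule lin_ext_cong, unfold prod.case) (rule linear_expand[OF linear_fq_mult_right, symmetric])
      also have "\<dots> = fq_mult m (fq_antipode m y) z"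
        by (rule linear_expand[OF linear_comp[OF linear_fq_antipode linear_fq_mult_left], symmetric])
      finally show ?thesis .
    qed
    have "x \<in> pbt_deg m n" by fact
    then have "[] \<notin> keys x"
      using mperms_ofD(1)[of "[]" m n] m False by (auto simp: pbt_deg_eq)
    \<comment> \<open>In positive degree the counit of \<open>x\<close> is 0, so the antipode
      identity can be solved for the term coming from \<open>x\<close> tensor 1.\<close>
    then have "0 = ?M (fq_comult m x)"
      using fq_antipode(1)[OF xA m] by (simp add: fq_counit_def in_keys_iff)
    also have "\<dots> = (\<Sum>q\<in>?Y. scl (c q) (fq_mult m (fq_antipode m (P m (fst q))) (P m (snd q)))) + fq_antipode m x"
      by (simp add: comult lin_ext_add lin_ext_sum lin_ext_scl M x' fq_mult_one_right)
    finally have S: "fq_antipode m x = - (\<Sum>q\<in>?Y. scl (c q) (fq_mult m (fq_antipode m (P m (fst q))) (P m (snd q))))"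
      by (simp add: eq_neg_iff_add_eq_0 add.commute)
    have "fq_mult m (fq_antipode m (P m (fst q))) (P m (snd q) :: _ \<Rightarrow>\<^sub>0 'k) \<in> pbt_deg m n" if "q \<in> ?Y" for q
    proof -
      have "(P m (fst q) :: _ \<Rightarrow>\<^sub>0 'k) \<in> pbt_deg m (nodes (fst q))"
        "(P m (snd q) :: _ \<Rightarrow>\<^sub>0 'k) \<in> pbt_deg m (nodes (snd q))"
        by (rule P_pbt_deg[OF _ m], simp add: Y(1,2)[OF that])+
      then show ?thesis
        using pbt_deg_mult[OF less.IH[OF Y(3)[OF that] m] _ m] Y(5)[OF that] by metis
    qed
    then show ?thesis
      unfolding S by (intro pm.subspace_neg pm.subspace_sum pm.subspace_scale subspace_pbt_deg)
  qed
qed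

lemma pbt_conv_span_deg:
  assumes "m \<ge> 1"
  shows "(pbt m :: (_ \<Rightarrow>\<^sub>0 'k::field) set) = pm.span (\<Union>n. pbt_deg m n)"
proof
  show "pbt m \<subseteq> pm.span (\<Union>n. pbt_deg m n :: (_ \<Rightarrow>\<^sub>0 'k) set)"
    unfolding pbt_def[of m] using P_pbt_deg[OF _ assms] by (intro pm.span_mono) blast
  show "pm.span (\<Union>n. pbt_deg m n :: (_ \<Rightarrow>\<^sub>0 'k) set) \<subseteq> pbt m"
  proof (rule pm.span_minimal)
    show "(\<Union>n. pbt_deg m n :: (_ \<Rightarrow>\<^sub>0 'k) set) \<subseteq> pbt m" by (auto simp: pbt_deg_def)
    show "pm.subspace (pbt m :: (_ \<Rightarrow>\<^sub>0 'k) set)" unfolding pbt_def by (rule pm.subspace_span)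
  qed
qed

lemma pbt_deg_direct:
  fixes h :: "nat \<Rightarrow> nat list \<Rightarrow>\<^sub>0 'k::field"
  assumes "m \<ge> 1" "finite N" "\<And>n. n \<in> N \<Longrightarrow> h n \<in> pbt_deg m n" "(\<Sum>n\<in>N. h n) = 0" "n \<in> N"
  shows "h n = 0"
proof (rule poly_mapping_eqI)
  fix w
  show "lookup (h n) w = lookup 0 w"
  proof (cases "w \<in> mperms_of m n")
    case True
    have "lookup (h k) w = 0" if "k \<in> N - {n}" for k
    proof -
      have "w \<notin> mperms_of m k" using mperms_of_inj[OF True _ assms(1)] that by auto
      then have "w \<notin> keys (h k)" using assms(3)[of k] that assms(1) by (auto simp: pbt_deg_eq)
      then show ?thesis by (simp add: in_keys_iff)
    qed
    then have "lookup (\<Sum>n\<in>N. h n) w = lookup (h n) w"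
      using assms(2,5) by (simp add: lookup_sum lookup_add sum.remove[of N n])
    then show ?thesis using assms(4) by simp
  next
    case False
    then have "w \<notin> keys (h n)" using assms(3)[OF assms(5)] assms(1) by (auto simp: pbt_deg_eq)
    then show ?thesis by (simp add: in_keys_iff)
  qed
qed

lemma linear_fq_counit: "Vector_Spaces.linear scl (*) (fq_counit :: _ \<Rightarrow> 'k::field)"
  unfolding module_hom_iff_linear[symmetric] module_hom_iff
  by (auto simp: fq_counit_def lookup_add pm.module_axioms intro!: module.intro)
    (simp_all add: algebra_simps)

text \<open>The numbered cases follow the order of the locale assumptions. The substance specific to
  \<open>pbt m\<close> lies in cases 8, 10 and 22: closure of the graded components under product,
  coproduct and antipode.\<close>

lemma graded_hopf_algebra_pbt:
  assumes m: "m \<ge> 1"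
  shows "graded_hopf_algebra (pbt m :: (nat list \<Rightarrow>\<^sub>0 'k::field) set) (pbt_deg m)
    (fq_mult m) (F []) (fq_comult m) fq_counit"
proof (rule graded_hopf_algebra.intro, goal_cases)
  case (11 x n)
  then have "[] \<notin> keys x"
    using mperms_ofD(1)[of "[]" m n] m by (auto simp: pbt_deg_eq)
  then show ?case by (simp add: fq_counit_def in_keys_iff)
next
  case 9
  show ?case using P_pbt_deg[of Tip m] m by (simp add: P_Tip[OF m])
next
  case 22
  have "fq_antipode m ` pbt_deg m n \<subseteq> (pbt_deg m n :: (_ \<Rightarrow>\<^sub>0 'k) set)" for n
    using fq_antipode_pbt_deg[OF m] by blast
  then show ?case
    by (intro exI[of _ "fq_antipode m"] conjI allI ballI linear_fq_antipode
        fq_antipode[OF pbt_subset_fqsym[OF m] m])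
next
  case 6
  show ?case by (rule pbt_conv_span_deg[OF m])
next
  case (7 N h n)
  then show ?case by (rule pbt_deg_direct[OF m])
next
  case (8 x p y q)
  then show ?case by (rule pbt_deg_mult[OF _ _ m])
next
  case (10 x n)
  then show ?case by (rule fq_comult_pbt_deg_span[OF _ m])
next
  case (12 x y z)
  then show ?case by (intro fq_mult_assoc pbt_subset_fqsym m)
next
  case (15 x)
  then show ?case by (intro fq_coassoc pbt_subset_fqsym m)
next
  case (16 x)
  then show ?case by (intro fq_counit_left pbt_subset_fqsym m)
next
  case (17 x)
  then show ?case by (intro fq_counit_right pbt_subset_fqsym m)
next
  case (18 x y)
  then show ?case by (intro fq_comult_mult pbt_subset_fqsym m)
qed (simp_all add: linear_fq_mult_left linear_fq_mult_right linear_fq_comult linear_fq_counit subspace_pbt_deg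
    fq_mult_one_left fq_mult_one_right fq_comult_one fq_counit_mult fq_counit_F del: tens_bas)

section \<open>Graded duals\<close>

lemma sum_scl_bas: "(\<Sum>a\<in>keys x. scl (lookup x a) (bas a)) = x"
  by (rule lin_ext_bas_id[unfolded lin_ext_def])

lemma independent_bas: "pm.independent (bas ` B :: ('a \<Rightarrow>\<^sub>0 'k::field) set)"
  unfolding pm.independent_explicit_module
proof (intro allI impI)
  fix X :: "('a \<Rightarrow>\<^sub>0 'k) set" and c v
  assume X: "finite X" "X \<subseteq> bas ` B" and 0: "(\<Sum>v\<in>X. scl (c v) v) = 0" and v: "v \<in> X"
  obtain Y where Y: "finite Y" "X = bas ` Y"
    using X by (meson finite_subset_image)
  obtain a where a: "a \<in> Y" "v = bas a" using v Y by auto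
  have "inj_on (bas :: 'a \<Rightarrow> 'a \<Rightarrow>\<^sub>0 'k) Y"
    by (rule inj_onI) (metis keys_single singleton_inject zero_neq_one)
  then have "(\<Sum>b\<in>Y. scl (c (bas b)) (bas b)) = 0"
    using 0 by (simp add: Y(2) sum.reindex)
  then have "lookup (\<Sum>b\<in>Y. scl (c (bas b)) (bas b)) a = 0" by simp
  then show "c v = 0"
    using Y(1) a by (simp add: lookup_sum lookup_single when_def if_distrib[of "(*) _"] cong: if_cong)
qed

text \<open>A coordinate functional is recognised by exhibiting a linear \<psi> on the ambient space
  with the right values on \<open>B\<close>; this turns \<open>pm.representation\<close> into an
  explicit coefficient.\<close>

lemma coord_eq:
  assumes B: "pm.independent B" "b \<in> B" and x: "x \<in> pm.span B"
    and add: "\<And>x y. \<psi> (x + y) = \<psi> x + \<psi> y" and scl: "\<And>c x. \<psi> (scl c x) = c * \<psi> x"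
    and \<psi>: "\<And>b'. b' \<in> B \<Longrightarrow> \<psi> b' = (if b' = b then 1 else (0 :: 'k::field))"
  shows "coord B b x = \<psi> x"
proof -
  have "x \<in> {x \<in> pm.span B. coord B b x = \<psi> x}"
    using x
  proof (rule pm.span_induct)
    have "\<psi> 0 = 0" using scl[of 0 0] by simp
    then show "pm.subspace {x. x \<in> {x \<in> pm.span B. coord B b x = \<psi> x}}"
      by (auto simp: pm.subspace_def coord_def pm.representation_zero pm.span_zero pm.span_add pm.span_scale
          pm.representation_add[OF B(1)] pm.representation_scale[OF B(1)] add scl)
  next
    fix b' assume b': "b' \<in> B"
    then show "b' \<in> {x \<in> pm.span B. coord B b x = \<psi> x}"
      using B(2) \<psi>[OF b'] by (auto simp: coord_def pm.representation_basis[OF B(1)] pm.span_base)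
  qed
  then show ?thesis by simp
qed

lemma coord_outside: "x \<notin> pm.span B \<Longrightarrow> coord B b x = 0"
  by (simp add: coord_def pm.representation_def)

lemma Q_eq:
  assumes "T \<in> ary_trees m" "m \<ge> 1"
  shows "Q m T = (\<lambda>x :: _ \<Rightarrow>\<^sub>0 'k::field. if x \<in> pbt m then lookup x (rep m T) else 0)"
proof
  fix x :: "nat list \<Rightarrow>\<^sub>0 'k"
  have "coord (P m ` ary_trees m) (P m T) x = lookup x (rep m T)" if "x \<in> pbt m"
  proof (rule coord_eq[OF independent_P[OF assms(2)]])
    fix b assume "b \<in> (P m ` ary_trees m :: (_ \<Rightarrow>\<^sub>0 'k) set)"
    then obtain S where S: "S \<in> ary_trees m" "b = P m S" by blast
    have "b = P m T \<longleftrightarrow> S = T"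
      unfolding S(2) by (rule inj_on_eq_iff[OF inj_on_P[OF assms(2)] S(1) assms(1)])
    then show "lookup b (rep m T) = (if b = P m T then 1 else 0)"
      unfolding S(2) lookup_P_rep[OF assms] by auto
  qed (use assms that in \<open>auto simp: pbt_def lookup_add\<close>)
  then show "Q m T x = (if x \<in> pbt m then lookup x (rep m T) else 0)"
    by (simp add: Q_def pbt_def coord_outside)
qed

lemma G_eq:
  assumes "\<alpha> \<in> mperms m"
  shows "G m \<alpha> = (\<lambda>x :: _ \<Rightarrow>\<^sub>0 'k::field. if x \<in> fqsym m then lookup x \<alpha> else 0)"
proof
  fix x :: "nat list \<Rightarrow>\<^sub>0 'k"
  have "coord (F ` mperms m) (F \<alpha>) x = lookup x \<alpha>" if "x \<in> fqsym m"
  proof (rule coord_eq[OF independent_bas])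
    fix b assume "b \<in> (F ` mperms m :: (_ \<Rightarrow>\<^sub>0 'k) set)"
    then obtain \<beta> where "b = F \<beta>" by blast
    then show "lookup b \<alpha> = (if b = F \<alpha> then 1 else 0)"
      by (auto simp: lookup_single when_def dest: arg_cong[of _ _ keys])
  qed (use assms that in \<open>auto simp: fqsym_def lookup_add\<close>)
  then show "G m \<alpha> x = (if x \<in> fqsym m then lookup x \<alpha> else 0)"
    by (simp add: G_def fqsym_def coord_outside)
qed

lemma sum_fun_apply: "(\<Sum>i\<in>I. f i) x = (\<Sum>i\<in>I. f i x)"
  by (induction I rule: infinite_finite_induct) auto

lemma graded_dualD:
  assumes "f \<in> graded_dual A H"
  shows "x \<notin> A \<Longrightarrow> f x = 0" "x \<in> A \<Longrightarrow> y \<in> A \<Longrightarrow> f (x + y) = f x + f y"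
    "x \<in> A \<Longrightarrow> f (scl c x) = c * f x" "\<exists>N. \<forall>n\<ge>N. \<forall>x\<in>H n. f x = 0"
  using assms by (auto simp: graded_dual_def)

lemma subspace_graded_dual: "fn.subspace (graded_dual A H)"
proof (rule fn.subspaceI)
  show "0 \<in> graded_dual A H" by (simp add: graded_dual_def)
next
  fix f g assume f: "f \<in> graded_dual A H" and g: "g \<in> graded_dual A H"
  obtain M N where "\<forall>n\<ge>M. \<forall>x\<in>H n. f x = 0" "\<forall>n\<ge>N. \<forall>x\<in>H n. g x = 0"
    using graded_dualD(4)[OF f] graded_dualD(4)[OF g] by blast
  then have "\<forall>n\<ge>max M N. \<forall>x\<in>H n. (f + g) x = 0" by auto
  then have ex: "\<exists>N. \<forall>n\<ge>N. \<forall>x\<in>H n. (f + g) x = 0" by blast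
  show "f + g \<in> graded_dual A H"
    unfolding graded_dual_def mem_Collect_eq
    by (intro conjI allI ballI impI ex) (simp_all add: graded_dualD[OF f] graded_dualD[OF g] algebra_simps)
next
  fix c f assume f: "f \<in> graded_dual A H"
  have ex: "\<exists>N. \<forall>n\<ge>N. \<forall>x\<in>H n. c * f x = 0"
    using graded_dualD(4)[OF f] by (metis mult_zero_right)
  show "fscl c f \<in> graded_dual A H"
    unfolding graded_dual_def mem_Collect_eq fscl_def
    by (intro conjI allI ballI impI ex) (simp_all add: graded_dualD[OF f] algebra_simps)
qed

lemma graded_dual_sum:
  assumes "f \<in> graded_dual A H" "pm.subspace A" "\<And>i. i \<in> I \<Longrightarrow> v i \<in> A"
  shows "f (\<Sum>i\<in>I. scl (c i) (v i)) = (\<Sum>i\<in>I. c i * f (v i))"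
proof -
  have f0: "f 0 = 0"
    using graded_dualD(3)[OF assms(1), of 0 0] pm.subspace_0[OF assms(2)] by simp
  show ?thesis
    using assms(3)
  proof (induction I rule: infinite_finite_induct)
    case (insert i I)
    have "(\<Sum>i\<in>I. scl (c i) (v i)) \<in> A" "scl (c i) (v i) \<in> A"
      using insert.prems by (auto intro!: pm.subspace_sum[OF assms(2)] pm.subspace_scale[OF assms(2)])
    then show ?case
      using insert graded_dualD(2,3)[OF assms(1)] by simp
  qed (simp_all add: f0)
qed

text \<open>Shared by both duals, with \<open>v\<close> the basis and \<xi> its coordinates. A
  functional in the graded dual kills all high degrees, and only finitely many basis vectors have
  small degree.\<close>

lemma graded_dual_expand:
  assumes f: "f \<in> graded_dual A H" and A: "pm.subspace A"
    and v: "\<And>b. b \<in> B \<Longrightarrow> v b \<in> A \<and> v b \<in> H (deg b)"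
    and fin: "\<And>N. finite {b \<in> B. deg b < N}"
    and expand: "\<And>x. x \<in> A \<Longrightarrow> \<exists>X. finite X \<and> X \<subseteq> B \<and> x = (\<Sum>b\<in>X. scl (\<xi> b x) (v b)) \<and> (\<forall>b\<in>B - X. \<xi> b x = 0)"
  shows "\<exists>Y. finite Y \<and> Y \<subseteq> B \<and> f = (\<Sum>b\<in>Y. fscl (f (v b)) (\<lambda>x. if x \<in> A then \<xi> b x else 0))"
proof -
  obtain N where N: "\<And>n x. n \<ge> N \<Longrightarrow> x \<in> H n \<Longrightarrow> f x = 0"
    using graded_dualD(4)[OF f] by blast
  let ?Y = "{b \<in> B. deg b < N}"
  have "f x = (\<Sum>b\<in>?Y. fscl (f (v b)) (\<lambda>x. if x \<in> A then \<xi> b x else 0)) x" for x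
  proof (cases "x \<in> A")
    case True
    obtain X where X: "finite X" "X \<subseteq> B" "x = (\<Sum>b\<in>X. scl (\<xi> b x) (v b))" "\<forall>b\<in>B - X. \<xi> b x = 0"
      using expand[OF True] by blast
    have zero: "f (v b) = 0" if "b \<in> B" "b \<notin> ?Y" for b
      using N[of "deg b" "v b"] v[of b] that by auto
    have "f x = f (\<Sum>b\<in>X. scl (\<xi> b x) (v b))" using X(3) by (rule arg_cong)
    also have "\<dots> = (\<Sum>b\<in>X. \<xi> b x * f (v b))"
      using X(2) v by (intro graded_dual_sum[OF f A]) blast
    also have "\<dots> = (\<Sum>b\<in>X \<inter> ?Y. \<xi> b x * f (v b))"
      using X(1,2) zero by (intro sum.mono_neutral_right) auto
    also have "\<dots> = (\<Sum>b\<in>?Y. \<xi> b x * f (v b))"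
      using X(4) fin by (intro sum.mono_neutral_left) auto
    finally show ?thesis using True by (simp add: sum_fun_apply fscl_def mult.commute)
  qed (simp add: sum_fun_apply fscl_def graded_dualD(1)[OF f])
  then have "f = (\<Sum>b\<in>?Y. fscl (f (v b)) (\<lambda>x. if x \<in> A then \<xi> b x else 0))"
    by (rule ext)
  moreover have "finite ?Y" "?Y \<subseteq> B" using fin by auto
  ultimately show ?thesis by blast
qed

lemma subspace_pbt: "pm.subspace (pbt m)"
  unfolding pbt_def by (rule pm.subspace_span)

lemma pbt_dual_expand:
  fixes f :: "(nat list \<Rightarrow>\<^sub>0 'k::field) \<Rightarrow> 'k"
  assumes "f \<in> pbt_dual m" "m \<ge> 1"
  shows "\<exists>Y. finite Y \<and> Y \<subseteq> ary_trees m \<and> f = (\<Sum>T\<in>Y. fscl (f (P m T)) (Q m T))"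
proof -
  have "\<exists>Y. finite Y \<and> Y \<subseteq> ary_trees m \<and>
      f = (\<Sum>T\<in>Y. fscl (f (P m T)) (\<lambda>x. if x \<in> pbt m then lookup x (rep m T) else 0))"
  proof (rule graded_dual_expand[where deg = nodes and H = "pbt_deg m"])
    show "f \<in> graded_dual (pbt m) (pbt_deg m)" using assms(1) by (simp add: pbt_dual_def)
    show "pm.subspace (pbt m :: (_ \<Rightarrow>\<^sub>0 'k) set)" by (rule subspace_pbt)
    show "P m T \<in> pbt m \<and> P m T \<in> pbt_deg m (nodes T)" if "T \<in> ary_trees m" for T
      using that P_pbt P_pbt_deg assms(2) by blast
    show "finite {T \<in> ary_trees m. nodes T < N}" for N
    proof (rule finite_subset)
      show "{T \<in> ary_trees m. nodes T < N} \<subseteq> (\<Union>n<N. {T. ary (Suc m) T \<and> nodes T = n})" by auto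
    qed (simp add: finite_ary_trees)
    fix x :: "nat list \<Rightarrow>\<^sub>0 'k" assume "x \<in> pbt m"
    then have inv: "sylv_invariant m x" using assms(2) by (simp add: pbt_eq)
    let ?X = "sylv m ` keys x"
    have X: "?X \<subseteq> ary_trees m"
      using inv sylv_in_ary[OF _ assms(2)] unfolding sylv_invariant_def by blast
    have "lookup x (rep m T) = 0" if "T \<in> ary_trees m - ?X" for T
    proof -
      have "rep m T \<notin> keys x"
        using that rep(2)[of T m] assms(2) by (metis DiffD1 DiffD2 image_eqI)
      then show ?thesis by (simp add: in_keys_iff)
    qed
    then show "\<exists>X. finite X \<and> X \<subseteq> ary_trees m \<and> x = (\<Sum>T\<in>X. scl (lookup x (rep m T)) (P m T)) \<and>
        (\<forall>T\<in>ary_trees m - X. lookup x (rep m T) = 0)"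
      using X sylv_invariant_expand[OF inv _ order_refl X assms(2)] by (intro exI[of _ ?X]) simp
  qed
  then obtain Y where Y: "finite Y" "Y \<subseteq> ary_trees m"
    "f = (\<Sum>T\<in>Y. fscl (f (P m T)) (\<lambda>x. if x \<in> pbt m then lookup x (rep m T) else 0))" by blast
  have "(\<Sum>T\<in>Y. fscl (f (P m T)) (\<lambda>x. if x \<in> pbt m then lookup x (rep m T) else 0)) =
      (\<Sum>T\<in>Y. fscl (f (P m T)) (Q m T))"
    using Y(2) by (intro sum.cong refl) (simp add: Q_eq[OF subsetD assms(2)])
  then show ?thesis using Y by metis
qed

lemma fqsym_dual_expand:
  fixes f :: "(nat list \<Rightarrow>\<^sub>0 'k::field) \<Rightarrow> 'k"
  assumes "f \<in> fqsym_dual m" "m \<ge> 1"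
  shows "\<exists>Y. finite Y \<and> Y \<subseteq> mperms m \<and> f = (\<Sum>\<alpha>\<in>Y. fscl (f (F \<alpha>)) (G m \<alpha>))"
proof -
  have "\<exists>Y. finite Y \<and> Y \<subseteq> mperms m \<and>
      f = (\<Sum>\<alpha>\<in>Y. fscl (f (F \<alpha>)) (\<lambda>x. if x \<in> fqsym m then lookup x \<alpha> else 0))"
  proof (rule graded_dual_expand[where deg = "\<lambda>w. length w div m" and H = "fqsym_deg m"])
    show "f \<in> graded_dual (fqsym m) (fqsym_deg m)" using assms(1) by (simp add: fqsym_dual_def)
    show "pm.subspace (fqsym m :: (_ \<Rightarrow>\<^sub>0 'k) set)" by (rule fqsym_subspace)
    show "F \<alpha> \<in> fqsym m \<and> F \<alpha> \<in> (fqsym_deg m (length \<alpha> div m) :: (_ \<Rightarrow>\<^sub>0 'k) set)" if "\<alpha> \<in> mperms m" for \<alpha>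
      using that mperms_iff[OF assms(2), of \<alpha>] by (simp add: fqsym_eq fqsym_deg_eq)
    show "finite {\<alpha> \<in> mperms m. length \<alpha> div m < N}" for N
    proof (rule finite_subset)
      show "{\<alpha> \<in> mperms m. length \<alpha> div m < N} \<subseteq> (\<Union>n<N. mperms_of m n)"
        using mperms_iff[OF assms(2)] by blast
    qed (simp add: finite_mperms_of)
    fix x :: "nat list \<Rightarrow>\<^sub>0 'k" assume "x \<in> fqsym m"
    then have "keys x \<subseteq> mperms m" by (simp add: fqsym_eq)
    moreover have "x = (\<Sum>\<alpha>\<in>keys x. scl (lookup x \<alpha>) (F \<alpha>))"
      by (rule sum_scl_bas[symmetric])
    ultimately show "\<exists>X. finite X \<and> X \<subseteq> mperms m \<and> x = (\<Sum>\<alpha>\<in>X. scl (lookup x \<alpha>) (F \<alpha>)) \<and>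
        (\<forall>\<alpha>\<in>mperms m - X. lookup x \<alpha> = 0)"
      by (intro exI[of _ "keys x"]) (auto simp: in_keys_iff)
  qed
  then obtain Y where Y: "finite Y" "Y \<subseteq> mperms m"
    "f = (\<Sum>\<alpha>\<in>Y. fscl (f (F \<alpha>)) (\<lambda>x. if x \<in> fqsym m then lookup x \<alpha> else 0))" by blast
  have "(\<Sum>\<alpha>\<in>Y. fscl (f (F \<alpha>)) (\<lambda>x. if x \<in> fqsym m then lookup x \<alpha> else 0)) =
      (\<Sum>\<alpha>\<in>Y. fscl (f (F \<alpha>)) (G m \<alpha>))"
    using Y(2) by (intro sum.cong refl) (simp add: G_eq[OF subsetD])
  then show ?thesis using Y by metis
qed

lemma Q_P:
  assumes "S \<in> ary_trees m" "T \<in> ary_trees m" "m \<ge> 1"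
  shows "Q m T (P m S :: _ \<Rightarrow>\<^sub>0 'k::field) = (if S = T then 1 else 0)"
  using lookup_P_rep[OF assms(2,3), of S] P_pbt[OF assms(1)] by (auto simp: Q_eq[OF assms(2,3)])

lemma Q_dual:
  assumes "T \<in> ary_trees m" "m \<ge> 1"
  shows "(Q m T :: (_ \<Rightarrow>\<^sub>0 'k::field) \<Rightarrow> 'k) \<in> pbt_dual m"
proof -
  have "Q m T x = 0" if "n \<ge> Suc (nodes T)" "x \<in> pbt_deg m n" for n and x :: "_ \<Rightarrow>\<^sub>0 'k"
  proof -
    have "rep m T \<notin> mperms_of m n"
      using mperms_of_inj[OF rep(1)[OF assms] _ assms(2)] that(1) by fastforce
    then have "rep m T \<notin> keys x" using that(2) assms(2) by (auto simp: pbt_deg_eq)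
    then show ?thesis by (simp add: Q_eq[OF assms] in_keys_iff)
  qed
  then have "\<exists>N. \<forall>n\<ge>N. \<forall>x\<in>pbt_deg m n. Q m T (x :: _ \<Rightarrow>\<^sub>0 'k) = 0" by blast
  then show ?thesis
    unfolding pbt_dual_def graded_dual_def mem_Collect_eq
    by (intro conjI allI ballI impI)
      (simp_all add: Q_eq[OF assms] lookup_add pm.subspace_add[OF subspace_pbt] pm.subspace_scale[OF subspace_pbt])
qed

lemma G_dual:
  assumes "\<alpha> \<in> mperms m" "m \<ge> 1"
  shows "(G m \<alpha> :: (_ \<Rightarrow>\<^sub>0 'k::field) \<Rightarrow> 'k) \<in> fqsym_dual m"
proof -
  obtain k where k: "\<alpha> \<in> mperms_of m k" using assms(1) by (auto simp: mperms_def)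
  have "G m \<alpha> x = 0" if "n \<ge> Suc k" "x \<in> fqsym_deg m n" for n and x :: "_ \<Rightarrow>\<^sub>0 'k"
  proof -
    have "\<alpha> \<notin> mperms_of m n"
      using mperms_of_inj[OF k _ assms(2)] that(1) by fastforce
    then have "\<alpha> \<notin> keys x" using that(2) by (auto simp: fqsym_deg_eq)
    then show ?thesis by (simp add: G_eq[OF assms(1)] in_keys_iff)
  qed
  then have "\<exists>N. \<forall>n\<ge>N. \<forall>x\<in>fqsym_deg m n. G m \<alpha> (x :: _ \<Rightarrow>\<^sub>0 'k) = 0" by blast
  then show ?thesis
    unfolding fqsym_dual_def graded_dual_def mem_Collect_eq
    by (intro conjI allI ballI impI)
      (simp_all add: G_eq[OF assms(1)] lookup_add pm.subspace_add[OF fqsym_subspace] pm.subspace_scale[OF fqsym_subspace])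
qed

lemma inj_on_Q:
  assumes "m \<ge> 1"
  shows "inj_on (Q m :: _ \<Rightarrow> (_ \<Rightarrow>\<^sub>0 'k::field) \<Rightarrow> 'k) (ary_trees m)"
proof (rule inj_onI)
  fix S T assume ST: "S \<in> ary_trees m" "T \<in> ary_trees m" "(Q m S :: (_ \<Rightarrow>\<^sub>0 'k) \<Rightarrow> 'k) = Q m T"
  have "Q m T (P m S :: _ \<Rightarrow>\<^sub>0 'k) = 1"
    unfolding ST(3)[symmetric] by (simp add: Q_P[OF ST(1,1) assms])
  then show "S = T" by (simp add: Q_P[OF ST(1,2) assms] split: if_splits)
qed

lemma independent_Q:
  assumes "m \<ge> 1"
  shows "fn.independent ((Q m :: _ \<Rightarrow> (_ \<Rightarrow>\<^sub>0 'k::field) \<Rightarrow> 'k) ` ary_trees m)"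
  unfolding fn.independent_explicit_module
proof (intro allI impI)
  fix X :: "((nat list \<Rightarrow>\<^sub>0 'k) \<Rightarrow> 'k) set" and c q
  assume X: "finite X" "X \<subseteq> Q m ` ary_trees m" and 0: "(\<Sum>q\<in>X. fscl (c q) q) = 0" and q: "q \<in> X"
  obtain Y where Y: "finite Y" "Y \<subseteq> ary_trees m" "X = Q m ` Y"
    using X by (meson finite_subset_image)
  obtain S where S: "S \<in> Y" "q = Q m S" using q Y by auto
  have "inj_on (Q m :: _ \<Rightarrow> (_ \<Rightarrow>\<^sub>0 'k) \<Rightarrow> 'k) Y" using inj_on_Q[OF assms] Y(2) by (rule inj_on_subset)
  then have "(\<Sum>T\<in>Y. fscl (c (Q m T)) (Q m T)) = 0"
    using 0 by (simp add: Y(3) sum.reindex)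
  then have "(\<Sum>T\<in>Y. fscl (c (Q m T)) (Q m T)) (P m S) = 0" by simp
  then have "(\<Sum>T\<in>Y. c (Q m T) * Q m T (P m S)) = 0"
    by (simp only: sum_fun_apply fscl_def)
  moreover have "(\<Sum>T\<in>Y. c (Q m T) * Q m T (P m S)) = (\<Sum>T\<in>Y. if T = S then c (Q m T) else 0)"
    using Y(2) S(1) assms by (intro sum.cong refl) (auto simp: Q_P subset_iff)
  ultimately show "c q = 0" using Y(1) S by simp
qed

lemma span_Q:
  assumes "m \<ge> 1"
  shows "fn.span (Q m ` ary_trees m) = (pbt_dual m :: ((_ \<Rightarrow>\<^sub>0 'k::field) \<Rightarrow> 'k) set)"
proof
  show "fn.span (Q m ` ary_trees m) \<subseteq> (pbt_dual m :: ((_ \<Rightarrow>\<^sub>0 'k) \<Rightarrow> 'k) set)"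
    using Q_dual[OF _ assms] subspace_graded_dual[of "pbt m" "pbt_deg m"]
    by (intro fn.span_minimal) (auto simp: pbt_dual_def)
  show "pbt_dual m \<subseteq> fn.span (Q m ` ary_trees m :: ((_ \<Rightarrow>\<^sub>0 'k) \<Rightarrow> 'k) set)"
  proof
    fix f :: "(_ \<Rightarrow>\<^sub>0 'k) \<Rightarrow> 'k" assume "f \<in> pbt_dual m"
    then obtain Y where Y: "Y \<subseteq> ary_trees m" "f = (\<Sum>T\<in>Y. fscl (f (P m T)) (Q m T))"
      using pbt_dual_expand[OF _ assms] by blast
    have "(\<Sum>T\<in>Y. fscl (f (P m T)) (Q m T)) \<in> fn.span (Q m ` ary_trees m)"
      using Y(1) by (intro fn.span_sum fn.span_scale fn.span_base) blast
    then show "f \<in> fn.span (Q m ` ary_trees m)" using Y(2) by simp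
  qed
qed

section \<open>The quotient by the sylvester ideal\<close>

lemma restrict_pbt_dual:
  assumes "f \<in> fqsym_dual m" "m \<ge> 1"
  shows "restrict_functional (pbt m) f \<in> pbt_dual m"
proof -
  have f: "f \<in> graded_dual (fqsym m) (fqsym_deg m)" using assms(1) by (simp add: fqsym_dual_def)
  note fq = pbt_subset_fqsym[OF assms(2)]
  obtain N where "\<forall>n\<ge>N. \<forall>x\<in>fqsym_deg m n. f x = 0" using graded_dualD(4)[OF f] by blast
  then have "\<forall>n\<ge>N. \<forall>x\<in>pbt_deg m n. restrict_functional (pbt m) f x = 0"
    by (auto simp: restrict_functional_def pbt_deg_def)
  then have ex: "\<exists>N. \<forall>n\<ge>N. \<forall>x\<in>pbt_deg m n. restrict_functional (pbt m) f x = 0" by blast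
  show ?thesis
    unfolding pbt_dual_def graded_dual_def mem_Collect_eq
    by (intro conjI allI ballI impI ex)
      (auto simp: restrict_functional_def fq graded_dualD[OF f] pm.subspace_add[OF subspace_pbt]
        pm.subspace_scale[OF subspace_pbt])
qed

text \<open>An element of \<open>pbt m\<close> has the same coefficient at \<alpha> and at the
  representative of its class; \<open>G\<close> reads the former and \<open>Q\<close> the
  latter.\<close>

lemma restrict_G:
  assumes "\<alpha> \<in> mperms m" "m \<ge> 1"
  shows "restrict_functional (pbt m) (G m \<alpha>) = (Q m (sylv m \<alpha>) :: (_ \<Rightarrow>\<^sub>0 'k::field) \<Rightarrow> 'k)"
proof
  fix x :: "_ \<Rightarrow>\<^sub>0 'k"
  note T = sylv_in_ary[OF assms]
  note r = rep[OF T assms(2)]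
  show "restrict_functional (pbt m) (G m \<alpha>) x = Q m (sylv m \<alpha>) x"
  proof (cases "x \<in> pbt m")
    case True
    then have "sylv_invariant m x" using assms(2) by (simp add: pbt_eq)
    from sylv_invariantD[OF this r(3) assms(1) r(2)] show ?thesis
      using True pbt_subset_fqsym[OF assms(2) True]
      by (simp add: restrict_functional_def G_eq[OF assms(1)] Q_eq[OF T assms(2)])
  qed (simp add: restrict_functional_def Q_eq[OF T assms(2)])
qed

text \<open>The value of \<open>f\<close> tensor \<open>g\<close> at \<open>z\<close>, separated
  from \<open>fq_dual_mult\<close> so that its linearity in \<open>z\<close> is available.\<close>

definition eval_tens ::
  "((nat list \<Rightarrow>\<^sub>0 'k::field) \<Rightarrow> 'k) \<Rightarrow> ((nat list \<Rightarrow>\<^sub>0 'k) \<Rightarrow> 'k) \<Rightarrow> (nat list \<times> nat list \<Rightarrow>\<^sub>0 'k) \<Rightarrow> 'k"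
  where "eval_tens f g z = (\<Sum>(u, v)\<in>keys z. lookup z (u, v) * f (F u) * g (F v))"

lemma eval_tens_superset:
  assumes "finite K" "keys z \<subseteq> K"
  shows "eval_tens f g z = (\<Sum>(u, v)\<in>K. lookup z (u, v) * f (F u) * g (F v))"
  unfolding eval_tens_def using assms by (intro sum.mono_neutral_left) (auto simp: in_keys_iff)

lemma eval_tens_add: "eval_tens f g (z + w) = eval_tens f g z + eval_tens f g w"
proof -
  let ?K = "keys z \<union> keys w"
  have "eval_tens f g y = (\<Sum>(u, v)\<in>?K. lookup y (u, v) * f (F u) * g (F v))"
    if "y \<in> {z, w, z + w}" for y
    using that by (intro eval_tens_superset) (auto dest: subsetD[OF Poly_Mapping.keys_add])
  then show ?thesis
    by (simp add: lookup_add case_prod_beta sum.distrib algebra_simps)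
qed

lemma eval_tens_scl: "eval_tens f g (scl c z) = c * eval_tens f g z"
proof -
  have "eval_tens f g (scl c z) =
      (\<Sum>(u, v)\<in>keys z. lookup (scl c z) (u, v) * f (F u) * g (F v))"
    by (intro eval_tens_superset) (auto simp: in_keys_iff)
  then show ?thesis
    by (simp add: eval_tens_def case_prod_beta sum_distrib_left mult.assoc)
qed

lemma eval_tens_sum: "eval_tens f g (\<Sum>i\<in>I. h i) = (\<Sum>i\<in>I. eval_tens f g (h i))"
  by (induction I rule: infinite_finite_induct) (auto simp: eval_tens_add eval_tens_def[of f g 0])

lemma fqsym_dual_eval:
  fixes f :: "(nat list \<Rightarrow>\<^sub>0 'k::field) \<Rightarrow> 'k"
  assumes "f \<in> fqsym_dual m" "x \<in> fqsym m"
  shows "f x = (\<Sum>u\<in>keys x. lookup x u * f (F u))"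
proof -
  have "f x = f (\<Sum>u\<in>keys x. scl (lookup x u) (F u))"
    by (simp only: sum_scl_bas)
  also have "\<dots> = (\<Sum>u\<in>keys x. lookup x u * f (F u))"
    using assms by (intro graded_dual_sum[OF _ fqsym_subspace, of f m "fqsym_deg m"])
      (auto simp: fqsym_dual_def fqsym_eq)
  finally show ?thesis .
qed

lemma eval_tens_tens:
  assumes "f \<in> fqsym_dual m" "g \<in> fqsym_dual m" "x \<in> fqsym m" "y \<in> fqsym m"
  shows "eval_tens f g (tens x y) = f x * g y"
proof -
  have "eval_tens f g (tens x y) = (\<Sum>(u, v)\<in>keys x \<times> keys y.
      lookup (tens x y) (u, v) * f (F u) * g (F v))"
    by (intro eval_tens_superset keys_tens) simp
  also have "\<dots> = (\<Sum>u\<in>keys x. \<Sum>v\<in>keys y.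
      (lookup x u * f (F u)) * (lookup y v * g (F v)))"
    unfolding sum.cartesian_product by (intro sum.cong refl) (auto simp: algebra_simps)
  also have "\<dots> = f x * g y"
    unfolding fqsym_dual_eval[OF assms(1,3)] fqsym_dual_eval[OF assms(2,4)] by (simp add: sum_product)
  finally show ?thesis .
qed

lemma fq_dual_mult_eq: "fq_dual_mult m f g = (\<lambda>x. if x \<in> fqsym m then eval_tens f g (fq_comult m x) else 0)"
  unfolding fq_dual_mult_def restrict_functional_def eval_tens_def by (rule refl)

lemma fq_dual_mult_dual:
  fixes f g :: "(nat list \<Rightarrow>\<^sub>0 'k::field) \<Rightarrow> 'k"
  assumes "f \<in> fqsym_dual m" "g \<in> fqsym_dual m" "m \<ge> 1"
  shows "fq_dual_mult m f g \<in> fqsym_dual m"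
proof -
  obtain M where M: "\<And>n x. n \<ge> M \<Longrightarrow> x \<in> fqsym_deg m n \<Longrightarrow> f x = 0"
    using assms(1) graded_dualD(4) unfolding fqsym_dual_def by blast
  obtain N where N: "\<And>n x. n \<ge> N \<Longrightarrow> x \<in> fqsym_deg m n \<Longrightarrow> g x = 0"
    using assms(2) graded_dualD(4) unfolding fqsym_dual_def by blast
  have "fq_dual_mult m f g x = 0" if n: "n \<ge> M + N" and x: "x \<in> fqsym_deg m n" for n x
  proof -
    have "f (F u) = 0 \<or> g (F v) = 0" if uv: "(u, v) \<in> keys (fq_comult m x)" for u v
    proof -
      have "keys x \<subseteq> mperms_of m n" using x by (simp add: fqsym_deg_eq)
      from keys_fq_comult[OF this assms(3) uv]
      obtain i j where ij: "n = i + j" "u \<in> mperms_of m i" "v \<in> mperms_of m j" by blast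
      \<comment> \<open>The degrees of the two factors add up to at least \<open>M + N\<close>, so
        one of the functionals kills its factor.\<close>
      then have "i \<ge> M \<or> j \<ge> N" using n by auto
      then show ?thesis using M[of i "F u"] N[of j "F v"] ij by (auto simp: fqsym_deg_eq)
    qed
    then have "eval_tens f g (fq_comult m x) = 0"
      unfolding eval_tens_def by (intro sum.neutral) auto
    then show ?thesis by (simp add: fq_dual_mult_eq)
  qed
  then have "\<exists>N. \<forall>n\<ge>N. \<forall>x\<in>fqsym_deg m n. fq_dual_mult m f g x = 0" by blast
  then show ?thesis
    unfolding fqsym_dual_def graded_dual_def mem_Collect_eq
    by (intro conjI allI ballI impI)
      (simp_all add: fq_dual_mult_eq pm.subspace_add[OF fqsym_subspace] pm.subspace_scale[OF fqsym_subspace]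
        linear_addD[OF linear_fq_comult] linear_sclD[OF linear_fq_comult] eval_tens_add eval_tens_scl)
qed

text \<open>The coproduct of \<open>P m T\<close> is a combination of tensors of
  \<open>P m U\<close> and \<open>P m V\<close>, at which \<open>f\<close> tensor \<open>g\<close>
  takes the value \<open>f (P m U) * g (P m V)\<close>. So the annihilator of \<open>pbt m\<close>
  is an ideal.\<close>

lemma fq_dual_mult_vanish:
  fixes f g :: "(nat list \<Rightarrow>\<^sub>0 'k::field) \<Rightarrow> 'k"
  assumes "f \<in> fqsym_dual m" "g \<in> fqsym_dual m" "m \<ge> 1"
    and "(\<forall>x\<in>pbt m. f x = 0) \<or> (\<forall>x\<in>pbt m. g x = 0)"
  shows "\<forall>x\<in>pbt m. fq_dual_mult m f g x = 0"
proof
  fix x :: "nat list \<Rightarrow>\<^sub>0 'k" assume x: "x \<in> pbt m"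
  let ?h = "fq_dual_mult m f g"
  have zero: "?h (P m T) = 0" if T: "T \<in> ary_trees m" for T
  proof -
    let ?c = "\<lambda>U V. lookup (fq_comult m (P m T)) (rep m U, rep m V)"
    have "eval_tens f g (fq_comult m (P m T)) =
        eval_tens f g (\<Sum>(U, V)\<in>tree_pairs m (nodes T). scl (?c U V) (tens (P m U) (P m V)))"
      by (rule arg_cong[OF fq_comult_pbt_deg[OF P_pbt_deg[OF T assms(3)] assms(3)]])
    also have "\<dots> = (\<Sum>(U, V)\<in>tree_pairs m (nodes T). ?c U V * eval_tens f g (tens (P m U) (P m V)))"
      by (simp add: eval_tens_sum eval_tens_scl case_prod_beta)
    also have "\<dots> = 0"
    proof (rule sum.neutral, clarify)
      fix U V assume "(U, V) \<in> tree_pairs m (nodes T)"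
      then have "P m U \<in> (pbt m :: (_ \<Rightarrow>\<^sub>0 'k) set)" "P m V \<in> (pbt m :: (_ \<Rightarrow>\<^sub>0 'k) set)"
        by (auto simp: tree_pairs_def intro!: P_pbt)
      then show "?c U V * eval_tens f g (tens (P m U) (P m V)) = 0"
        using eval_tens_tens[OF assms(1,2)] pbt_subset_fqsym[OF assms(3)] assms(4) by fastforce
    qed
    finally show ?thesis by (simp add: fq_dual_mult_eq)
  qed
  have inv: "sylv_invariant m x" using x assms(3) by (simp add: pbt_eq)
  let ?X = "sylv m ` keys x"
  have X: "?X \<subseteq> ary_trees m"
    using inv sylv_in_ary[OF _ assms(3)] unfolding sylv_invariant_def by blast
  have "?h x = ?h (\<Sum>T\<in>?X. scl (lookup x (rep m T)) (P m T))"
    by (rule arg_cong[OF sylv_invariant_expand[OF inv _ order_refl X assms(3)]]) simp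
  also have "\<dots> = (\<Sum>T\<in>?X. lookup x (rep m T) * ?h (P m T))"
    using fq_dual_mult_dual[OF assms(1-3)] X P_pbt pbt_subset_fqsym[OF assms(3)]
    unfolding fqsym_dual_def by (intro graded_dual_sum[OF _ fqsym_subspace]) blast+
  also have "\<dots> = 0" using zero X by (intro sum.neutral) auto
  finally show "?h x = 0" .
qed

text \<open>The generators vanish because coefficients of elements of \<open>pbt m\<close> are
  constant on classes. Membership in the graded dual is carried along since
  \<open>fq_dual_mult_vanish\<close> asks for it in the multiplication cases.\<close>

lemma sylvester_ideal_vanish:
  fixes f :: "(nat list \<Rightarrow>\<^sub>0 'k::field) \<Rightarrow> 'k"
  assumes "f \<in> sylvester_ideal m" "m \<ge> 1"
  shows "f \<in> fqsym_dual m \<and> (\<forall>x\<in>pbt m. f x = 0)"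
  using assms(1)
proof induction
  case (gen \<alpha> \<beta>)
  have sub: "G m \<alpha> - G m \<beta> \<in> (fqsym_dual m :: ((_ \<Rightarrow>\<^sub>0 'k) \<Rightarrow> 'k) set)"
    using G_dual[OF gen(1) assms(2)] G_dual[OF gen(2) assms(2)]
    unfolding fqsym_dual_def by (rule fn.subspace_diff[OF subspace_graded_dual])
  have "sylv m \<alpha> = sylv m \<beta>" using sylvester_iff_sylv[OF gen(1,2) assms(2)] gen(3) by simp
  then have "restrict_functional (pbt m) (G m \<alpha>) = (restrict_functional (pbt m) (G m \<beta>) :: (_ \<Rightarrow>\<^sub>0 'k) \<Rightarrow> 'k)"
    by (simp only: restrict_G[OF gen(1) assms(2)] restrict_G[OF gen(2) assms(2)])
  then have "G m \<alpha> x = G m \<beta> x" if "x \<in> pbt m" for x :: "_ \<Rightarrow>\<^sub>0 'k"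
    using that unfolding restrict_functional_def by metis
  then have "\<forall>x\<in>pbt m. (G m \<alpha> - G m \<beta>) (x :: _ \<Rightarrow>\<^sub>0 'k) = 0" by simp
  then show ?case using sub by blast
next
  case zero
  have "0 \<in> fqsym_dual m" unfolding fqsym_dual_def by (rule fn.subspace_0[OF subspace_graded_dual])
  moreover have "\<forall>x\<in>pbt m. (0 :: (_ \<Rightarrow>\<^sub>0 'k) \<Rightarrow> 'k) x = 0" by simp
  ultimately show ?case by blast
next
  case (add f g)
  then have "f + g \<in> fqsym_dual m"
    unfolding fqsym_dual_def by (blast intro: fn.subspace_add[OF subspace_graded_dual])
  moreover have "\<forall>x\<in>pbt m. (f + g) x = 0" using add by simp
  ultimately show ?case by blast
next
  case (scale f c)
  then show ?case using fn.subspace_scale[OF subspace_graded_dual]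
    by (auto simp: fqsym_dual_def fscl_def[abs_def])
next
  case (mult_left f g)
  then show ?case using fq_dual_mult_dual[of g m f] fq_dual_mult_vanish[of g m f] assms(2) by blast
next
  case (mult_right f g)
  then show ?case using fq_dual_mult_dual[of f m g] fq_dual_mult_vanish[of f m g] assms(2) by blast
qed

lemma sylvester_ideal_sum:
  "(\<And>i. i \<in> I \<Longrightarrow> f i \<in> sylvester_ideal m) \<Longrightarrow> (\<Sum>i\<in>I. f i) \<in> sylvester_ideal m"
  by (induction I rule: infinite_finite_induct) (auto intro: sylvester_ideal.intros)

text \<open>Modulo the generators, every \<open>G m \<alpha>\<close> may be replaced by
  \<open>G\<close> at the representative of its class. The remaining combination has one coefficient
  \<open>d T\<close> per tree, and these are detected on the \<open>P m T\<close>.\<close>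

lemma vanish_sylvester_ideal:
  fixes f :: "(nat list \<Rightarrow>\<^sub>0 'k::field) \<Rightarrow> 'k"
  assumes f: "f \<in> fqsym_dual m" and 0: "\<forall>x\<in>pbt m. f x = 0" and m: "m \<ge> 1"
  shows "f \<in> sylvester_ideal m"
proof -
  obtain Y where Y: "finite Y" "Y \<subseteq> mperms m" "f = (\<Sum>\<alpha>\<in>Y. fscl (f (F \<alpha>)) (G m \<alpha>))"
    using fqsym_dual_expand[OF f m] by blast
  let ?r = "\<lambda>\<alpha>. rep m (sylv m \<alpha>)"
  let ?g = "\<Sum>\<alpha>\<in>Y. fscl (f (F \<alpha>)) (G m \<alpha> - G m (?r \<alpha>))"
  let ?X = "sylv m ` Y"
  have ary: "sylv m \<alpha> \<in> ary_trees m" if "\<alpha> \<in> Y" for \<alpha>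
    using that Y(2) sylv_in_ary[OF _ m] by blast
  define d where "d T = (\<Sum>\<alpha>\<in>{\<alpha> \<in> Y. sylv m \<alpha> = T}. f (F \<alpha>))" for T
  let ?h = "\<Sum>T\<in>?X. fscl (d T) (G m (rep m T))"
  have ideal: "?g \<in> sylvester_ideal m"
  proof (rule sylvester_ideal_sum, rule sylvester_ideal.scale, rule sylvester_ideal.gen)
    fix \<alpha> assume \<alpha>: "\<alpha> \<in> Y"
    then show "\<alpha> \<in> mperms m" "?r \<alpha> \<in> mperms m" using Y(2) rep[OF ary m] by auto
    then show "sylvester \<alpha> (?r \<alpha>)"
      using sylvester_iff_sylv[OF _ _ m] rep(2)[OF ary[OF \<alpha>] m] by simp
  qed
  have "(\<Sum>\<alpha>\<in>Y. fscl (f (F \<alpha>)) (G m (?r \<alpha>))) =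
      (\<Sum>T\<in>?X. \<Sum>\<alpha>\<in>{\<alpha> \<in> Y. sylv m \<alpha> = T}. fscl (f (F \<alpha>)) (G m (?r \<alpha>)))"
    by (rule sum.image_gen[OF Y(1)])
  also have "\<dots> = ?h"
    by (intro sum.cong refl) (simp add: d_def fn.scale_sum_left)
  finally have "f = ?g + ?h"
    using Y(3) by (simp add: fn.scale_right_diff_distrib sum_subtractf)
  moreover have "?h = 0"
  proof -
    have "d S = 0" if S: "S \<in> ?X" for S
    proof -
      have S': "S \<in> ary_trees m" using S ary by auto
      have PS: "P m S \<in> (pbt m :: (_ \<Rightarrow>\<^sub>0 'k) set)" by (rule P_pbt[OF S'])
      \<comment> \<open>Both \<open>f\<close> and the ideal element \<open>?g\<close> vanish on
        \<open>pbt m\<close>, while \<open>?h\<close> takes the value \<open>d S\<close> at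
        \<open>P m S\<close>.\<close>
      have "?h (P m S) = f (P m S) - ?g (P m S)"
        using fun_cong[OF \<open>f = ?g + ?h\<close>, of "P m S"] by (simp add: algebra_simps)
      also have "\<dots> = 0"
        using 0 PS sylvester_ideal_vanish[OF ideal m] by simp
      finally have "(\<Sum>T\<in>?X. d T * G m (rep m T) (P m S)) = 0"
        by (simp only: sum_fun_apply fscl_def)
      moreover have "G m (rep m T) (P m S :: _ \<Rightarrow>\<^sub>0 'k) = (if T = S then 1 else 0)" if "T \<in> ?X" for T
      proof -
        have T: "T \<in> ary_trees m" using that ary by auto
        show ?thesis
          using pbt_subset_fqsym[OF m PS] lookup_P_rep[OF T m, of S] by (simp add: G_eq[OF rep(3)[OF T m]])
      qed
      ultimately show ?thesis
        using Y(1) S by (simp add: if_distrib[of "(*) _"] cong: if_cong sum.cong)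
    qed
    then show ?thesis by (intro sum.neutral) (auto simp: fscl_def zero_fun_def)
  qed
  ultimately show ?thesis using ideal by simp
qed

text \<open>Combines both inclusions between the ideal and the annihilator of \<open>pbt m\<close>:
  the quotient is taken by the kernel of restriction.\<close>

lemma sylvester_rel_iff:
  fixes f g :: "(nat list \<Rightarrow>\<^sub>0 'k::field) \<Rightarrow> 'k"
  assumes "m \<ge> 1"
  shows "(f, g) \<in> sylvester_rel m \<longleftrightarrow> f \<in> fqsym_dual m \<and> g \<in> fqsym_dual m \<and>
    restrict_functional (pbt m) f = restrict_functional (pbt m) g"
proof -
  have "f - g \<in> sylvester_ideal m \<longleftrightarrow> restrict_functional (pbt m) f = restrict_functional (pbt m) g"
    if fg: "f \<in> fqsym_dual m" "g \<in> fqsym_dual m"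
  proof -
    have "f - g \<in> fqsym_dual m"
      using fg unfolding fqsym_dual_def by (rule fn.subspace_diff[OF subspace_graded_dual])
    then have "f - g \<in> sylvester_ideal m \<longleftrightarrow> (\<forall>x\<in>pbt m. (f - g) x = 0)"
      using sylvester_ideal_vanish[OF _ assms, of "f - g"] vanish_sylvester_ideal[OF _ _ assms, of "f - g"] by blast
    also have "\<dots> \<longleftrightarrow> restrict_functional (pbt m) f = restrict_functional (pbt m) g"
      by (auto simp: restrict_functional_def fun_eq_iff split: if_splits)
    finally show ?thesis .
  qed
  then show ?thesis by (auto simp: sylvester_rel_def)
qed

text \<open>The bijection is induced by restricting functionals to \<open>pbt m\<close>. It is onto
  because \<open>Q m T\<close> lifts to \<open>G m (rep m T)\<close>.\<close>

lemma quotient_iso_pbt_dual: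
  assumes m: "m \<ge> 1"
  shows "\<exists>\<Phi> :: ((nat list \<Rightarrow>\<^sub>0 'k::field) \<Rightarrow> 'k) set \<Rightarrow> ((nat list \<Rightarrow>\<^sub>0 'k) \<Rightarrow> 'k).
    bij_betw \<Phi> (fqsym_dual m // sylvester_rel m) (pbt_dual m) \<and>
    (\<forall>f\<in>fqsym_dual m. \<Phi> (sylvester_rel m `` {f}) = restrict_functional (pbt m) f) \<and>
    (\<forall>\<alpha>\<in>mperms m. \<Phi> (Gbar m \<alpha>) = Q m (sylv m \<alpha>))"
proof -
  let ?\<rho> = "restrict_functional (pbt m) :: ((nat list \<Rightarrow>\<^sub>0 'k) \<Rightarrow> 'k) \<Rightarrow> _"
  let ?D = "fqsym_dual m :: ((nat list \<Rightarrow>\<^sub>0 'k) \<Rightarrow> 'k) set"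
  \<comment> \<open>Restriction is constant on classes, so the chosen element does not
    matter.\<close>
  define \<Phi> where "\<Phi> C = ?\<rho> (SOME f. f \<in> C)" for C
  have cls: "sylvester_rel m `` {f} = {g \<in> ?D. ?\<rho> g = ?\<rho> f}" if "f \<in> ?D" for f
    using sylvester_rel_iff[OF m] that by auto
  have \<Phi>: "\<Phi> (sylvester_rel m `` {f}) = ?\<rho> f" if "f \<in> ?D" for f
  proof -
    have "f \<in> {g \<in> ?D. ?\<rho> g = ?\<rho> f}" using that by simp
    then have "(SOME g. g \<in> {g \<in> ?D. ?\<rho> g = ?\<rho> f}) \<in> {g \<in> ?D. ?\<rho> g = ?\<rho> f}"
      by (rule someI[of "\<lambda>g. g \<in> {g \<in> ?D. ?\<rho> g = ?\<rho> f}"])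
    then show ?thesis unfolding \<Phi>_def cls[OF that] by blast
  qed
  have "inj_on \<Phi> (?D // sylvester_rel m)"
  proof (rule inj_onI)
    fix X Y assume X: "X \<in> ?D // sylvester_rel m" and Y: "Y \<in> ?D // sylvester_rel m" and eq: "\<Phi> X = \<Phi> Y"
    obtain f where f: "f \<in> ?D" "X = sylvester_rel m `` {f}" using X by (rule quotientE)
    obtain g where g: "g \<in> ?D" "Y = sylvester_rel m `` {g}" using Y by (rule quotientE)
    have "?\<rho> f = ?\<rho> g" using eq unfolding f(2) g(2) \<Phi>[OF f(1)] \<Phi>[OF g(1)] .
    then show "X = Y" unfolding f(2) g(2) cls[OF f(1)] cls[OF g(1)] by simp
  qed
  moreover have "\<Phi> ` (?D // sylvester_rel m) = pbt_dual m"
  proof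
    show "\<Phi> ` (?D // sylvester_rel m) \<subseteq> pbt_dual m"
      using \<Phi> restrict_pbt_dual[OF _ m] by (auto elim!: quotientE)
    show "pbt_dual m \<subseteq> \<Phi> ` (?D // sylvester_rel m)"
    proof
      fix g :: "(nat list \<Rightarrow>\<^sub>0 'k) \<Rightarrow> 'k" assume g: "g \<in> pbt_dual m"
      obtain Y where Y: "Y \<subseteq> ary_trees m" "g = (\<Sum>T\<in>Y. fscl (g (P m T)) (Q m T))"
        using pbt_dual_expand[OF g m] by blast
      let ?f = "\<Sum>T\<in>Y. fscl (g (P m T)) (G m (rep m T))"
      have mem: "?f \<in> ?D"
        unfolding fqsym_dual_def
      proof (intro fn.subspace_sum[OF subspace_graded_dual] fn.subspace_scale[OF subspace_graded_dual])
        fix T assume "T \<in> Y"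
        then have "T \<in> ary_trees m" using Y(1) by blast
        then show "G m (rep m T) \<in> graded_dual (fqsym m) (fqsym_deg m)"
          using G_dual[OF rep(3)] m unfolding fqsym_dual_def by blast
      qed
      have "?\<rho> ?f = (\<Sum>T\<in>Y. fscl (g (P m T)) (?\<rho> (G m (rep m T))))"
        by (auto simp: restrict_functional_def sum_fun_apply fscl_def fun_eq_iff)
      also have "\<dots> = (\<Sum>T\<in>Y. fscl (g (P m T)) (Q m T))"
      proof (intro sum.cong refl)
        fix T assume "T \<in> Y"
        then have T: "T \<in> ary_trees m" using Y(1) by blast
        show "fscl (g (P m T)) (?\<rho> (G m (rep m T))) = fscl (g (P m T)) (Q m T)"
          unfolding restrict_G[OF rep(3)[OF T m] m] rep(2)[OF T m] ..
      qed
      finally have "g = \<Phi> (sylvester_rel m `` {?f})" using \<Phi>[OF mem] Y(2) by simp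
      then show "g \<in> \<Phi> ` (?D // sylvester_rel m)" by (rule image_eqI[OF _ quotientI[OF mem]])
    qed
  qed
  moreover have "\<Phi> (Gbar m \<alpha>) = Q m (sylv m \<alpha>)" if "\<alpha> \<in> mperms m" for \<alpha>
    unfolding Gbar_def using \<Phi>[OF G_dual[OF that m]] restrict_G[OF that m] by simp
  ultimately show ?thesis
    using \<Phi> unfolding bij_betw_def by blast
qed

theorem theorem4p10:
  fixes m :: nat
  assumes "m \<ge> 1"
  shows
    "inj_on (P m :: ptree \<Rightarrow> nat list \<Rightarrow>\<^sub>0 'k::field_char_0) (ary_trees m) \<and>
     pm.independent ((P m :: ptree \<Rightarrow> nat list \<Rightarrow>\<^sub>0 'k) ` ary_trees m) \<and>
     graded_hopf_algebra (pbt m :: (nat list \<Rightarrow>\<^sub>0 'k) set) (pbt_deg m)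
       (fq_mult m) (F []) (fq_comult m) fq_counit \<and>
     (\<forall>n. real (pm.dim (pbt_deg m n :: (nat list \<Rightarrow>\<^sub>0 'k) set)) =
       1 / (real m * real n + 1) * real (((m + 1) * n) choose n)) \<and>
     (\<forall>S\<in>ary_trees m. \<forall>T\<in>ary_trees m.
       Q m T (P m S :: nat list \<Rightarrow>\<^sub>0 'k) = (if S = T then 1 else 0)) \<and>
     inj_on (Q m :: ptree \<Rightarrow> (nat list \<Rightarrow>\<^sub>0 'k) \<Rightarrow> 'k) (ary_trees m) \<and>
     fn.independent ((Q m :: ptree \<Rightarrow> (nat list \<Rightarrow>\<^sub>0 'k) \<Rightarrow> 'k) ` ary_trees m) \<and>
     fn.span (Q m ` ary_trees m) = (pbt_dual m :: ((nat list \<Rightarrow>\<^sub>0 'k) \<Rightarrow> 'k) set) \<and>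
     (\<exists>\<Phi> :: ((nat list \<Rightarrow>\<^sub>0 'k) \<Rightarrow> 'k) set \<Rightarrow> ((nat list \<Rightarrow>\<^sub>0 'k) \<Rightarrow> 'k).
       bij_betw \<Phi> (fqsym_dual m // sylvester_rel m) (pbt_dual m) \<and>
       (\<forall>f\<in>fqsym_dual m. \<Phi> (sylvester_rel m `` {f}) = restrict_functional (pbt m) f) \<and>
       (\<forall>\<alpha>\<in>mperms m. \<Phi> (Gbar m \<alpha>) = Q m (sylv m \<alpha>))) \<and>
     (\<forall>T'\<in>ary_trees m. \<forall>T''\<in>ary_trees m.
       fq_mult m (P m T') (P m T'' :: nat list \<Rightarrow>\<^sub>0 'k) =
         (\<Sum>T\<in>{T. mtamari m (lower_bound T' T'') T \<and> mtamari m T (upper_bound m T' T'')}. P m T) \<and>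
       mtamari m (lower_bound T' T'') (upper_bound m T' T'') \<and>
       to_bin (lower_bound T' T'') = glue_left (to_bin T') (to_bin T'') \<and>
       to_bin (upper_bound m T' T'') = glue_right (to_bin T') (to_bin T''))"
proof (intro conjI ballI allI)
  show "real (pm.dim (pbt_deg m n :: (nat list \<Rightarrow>\<^sub>0 'k) set)) =
      1 / (real m * real n + 1) * real (((m + 1) * n) choose n)" for n
    unfolding dim_pbt_deg[OF assms] by (rule card_ary_trees)
  fix T' T'' assume T: "T' \<in> ary_trees m" "T'' \<in> ary_trees m"
  show "mtamari m (lower_bound T' T'') (upper_bound m T' T'')"
    using to_bin_lower_bound[OF T assms] to_bin_upper_bound[OF T assms] tamari_glue
    by (simp add: mtamari_def)
qed (rule inj_on_P[OF assms] independent_P[OF assms] graded_hopf_algebra_pbt[OF assms]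
    Q_P[OF _ _ assms] inj_on_Q[OF assms] independent_Q[OF assms] span_Q[OF assms]
    quotient_iso_pbt_dual[OF assms] fq_mult_P[OF _ _ assms]
    to_bin_lower_bound(2)[OF _ _ assms] to_bin_upper_bound(2)[OF _ _ assms] | assumption)+

end
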